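(* Assume that the inter-arrival times $(Z_n)_{n\ge1}$ are $[0,\infty)$-valued, i.i.d., independent of the service time sequence $(S_n)_{n\in\mathbb{N}}$, with $\mathbb{E}(Z_1^2)<\infty$; that $(S_n)_{n\in\mathbb{N}}$ takes values in $[0,M]$; and that there is $\bar t>0$ with $\Lambda(\bar t)<0$, where $$\Lambda(t)=\limsup_{n\to\infty}\sup_{j\in\mathbb{N}}\frac1n\log\mathbb{E}\left[\exp\left(t\sum_{k=0}^n(S_{k+j}-Z_{k+j+1})\right)\right],\quad t\ge0.$$ Put $\bar\gamma=\exp(\Lambda(\bar t))$ and assume moreover that for some $0<r<1/\bar\gamma$, $$\mathbb{P}\left(Z_1\ge M+\frac{1}{\bar t}\log\left(1+\frac2r\right)\right)>0.$$ Let $W_0=0$ and $W_{n+1}=(W_n+S_n-Z_{n+1})_+$, $n\in\mathbb{N}$. Then: A) If $(S_n)_{n\in\mathbb{N}}$ is strongly mixing, i.e. $\alpha^S(n)\to0$, then $\frac1n\sum_{k=1}^n[W_k-\mathbb{E}(W_k)]\to0$ in $L^1$ as $n\to\infty$. B) If there exist $c>0$ and $\kappa>1$ such that $\alpha^S(n)\le cn^{-\kappa}$, $n\ge1$, then $\frac1n\sum_{k=1}^n[W_k-\mathbb{E}(W_k)]\to0$ almost surely as $n\to\infty$. C) If $\sum_{n\in\mathbb{N}}(n+1)^2\alpha^S(n)^\delta<\infty$ for some $\delta\in(0,1)$, then there exists $\sigma>0$ such that $$\limsup_{n\to\infty}\mathbb{P}\left(\frac{1}{\sqrt n}\left|\sum_{k=1}^n(W_k-\mathbb{E}(W_k))\right|\ge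 a\right)\le\int_{\mathbb{R}}\mathbf{1}_{[-a,a]^c}(\sigma t)\frac{1}{\sqrt{2\pi}}e^{-t^2/2}\,dt,\qquad a>0.$$
   Context: $\mathbb{N}=\{0,1,2,\dots\}$, $x_+=\max(x,0)$, $M>0$ is a constant. Mixing coefficients: $\alpha^S(n)=\sup_{j\in\mathbb{N}}\sup|\mathbb{P}(G\cap H)-\mathbb{P}(G)\mathbb{P}(H)|$, the inner supremum over $G\in\sigma(S_k,0\le k\le j)$ and $H\in\sigma(S_k,k\ge j+n)$, $n\ge0$. *)

theory Defs
  imports "HOL-Probability.Probability"
begin

text \<open>The family of events of the sigma-algebra generated by \<open>X k\<close>, \<open>k \<in> I\<close>.\<close>

definition generated_events ::
  "'a measure \<Rightarrow> (nat \<Rightarrow> 'a \<Rightarrow> real) \<Rightarrow> nat set \<Rightarrow> 'a set set" where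
  "generated_events P X I =
     sigma_sets (space P) (\<Union>k\<in>I. {X k -` A \<inter> space P |A. A \<in> sets borel})"

text \<open>
  Strong mixing coefficients. On a probability space every set of which a supremum is taken
  is nonempty and contained in \<open>[0, 1]\<close>, so the suprema in the reals are genuine.
\<close>

definition alpha_mixing :: "'a measure \<Rightarrow> (nat \<Rightarrow> 'a \<Rightarrow> real) \<Rightarrow> nat \<Rightarrow> real" where
  "alpha_mixing P X n =
     (SUP j. SUP (G, H) \<in> generated_events P X {..j} \<times> generated_events P X {j + n..}.
        \<bar>measure P (G \<inter> H) - measure P G * measure P H\<bar>)"

text \<open>
  The supremum and the limes superior are taken in the extended reals. The term for \<open>n = 0\<close>
  (where \<open>1 / 0 = 0\<close>) does not affect the limes superior. For services in \<open>[0, M]\<close>, nonnegative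
  inter-arrival times and \<open>t \<ge> 0\<close> the integrand is bounded and positive, so the Bochner integral
  is the usual expectation and the logarithm is a genuine one. If moreover the inter-arrival
  times are identically distributed and integrable, Jensen's inequality bounds the limes superior
  from below, so it is finite and \<open>real_of_ereal\<close> may be applied to it.
\<close>

definition log_mgf_rate ::
  "'a measure \<Rightarrow> (nat \<Rightarrow> 'a \<Rightarrow> real) \<Rightarrow> (nat \<Rightarrow> 'a \<Rightarrow> real) \<Rightarrow> real \<Rightarrow> ereal" where
  "log_mgf_rate P S Z t =
     limsup (\<lambda>n. SUP j. ereal (1 / real n *
       ln (\<integral>\<omega>. exp (t * (\<Sum>k=0..n. S (k + j) \<omega> - Z (k + j + 1) \<omega>)) \<partial>P)))"

primrec waiting_time ::
  "(nat \<Rightarrow> 'a \<Rightarrow> real) \<Rightarrow> (nat \<Rightarrow> 'a \<Rightarrow> real) \<Rightarrow> nat \<Rightarrow> 'a \<Rightarrow> real" where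
  "waiting_time S Z 0 \<omega> = 0"
| "waiting_time S Z (Suc n) \<omega> = max (waiting_time S Z n \<omega> + S n \<omega> - Z (Suc n) \<omega>) 0"

text \<open>For services in \<open>[0, M]\<close> and \<open>Z \<ge> 0\<close> one has \<open>0 \<le> waiting_time S Z k \<le> k * M\<close>, so the
  expectations below exist.\<close>

definition centered_sum ::
  "'a measure \<Rightarrow> (nat \<Rightarrow> 'a \<Rightarrow> real) \<Rightarrow> (nat \<Rightarrow> 'a \<Rightarrow> real) \<Rightarrow> nat \<Rightarrow> 'a \<Rightarrow> real" where
  "centered_sum P S Z n \<omega> =
     (\<Sum>k=1..n. waiting_time S Z k \<omega> - (\<integral>\<omega>'. waiting_time S Z k \<omega>' \<partial>P))"

end

theory Submission
  imports Defs "HOL-Real_Asymp.Real_Asymp" "HOL-Library.Discrete_Functions"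
begin

text \<open>
  With \<open>X k = S k - Z (k + 1)\<close> the waiting time is \<open>W k = max\<close> over \<open>i \<le> k\<close> of \<open>X i + \<dots> + X (k - 1)\<close>, and the
  hypothesis \<open>\<Lambda>(t) < 0\<close> makes \<open>E exp (t (X i + \<dots> + X (i + d - 1)))\<close> decay geometrically in \<open>d\<close>, uniformly in \<open>i\<close>.
  Hence \<open>W k\<close> has bounded exponential moments, and the recursion restarted from \<open>0\<close> at time \<open>k - m\<close> agrees
  with \<open>W k\<close> up to an error that is geometrically small in \<open>m\<close>. The mixing coefficients of \<open>X\<close> are
  at most those of \<open>S\<close>, so covariances of \<open>W\<close> are controlled by mixing coefficients plus
  truncation and window errors. This gives A by Chebyshev's inequality, B by summing variances along
  the squares, and C by Bernstein's blocking method: the normalized sums have characteristic functions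
  asymptotic to those of centered normal laws with bounded, possibly oscillating or vanishing, variances, and
  the bound on the tail follows by passing to subsequences and Levy's continuity theorem.
\<close>

section \<open>Mixing coefficients and covariances\<close>

text \<open>The services are not assumed stationary, so every bound has to be uniform in the
  starting time and no limiting variance is available: part C can only compare with a normal law
  whose variance strictly exceeds a common bound of the normalized variances. The second obstacle is
  memory: \<open>W k\<close> depends on its whole past, so a lag \<open>d\<close> gives no gap by
  itself. It has to be divided between a window, over which the restarted recursion forgets its
  start, and a genuine gap, over which mixing acts; half of the lag for each is enough. Thirdly, the
  covariance inequality concerns bounded functions, and the square of the truncation level
  \<open>B\<close> multiplies the mixing coefficient. A level logarithmic in the lag makes the
  truncation error summable at the price of a squared logarithm, which any exponent
  \<open>\<kappa> > 1\<close> absorbs. For C, monotonicity of the coefficients reduces the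
  summability condition to decay of order \<open>1 / n ^ 3\<close>, and the block lengths are tuned
  to this rate.\<close>

definition generated_algebra ::
  "'a measure \<Rightarrow> (nat \<Rightarrow> 'a \<Rightarrow> real) \<Rightarrow> nat set \<Rightarrow> 'a measure" where
  "generated_algebra P X I =
     sigma (space P) (\<Union>k\<in>I. {X k -` A \<inter> space P |A. A \<in> sets borel})"

lemma space_generated_algebra [simp]: "space (generated_algebra P X I) = space P"
  unfolding generated_algebra_def by (rule space_measure_of_conv)

lemma sets_generated_algebra: "sets (generated_algebra P X I) = generated_events P X I"
  unfolding generated_algebra_def generated_events_def by (rule sets_measure_of) auto

lemma generated_events_mono: "I \<subseteq> J \<Longrightarrow> generated_events P X I \<subseteq> generated_events P X J"
  unfolding generated_events_def by (rule sigma_sets_mono') auto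

lemma measurable_generated_algebra_mono:
  "I \<subseteq> J \<Longrightarrow> f \<in> measurable (generated_algebra P X I) N \<Longrightarrow> f \<in> measurable (generated_algebra P X J) N"
  using generated_events_mono[of I J P X]
  by (auto simp: measurable_def sets_generated_algebra)

lemma measurable_generated_algebra: "k \<in> I \<Longrightarrow> X k \<in> borel_measurable (generated_algebra P X I)"
  by (rule measurableI) (auto simp: sets_generated_algebra generated_events_def intro!: sigma_sets.Basic)

lemma generated_events_sets:
  assumes "\<And>k. k \<in> I \<Longrightarrow> X k \<in> borel_measurable P"
  shows "generated_events P X I \<subseteq> sets P"
  unfolding generated_events_def using assms
  by (intro sets.sigma_sets_subset) (auto simp: measurable_sets)

lemma subalgebra_generated_algebra:
  assumes "\<And>k. k \<in> I \<Longrightarrow> X k \<in> borel_measurable P"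
  shows "subalgebra P (generated_algebra P X I)"
  unfolding subalgebra_def using generated_events_sets[OF assms]
  by (simp add: sets_generated_algebra)

text \<open>The sets of this form contain the generators and are closed under complements and
  countable unions. Describing an event by a set \<open>A\<close> of sequences is what later allows
  \<open>Z\<close> to be frozen, so that an event of \<open>S - Z\<close> becomes a shifted event of
  \<open>S\<close>.\<close>

lemma generated_events_eq_vimage_PiM:
  assumes "G \<in> generated_events P X I"
  obtains A where "A \<in> sets (PiM I (\<lambda>_. borel))"
    "G = {\<omega> \<in> space P. (\<lambda>k\<in>I. X k \<omega>) \<in> A}"
proof -
  have "\<exists>A \<in> sets (PiM I (\<lambda>_. borel)). G = {\<omega> \<in> space P. (\<lambda>k\<in>I. X k \<omega>) \<in> A}"
    using assms unfolding generated_events_def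
  proof (induction rule: sigma_sets.induct)
    case (Basic G)
    then obtain k A where "k \<in> I" and A: "A \<in> sets borel" "G = X k -` A \<inter> space P"
      by auto
    then have "{f \<in> space (PiM I (\<lambda>_. borel)). f k \<in> A} \<in> sets (PiM I (\<lambda>_. borel))"
      by measurable
    moreover have "G = {\<omega> \<in> space P. (\<lambda>k\<in>I. X k \<omega>) \<in> {f \<in> space (PiM I (\<lambda>_. borel)). f k \<in> A}}"
      using A \<open>k \<in> I\<close> by (auto simp: space_PiM)
    ultimately show ?case by blast
  next
    case Empty
    then show ?case by (intro bexI[of _ "{}"]) auto
  next
    case (Compl G)
    from Compl.IH obtain A where A: "A \<in> sets (PiM I (\<lambda>_. borel))" "G = {\<omega> \<in> space P. (\<lambda>k\<in>I. X k \<omega>) \<in> A}"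
      by blast
    have "(\<lambda>k\<in>I. X k \<omega>) \<in> space (PiM I (\<lambda>_. borel))" for \<omega>
      by (simp add: space_PiM)
    then have "space P - G = {\<omega> \<in> space P. (\<lambda>k\<in>I. X k \<omega>) \<in> space (PiM I (\<lambda>_. borel)) - A}"
      unfolding A(2) by (simp only: set_eq_iff Diff_iff mem_Collect_eq) metis
    with sets.compl_sets[OF A(1)] show ?case by (intro bexI[of _ "space (PiM I (\<lambda>_. borel)) - A"])
  next
    case (Union G)
    from Union.IH obtain A where A: "\<And>i. A i \<in> sets (PiM I (\<lambda>_. borel))"
      "\<And>i. G i = {\<omega> \<in> space P. (\<lambda>k\<in>I. X k \<omega>) \<in> A i}"
      by (metis (no_types))
    show ?case
    proof (rule bexI)
      show "(\<Union>i. G i) = {\<omega> \<in> space P. (\<lambda>k\<in>I. X k \<omega>) \<in> (\<Union>i. A i)}"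
        unfolding A(2) by blast
    qed (intro sets.countable_UN image_subsetI A(1))
  qed
  then show ?thesis using that by blast
qed

section \<open>Mixing coefficients as suprema, and the covariance inequality for bounded
  functions\<close>

context prob_space
begin

lemma abs_prob_diff_le_1: "\<bar>prob (G \<inter> H) - prob G * prob H\<bar> \<le> 1"
proof -
  have "0 \<le> prob G * prob H" "prob G * prob H \<le> 1"
    by (auto intro: mult_le_one)
  then show ?thesis using prob_le_1[of "G \<inter> H"] measure_nonneg[of M "G \<inter> H"] by linarith
qed

lemma bdd_above_mixing:
  "bdd_above ((\<lambda>(G, H). \<bar>prob (G \<inter> H) - prob G * prob H\<bar>) ` A)"
  using abs_prob_diff_le_1 by (intro bdd_aboveI[of _ 1]) auto

lemma generated_events_nonempty: "{} \<in> generated_events M X I"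
  unfolding generated_events_def by (rule sigma_sets.Empty)

lemma mixing_Sup_le:
  assumes "\<And>G H. G \<in> generated_events M X I \<Longrightarrow> H \<in> generated_events M X J \<Longrightarrow>
    \<bar>prob (G \<inter> H) - prob G * prob H\<bar> \<le> c"
  shows "(SUP (G, H) \<in> generated_events M X I \<times> generated_events M X J.
    \<bar>prob (G \<inter> H) - prob G * prob H\<bar>) \<le> c"
proof (rule cSUP_least)
  show "generated_events M X I \<times> generated_events M X J \<noteq> {}"
    using generated_events_nonempty[of X I] generated_events_nonempty[of X J] by blast
qed (use assms in auto)

lemma alpha_mixing_le:
  assumes "\<And>j G H. G \<in> generated_events M X {..j} \<Longrightarrow> H \<in> generated_events M X {j + n..} \<Longrightarrow>
    \<bar>prob (G \<inter> H) - prob G * prob H\<bar> \<le> c"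
  shows "alpha_mixing M X n \<le> c"
  unfolding alpha_mixing_def by (intro cSUP_least mixing_Sup_le assms) auto

lemma alpha_mixing_ge:
  assumes "G \<in> generated_events M X {..j}" "H \<in> generated_events M X {j + n..}"
  shows "\<bar>prob (G \<inter> H) - prob G * prob H\<bar> \<le> alpha_mixing M X n"
proof -
  have "\<bar>prob (G \<inter> H) - prob G * prob H\<bar> \<le>
    (SUP (G, H) \<in> generated_events M X {..j} \<times> generated_events M X {j + n..}.
      \<bar>prob (G \<inter> H) - prob G * prob H\<bar>)"
    using assms by (intro cSUP_upper2[where x="(G, H)"] bdd_above_mixing) auto
  also have "\<dots> \<le> alpha_mixing M X n"
    unfolding alpha_mixing_def
    by (intro cSUP_upper bdd_aboveI[of _ 1]) (auto intro!: mixing_Sup_le abs_prob_diff_le_1)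
  finally show ?thesis .
qed

lemma alpha_mixing_nonneg: "0 \<le> alpha_mixing M X n"
  using alpha_mixing_ge[OF generated_events_nonempty generated_events_nonempty, of X n] by simp

lemma alpha_mixing_antimono:
  assumes "m \<le> n" shows "alpha_mixing M X n \<le> alpha_mixing M X m"
proof (rule alpha_mixing_le)
  fix j G H assume "G \<in> generated_events M X {..j}" "H \<in> generated_events M X {j + n..}"
  moreover have "generated_events M X {j + n..} \<subseteq> generated_events M X {j + m..}"
    using assms by (intro generated_events_mono) auto
  ultimately show "\<bar>prob (G \<inter> H) - prob G * prob H\<bar> \<le> alpha_mixing M X m"
    by (intro alpha_mixing_ge) auto
qed

text \<open>Layer-cake argument: \<open>f x\<close> is the length of
  \<open>{s. 0 \<le> s \<and> s < f x}\<close>, so by Fubini the integral of \<open>h * f\<close> is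
  an integral over \<open>s\<close> of the integrals of \<open>h\<close> over the level sets
  \<open>s < f x\<close>, which lie in \<open>F\<close>. Only levels in \<open>[0, b]\<close>
  contribute, whence the factor \<open>b\<close>.\<close>

lemma abs_integral_mult_nonneg_le_of_events:
  fixes f h :: "'a \<Rightarrow> real"
  assumes sub: "subalgebra M F" and f: "f \<in> borel_measurable F"
    and range: "\<And>x. x \<in> space M \<Longrightarrow> f x \<in> {0..b}"
    and h: "integrable M h"
    and le: "\<And>G. G \<in> sets F \<Longrightarrow> \<bar>\<integral>x. h x * indicator G x \<partial>M\<bar> \<le> c"
  shows "\<bar>\<integral>x. h x * f x \<partial>M\<bar> \<le> c * b"
proof -
  have fM[measurable]: "f \<in> borel_measurable M" using measurable_from_subalg[OF sub f] .
  have hM[measurable]: "h \<in> borel_measurable M" using h by auto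
  obtain x0 where "x0 \<in> space M" using not_empty by blast
  then have b0: "0 \<le> b" using range[of x0] by auto
  interpret L: pair_sigma_finite M lborel ..
  let ?g = "\<lambda>x s. h x * (indicator {s. 0 \<le> s \<and> s < f x} s :: real)"
  have int: "integrable (M \<Otimes>\<^sub>M lborel) (\<lambda>(x, s). ?g x s)"
  proof (rule L.Fubini_integrable)
    show "(\<lambda>(x, s). ?g x s) \<in> borel_measurable (M \<Otimes>\<^sub>M lborel)"
      unfolding indicator_def by measurable
    have *: "{s. 0 \<le> s \<and> s < f x} = {0..<f x}" for x by auto
    have eq: "(\<integral>s. norm (case (x, s) of (x, s) \<Rightarrow> ?g x s) \<partial>lborel) = \<bar>h x\<bar> * f x"
      if "x \<in> space M" for x
      using range[OF that] by (simp add: abs_mult *)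
    have "integrable M (\<lambda>x. \<bar>h x\<bar> * f x)"
      using range h b0 by (intro Bochner_Integration.integrable_bound[OF integrable_mult_left[OF integrable_abs[OF h], of b]])
        (auto simp: abs_mult intro!: mult_left_mono)
    then show "integrable M (\<lambda>x. \<integral>s. norm (case (x, s) of (x, s) \<Rightarrow> ?g x s) \<partial>lborel)"
      using eq by (subst Bochner_Integration.integrable_cong[OF refl eq]) auto
    show "AE x in M. integrable lborel (\<lambda>s. case (x, s) of (x, s) \<Rightarrow> ?g x s)"
      unfolding * using range by (auto intro!: integrable_mult_right integrable_real_indicator)
  qed
  have "(\<integral>x. h x * f x \<partial>M) = (\<integral>x. (\<integral>s. ?g x s \<partial>lborel) \<partial>M)"
  proof (rule Bochner_Integration.integral_cong[OF refl])
    fix x assume "x \<in> space M"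
    moreover have *: "{s. 0 \<le> s \<and> s < f x} = {0..<f x}" by auto
    ultimately show "h x * f x = (\<integral>s. ?g x s \<partial>lborel)"
      unfolding * using range[of x] by simp
  qed
  also have "\<dots> = (\<integral>s. (\<integral>x. ?g x s \<partial>M) \<partial>lborel)"
    using L.Fubini_integral[OF int] by simp
  finally have eq: "(\<integral>x. h x * f x \<partial>M) = (\<integral>s. (\<integral>x. ?g x s \<partial>M) \<partial>lborel)" .
  have bound: "\<bar>\<integral>x. ?g x s \<partial>M\<bar> \<le> c * indicator {0..b} s" for s
  proof (cases "0 \<le> s \<and> s < b")
    case True
    have "{x \<in> space F. s < f x} \<in> sets F" using f by measurable
    moreover have "space F = space M" using sub by (simp add: subalgebra_def)
    ultimately have "\<bar>\<integral>x. h x * indicator {x \<in> space M. s < f x} x \<partial>M\<bar> \<le> c" using le by auto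
    moreover have "(\<integral>x. h x * indicator {x \<in> space M. s < f x} x \<partial>M) = (\<integral>x. ?g x s \<partial>M)"
      using True by (intro Bochner_Integration.integral_cong) (auto simp: indicator_def)
    ultimately show ?thesis using True by auto
  next
    case False
    then have "(\<integral>x. ?g x s \<partial>M) = (\<integral>x. 0 \<partial>M)"
      using range by (intro Bochner_Integration.integral_cong) (force simp: indicator_def)+
    moreover have "0 \<le> c" using le[of "{}"] by simp
    ultimately show ?thesis by (simp add: indicator_def)
  qed
  have "\<bar>\<integral>s. (\<integral>x. ?g x s \<partial>M) \<partial>lborel\<bar> \<le> (\<integral>s. c * indicator {0..b} s \<partial>lborel)"
    using bound by (intro integral_abs_bound_integral integrable_mult_right integrable_real_indicator
        L.integrable_snd int) (auto simp: case_prod_unfold emeasure_lborel_Icc[OF b0])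
  then show ?thesis unfolding eq using b0 by simp
qed

text \<open>Splitting \<open>f\<close> into its positive and negative part doubles the
  bound.\<close>

lemma abs_integral_mult_le_of_events:
  fixes f h :: "'a \<Rightarrow> real"
  assumes sub: "subalgebra M F" and f: "f \<in> borel_measurable F"
    and range: "\<And>x. x \<in> space M \<Longrightarrow> \<bar>f x\<bar> \<le> b"
    and h: "integrable M h"
    and le: "\<And>G. G \<in> sets F \<Longrightarrow> \<bar>\<integral>x. h x * indicator G x \<partial>M\<bar> \<le> c"
  shows "\<bar>\<integral>x. h x * f x \<partial>M\<bar> \<le> 2 * c * b"
proof -
  have fM[measurable]: "f \<in> borel_measurable M" using measurable_from_subalg[OF sub f] .
  have hM[measurable]: "h \<in> borel_measurable M" using h by auto
  obtain x0 where "x0 \<in> space M" using not_empty by blast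
  then have b0: "0 \<le> b" using range[of x0] by auto
  have int: "integrable M (\<lambda>x. h x * g x)" if [measurable]: "g \<in> borel_measurable M"
    and "\<And>x. x \<in> space M \<Longrightarrow> \<bar>g x\<bar> \<le> b" for g
    using that b0 by (intro Bochner_Integration.integrable_bound[OF integrable_mult_left[OF integrable_abs[OF h], of b]])
        (auto simp: abs_mult intro!: mult_left_mono)
  have "(\<integral>x. h x * f x \<partial>M) = (\<integral>x. h x * max (f x) 0 - h x * max (- f x) 0 \<partial>M)"
    by (intro Bochner_Integration.integral_cong) (auto simp: max_def)
  also have "\<dots> = (\<integral>x. h x * max (f x) 0 \<partial>M) - (\<integral>x. h x * max (- f x) 0 \<partial>M)"
    using b0 by (intro Bochner_Integration.integral_diff int) (auto dest!: range)
  finally have "\<bar>\<integral>x. h x * f x \<partial>M\<bar> \<le> \<bar>\<integral>x. h x * max (f x) 0 \<partial>M\<bar> + \<bar>\<integral>x. h x * max (- f x) 0 \<partial>M\<bar>"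
    by linarith
  also have "\<dots> \<le> c * b + c * b"
    using f b0 by (intro add_mono abs_integral_mult_nonneg_le_of_events[OF sub _ _ h le]) (auto dest!: range)
  finally show ?thesis by (simp add: mult_ac)
qed

text \<open>The preceding bound is used twice: once to pass from events of \<open>F\<close> to
  \<open>f\<close>, with \<open>indicator B - prob B\<close> as the fixed factor, and once to pass
  from events of \<open>G\<close> to \<open>g\<close>, with \<open>f - expectation f\<close> as the
  fixed factor. Each passage costs a factor 2.\<close>

lemma covariance_le_of_events:
  fixes f g :: "'a \<Rightarrow> real"
  assumes F: "subalgebra M F" "f \<in> borel_measurable F" "\<And>x. x \<in> space M \<Longrightarrow> \<bar>f x\<bar> \<le> b"
    and G: "subalgebra M G" "g \<in> borel_measurable G" "\<And>x. x \<in> space M \<Longrightarrow> \<bar>g x\<bar> \<le> d"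
    and le: "\<And>A B. A \<in> sets F \<Longrightarrow> B \<in> sets G \<Longrightarrow> \<bar>prob (A \<inter> B) - prob A * prob B\<bar> \<le> c"
  shows "\<bar>expectation (\<lambda>x. f x * g x) - expectation f * expectation g\<bar> \<le> 4 * c * b * d"
proof -
  have fM[measurable]: "f \<in> borel_measurable M" using measurable_from_subalg[OF F(1,2)] .
  have gM[measurable]: "g \<in> borel_measurable M" using measurable_from_subalg[OF G(1,2)] .
  have fi: "integrable M f" using F(3) by (intro integrable_const_bound[of _ b]) auto
  have gi: "integrable M g" using G(3) by (intro integrable_const_bound[of _ d]) auto
  obtain x0 where "x0 \<in> space M" using not_empty by blast
  then have b0: "0 \<le> b" "0 \<le> d" using F(3)[of x0] G(3)[of x0] by auto
  have fgi: "integrable M (\<lambda>x. f x * g x)"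
    using F(3) G(3) b0 by (intro integrable_const_bound[of _ "b * d"])
      (auto simp: abs_mult intro!: mult_mono)
  have 1: "\<bar>\<integral>x. (indicator B x - prob B) * f x \<partial>M\<bar> \<le> 2 * c * b" if B: "B \<in> sets G" for B
  proof (rule abs_integral_mult_le_of_events[OF F])
    have [measurable]: "B \<in> sets M" using B G(1) by (auto simp: subalgebra_def)
    show "integrable M (\<lambda>x. indicator B x - prob B)" by (auto intro!: integrable_real_indicator simp: emeasure_eq_measure)
    fix A assume A: "A \<in> sets F"
    have [measurable]: "A \<in> sets M" using A F(1) by (auto simp: subalgebra_def)
    have "(\<integral>x. (indicator B x - prob B) * indicator A x \<partial>M) =
      (\<integral>x. indicator (A \<inter> B) x - prob B * indicator A x \<partial>M)"
      by (intro Bochner_Integration.integral_cong) (auto simp: indicator_def)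
    also have "\<dots> = prob (A \<inter> B) - prob B * prob A"
      by (subst Bochner_Integration.integral_diff)
        (auto intro!: integrable_mult_right integrable_real_indicator simp: emeasure_eq_measure)
    finally show "\<bar>\<integral>x. (indicator B x - prob B) * indicator A x \<partial>M\<bar> \<le> c"
      using le[OF A B] by (simp add: mult.commute)
  qed
  have 2: "\<bar>\<integral>x. (f x - expectation f) * g x \<partial>M\<bar> \<le> 2 * (2 * c * b) * d"
  proof (rule abs_integral_mult_le_of_events[OF G])
    show "integrable M (\<lambda>x. f x - expectation f)" using fi by auto
    fix B assume B: "B \<in> sets G"
    have [measurable]: "B \<in> sets M" using B G(1) by (auto simp: subalgebra_def)
    have iB: "integrable M (\<lambda>x. f x * indicator B x)"
      using F(3) b0 by (intro integrable_const_bound[of _ b]) (auto simp: abs_mult indicator_def)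
    have "(\<integral>x. (f x - expectation f) * indicator B x \<partial>M) =
       (\<integral>x. f x * indicator B x - expectation f * indicator B x \<partial>M)"
      by (intro Bochner_Integration.integral_cong) (auto simp: algebra_simps)
    also have "\<dots> = (\<integral>x. f x * indicator B x \<partial>M) - expectation f * prob B"
      using iB by (subst Bochner_Integration.integral_diff)
        (auto intro!: integrable_mult_right integrable_real_indicator simp: emeasure_eq_measure)
    \<comment> \<open>The centering moves from \<open>f\<close> to the indicator: both forms are the
      covariance of \<open>f\<close> and \<open>indicator B\<close>, and the second is the one
      estimated in \<open>1\<close>.\<close>
    also have "\<dots> = (\<integral>x. f x * indicator B x - prob B * f x \<partial>M)"
      using fi iB by (subst Bochner_Integration.integral_diff) auto
    also have "\<dots> = (\<integral>x. (indicator B x - prob B) * f x \<partial>M)"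
      by (intro Bochner_Integration.integral_cong) (auto simp: algebra_simps)
    finally show "\<bar>\<integral>x. (f x - expectation f) * indicator B x \<partial>M\<bar> \<le> 2 * c * b" using 1[OF B] by simp
  qed
  have "(\<integral>x. (f x - expectation f) * g x \<partial>M) = (\<integral>x. f x * g x - expectation f * g x \<partial>M)"
    by (intro Bochner_Integration.integral_cong) (auto simp: algebra_simps)
  also have "\<dots> = expectation (\<lambda>x. f x * g x) - expectation f * expectation g"
    using fgi gi by (subst Bochner_Integration.integral_diff) auto
  finally show ?thesis using 2 by simp
qed

lemma covariance_le_alpha_mixing:
  fixes f g :: "'a \<Rightarrow> real"
  assumes X: "\<And>k. X k \<in> borel_measurable M"
    and f: "f \<in> borel_measurable (generated_algebra M X {..j})" "\<And>x. x \<in> space M \<Longrightarrow> \<bar>f x\<bar> \<le> b"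
    and g: "g \<in> borel_measurable (generated_algebra M X {j + n..})" "\<And>x. x \<in> space M \<Longrightarrow> \<bar>g x\<bar> \<le> d"
  shows "\<bar>expectation (\<lambda>x. f x * g x) - expectation f * expectation g\<bar> \<le> 4 * alpha_mixing M X n * b * d"
  using f g by (intro covariance_le_of_events[OF subalgebra_generated_algebra _ _ subalgebra_generated_algebra])
    (auto simp: X sets_generated_algebra intro!: alpha_mixing_ge)

end

section \<open>Mixing and exponential decay of the increments\<close>

lemma norm_integral_le_integral:
  fixes f :: "'a \<Rightarrow> 'b::{banach, second_countable_topology}"
  assumes "integrable M f" "integrable M g" "\<And>x. x \<in> space M \<Longrightarrow> norm (f x) \<le> g x"
  shows "norm (\<integral>x. f x \<partial>M) \<le> (\<integral>x. g x \<partial>M)"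
  using assms by (intro order_trans[OF integral_norm_bound] integral_mono) auto

text \<open>Fubini for the joint law, which independence makes a product. It does the work of
  conditioning on \<open>X\<close> without conditional expectations.\<close>

lemma (in prob_space) indep_var_expectation_iterated:
  fixes \<Phi> :: "'b \<times> 'b \<Rightarrow> real"
  assumes ind: "indep_var N X L Y" and [measurable]: "\<Phi> \<in> borel_measurable (N \<Otimes>\<^sub>M L)"
    and bound: "\<And>p. \<bar>\<Phi> p\<bar> \<le> c"
  shows "expectation (\<lambda>\<omega>. \<Phi> (X \<omega>, Y \<omega>)) = expectation (\<lambda>\<omega>1. expectation (\<lambda>\<omega>2. \<Phi> (X \<omega>1, Y \<omega>2)))"
proof -
  have [measurable]: "X \<in> measurable M N" "Y \<in> measurable M L"
    using ind by (blast dest: indep_var_rv1 indep_var_rv2)+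
  interpret X: prob_space "distr M N X" by (rule prob_space_distr) simp
  interpret Y: prob_space "distr M L Y" by (rule prob_space_distr) simp
  interpret XY: pair_prob_space "distr M N X" "distr M L Y" ..
  have eq: "distr M N X \<Otimes>\<^sub>M distr M L Y = distr M (N \<Otimes>\<^sub>M L) (\<lambda>x. (X x, Y x))"
    using ind indep_var_distribution_eq by blast
  have "expectation (\<lambda>\<omega>. \<Phi> (X \<omega>, Y \<omega>)) = (\<integral>p. \<Phi> p \<partial>(distr M N X \<Otimes>\<^sub>M distr M L Y))"
    unfolding eq by (subst integral_distr) auto
  also have "\<dots> = (\<integral>x. (\<integral>y. \<Phi> (x, y) \<partial>distr M L Y) \<partial>distr M N X)"
    using bound by (subst XY.integral_fst') (auto intro!: XY.P.integrable_const_bound[of _ c])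
  also have "\<dots> = (\<integral>\<omega>1. (\<integral>y. \<Phi> (X \<omega>1, y) \<partial>distr M L Y) \<partial>M)"
    by (subst integral_distr) auto
  also have "\<dots> = expectation (\<lambda>\<omega>1. expectation (\<lambda>\<omega>2. \<Phi> (X \<omega>1, Y \<omega>2)))"
  proof (rule Bochner_Integration.integral_cong[OF refl])
    fix \<omega>1 assume "\<omega>1 \<in> space M"
    then have "X \<omega>1 \<in> space N" by (rule measurable_space[rotated]) simp
    then have [measurable]: "(\<lambda>y. \<Phi> (X \<omega>1, y)) \<in> borel_measurable L" by measurable
    show "(\<integral>y. \<Phi> (X \<omega>1, y) \<partial>distr M L Y) = expectation (\<lambda>\<omega>2. \<Phi> (X \<omega>1, Y \<omega>2))"
      by (subst integral_distr) auto
  qed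
  finally show ?thesis .
qed

text \<open>Conditionally on the independent sequence \<open>Z\<close>, events of \<open>S - Z\<close> are events of \<open>S\<close>; averaging
  over \<open>Z\<close> does not create dependence because past and future use disjoint sets of coordinates of
  \<open>Z\<close>, which is where \<open>n \<ge> 1\<close> enters.\<close>

lemma (in prob_space) alpha_mixing_diff_indep_le:
  fixes S Z :: "nat \<Rightarrow> 'a \<Rightarrow> real"
  assumes S[measurable]: "\<And>k. S k \<in> borel_measurable M"
    and Z: "indep_vars (\<lambda>_. borel) Z {1..}"
    and ZS: "indep_var (PiM {1..} (\<lambda>_. borel)) (\<lambda>\<omega>. \<lambda>k\<in>{1..}. Z k \<omega>) (PiM UNIV (\<lambda>_. borel)) (\<lambda>\<omega> k. S k \<omega>)"
    and n: "n \<ge> 1"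
  shows "alpha_mixing M (\<lambda>k \<omega>. S k \<omega> - Z (Suc k) \<omega>) n \<le> alpha_mixing M S n"
proof (rule alpha_mixing_le)
  let ?X = "\<lambda>k \<omega>. S k \<omega> - Z (Suc k) \<omega>"
  let ?Z = "\<lambda>K \<omega>. \<lambda>k\<in>K. Z k \<omega>"
  fix j G H
  define I J where "I = {..j}" and "J = {j + n..}"
  assume GH: "G \<in> generated_events M ?X {..j}" "H \<in> generated_events M ?X {j + n..}"
  obtain A where A[measurable]: "A \<in> sets (PiM I (\<lambda>_. borel))"
    and G: "G = {\<omega> \<in> space M. (\<lambda>k\<in>I. ?X k \<omega>) \<in> A}"
    unfolding I_def by (rule generated_events_eq_vimage_PiM[OF GH(1)])
  obtain B where B[measurable]: "B \<in> sets (PiM J (\<lambda>_. borel))"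
    and H: "H = {\<omega> \<in> space M. (\<lambda>k\<in>J. ?X k \<omega>) \<in> B}"
    unfolding J_def by (rule generated_events_eq_vimage_PiM[OF GH(2)])
  have Zm[measurable]: "Z k \<in> borel_measurable M" if "k \<ge> 1" for k
    using Z that by (auto simp: indep_vars_def)
  have Zm'[measurable]: "Z (Suc k) \<in> borel_measurable M" for k
    by (rule Zm) simp
  define \<phi> where "\<phi> K D z s = (indicator D (\<lambda>k\<in>K. s k - z (Suc k)) :: real)"
    for K :: "nat set" and D and z s :: "nat \<Rightarrow> real"
  have \<phi>_range: "\<phi> K D z s \<in> {0..1}" for K D z s by (simp add: \<phi>_def)
  have \<phi>_restrict: "\<phi> K D (?Z L \<omega>) s = \<phi> K D (\<lambda>k. Z k \<omega>) s" if "Suc ` K \<subseteq> L" for K D L \<omega> s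
    using that unfolding \<phi>_def by (intro arg_cong[of _ _ "indicator D"]) (auto intro!: restrict_ext)
  have comp: "(\<lambda>p. \<lambda>k\<in>K. snd p k - fst p (Suc k)) \<in> measurable
      (PiM {1..} (\<lambda>_. borel) \<Otimes>\<^sub>M PiM UNIV (\<lambda>_. borel)) (PiM K (\<lambda>_. borel :: real measure))" for K
    by (intro measurable_restrict borel_measurable_diff
        measurable_compose[OF measurable_snd] measurable_compose[OF measurable_fst]) auto
  have comp2: "(\<lambda>p. \<lambda>k\<in>K. S k (snd p) - fst p (Suc k)) \<in> measurable
      (PiM L (\<lambda>_. borel) \<Otimes>\<^sub>M M) (PiM K (\<lambda>_. borel :: real measure))" if "Suc ` K \<subseteq> L" for K L
    using that by (intro measurable_restrict borel_measurable_diff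
        measurable_compose[OF measurable_snd] measurable_compose[OF measurable_fst]) auto
  have Suc_image: "Suc ` K \<subseteq> {1..}" for K by auto
  \<comment> \<open>The probabilities of \<open>G\<close>, \<open>H\<close> and
    \<open>G \<inter> H\<close> when the inter-arrival times are frozen at \<open>z\<close>.\<close>
  define a b c where "a z = expectation (\<lambda>\<omega>. \<phi> I A z (\<lambda>k. S k \<omega>))"
    and "b z = expectation (\<lambda>\<omega>. \<phi> J B z (\<lambda>k. S k \<omega>))"
    and "c z = expectation (\<lambda>\<omega>. \<phi> I A z (\<lambda>k. S k \<omega>) * \<phi> J B z (\<lambda>k. S k \<omega>))" for z
  have am: "a \<in> borel_measurable (PiM L (\<lambda>_. borel))" if "Suc ` I \<subseteq> L" for L
    using measurable_compose[OF comp2[OF that] borel_measurable_indicator[OF A]]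
    unfolding a_def \<phi>_def by (intro borel_measurable_lebesgue_integral) (simp add: case_prod_unfold)
  have bm: "b \<in> borel_measurable (PiM L (\<lambda>_. borel))" if "Suc ` J \<subseteq> L" for L
    using measurable_compose[OF comp2[OF that] borel_measurable_indicator[OF B]]
    unfolding b_def \<phi>_def by (intro borel_measurable_lebesgue_integral) (simp add: case_prod_unfold)
  have cm: "c \<in> borel_measurable (PiM {1..} (\<lambda>_. borel))"
    using measurable_compose[OF comp2 borel_measurable_indicator[OF A], of "{1..}"]
      measurable_compose[OF comp2 borel_measurable_indicator[OF B], of "{1..}"]
    unfolding c_def \<phi>_def by (intro borel_measurable_lebesgue_integral) (auto simp: case_prod_unfold intro!: borel_measurable_times)
  \<comment> \<open>For frozen \<open>z\<close> the subtraction is a measurable map of the services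
    with indices in \<open>K\<close>, so the shifted event belongs to \<open>S\<close>
    alone.\<close>
  have \<phi>S: "{\<omega> \<in> space M. (\<lambda>k\<in>K. S k \<omega> - z (Suc k)) \<in> D} \<in> generated_events M S K"
    if D: "D \<in> sets (PiM K (\<lambda>_. borel))" for K D and z :: "nat \<Rightarrow> real"
  proof -
    have "(\<lambda>\<omega>. \<lambda>k\<in>K. S k \<omega> - z (Suc k)) \<in> measurable (generated_algebra M S K) (PiM K (\<lambda>_. borel))"
      by (intro measurable_restrict borel_measurable_diff measurable_generated_algebra) auto
    from measurable_sets[OF this D] show ?thesis
      by (simp add: sets_generated_algebra vimage_def Int_def conj_commute)
  qed
  have a_eq: "a z = prob {\<omega> \<in> space M. (\<lambda>k\<in>I. S k \<omega> - z (Suc k)) \<in> A}" (is "_ = prob (?A z)")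
   and b_eq: "b z = prob {\<omega> \<in> space M. (\<lambda>k\<in>J. S k \<omega> - z (Suc k)) \<in> B}" (is "_ = prob (?B z)")
   and c_eq: "c z = prob ({\<omega> \<in> space M. (\<lambda>k\<in>I. S k \<omega> - z (Suc k)) \<in> A} \<inter>
        {\<omega> \<in> space M. (\<lambda>k\<in>J. S k \<omega> - z (Suc k)) \<in> B})" for z
  proof -
    have sets: "?A z \<in> sets M" "?B z \<in> sets M"
      using \<phi>S[OF A] \<phi>S[OF B] generated_events_sets[of _ S M] S by blast+
    have "a z = expectation (indicator (?A z))" "b z = expectation (indicator (?B z))"
      "c z = expectation (indicator (?A z \<inter> ?B z))"
      unfolding a_def b_def c_def \<phi>_def
      by (intro Bochner_Integration.integral_cong; simp add: indicator_def of_bool_conj del: restrict_apply restrict_apply')+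
    then show "a z = prob (?A z)" "b z = prob (?B z)" "c z = prob (?A z \<inter> ?B z)"
      using sets by auto
  qed
  have abc: "\<bar>c z - a z * b z\<bar> \<le> alpha_mixing M S n" for z
    unfolding a_eq b_eq c_eq using \<phi>S[OF A] \<phi>S[OF B] unfolding I_def J_def by (intro alpha_mixing_ge)
  have ranges: "a z \<in> {0..1}" "b z \<in> {0..1}" "c z \<in> {0..1}" for z
    unfolding a_eq b_eq c_eq by auto
  have meas: "random_variable (PiM L (\<lambda>_. borel)) (?Z L)" if "L \<subseteq> {1..}" for L
    using that by (intro measurable_restrict) auto
  have PG: "prob G = expectation (\<lambda>\<omega>. a (?Z {1..} \<omega>))"
  proof -
    have "prob G = expectation (\<lambda>\<omega>. (\<lambda>(z, s). \<phi> I A z s) (?Z {1..} \<omega>, \<lambda>k. S k \<omega>))"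
    proof -
      have "G \<in> sets M" unfolding G using A by measurable
      then have "prob G = expectation (indicator G)" by simp
      also have "\<dots> = expectation (\<lambda>\<omega>. (\<lambda>(z, s). \<phi> I A z s) (?Z {1..} \<omega>, \<lambda>k. S k \<omega>))"
        by (intro Bochner_Integration.integral_cong)
          (auto simp: \<phi>_restrict G \<phi>_def indicator_def)
      finally show ?thesis .
    qed
    also have "\<dots> = expectation (\<lambda>\<omega>. a (?Z {1..} \<omega>))"
      using measurable_compose[OF comp borel_measurable_indicator[OF A]] \<phi>_range
      unfolding a_def by (subst indep_var_expectation_iterated[OF ZS, where c=1])
        (auto simp: \<phi>_def case_prod_unfold)
    finally show ?thesis .
  qed
  have PH: "prob H = expectation (\<lambda>\<omega>. b (?Z {1..} \<omega>))"
  proof -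
    have "prob H = expectation (\<lambda>\<omega>. (\<lambda>(z, s). \<phi> J B z s) (?Z {1..} \<omega>, \<lambda>k. S k \<omega>))"
    proof -
      have "H \<in> sets M" unfolding H using B by measurable
      then have "prob H = expectation (indicator H)" by simp
      also have "\<dots> = expectation (\<lambda>\<omega>. (\<lambda>(z, s). \<phi> J B z s) (?Z {1..} \<omega>, \<lambda>k. S k \<omega>))"
        by (intro Bochner_Integration.integral_cong)
          (auto simp: \<phi>_restrict H \<phi>_def indicator_def)
      finally show ?thesis .
    qed
    also have "\<dots> = expectation (\<lambda>\<omega>. b (?Z {1..} \<omega>))"
      using measurable_compose[OF comp borel_measurable_indicator[OF B]] \<phi>_range
      unfolding b_def by (subst indep_var_expectation_iterated[OF ZS, where c=1])
        (auto simp: \<phi>_def case_prod_unfold)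
    finally show ?thesis .
  qed
  have PGH: "prob (G \<inter> H) = expectation (\<lambda>\<omega>. c (?Z {1..} \<omega>))"
  proof -
    have "prob (G \<inter> H) = expectation (\<lambda>\<omega>. (\<lambda>(z, s). \<phi> I A z s * \<phi> J B z s) (?Z {1..} \<omega>, \<lambda>k. S k \<omega>))"
    proof -
      have "G \<in> sets M" "H \<in> sets M" unfolding G H using A B by measurable
      then have "prob (G \<inter> H) = expectation (indicator (G \<inter> H))" by simp
      also have "\<dots> = expectation (\<lambda>\<omega>. (\<lambda>(z, s). \<phi> I A z s * \<phi> J B z s) (?Z {1..} \<omega>, \<lambda>k. S k \<omega>))"
        by (intro Bochner_Integration.integral_cong)
          (auto simp: \<phi>_restrict G H \<phi>_def indicator_def)
      finally show ?thesis .
    qed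
    also have "\<dots> = expectation (\<lambda>\<omega>. c (?Z {1..} \<omega>))"
      using measurable_compose[OF comp borel_measurable_indicator[OF A]]
        measurable_compose[OF comp borel_measurable_indicator[OF B]]
      unfolding c_def by (subst indep_var_expectation_iterated[OF ZS, where c=1])
        (auto simp: \<phi>_def case_prod_unfold indicator_def[abs_def] intro!: borel_measurable_times)
    finally show ?thesis .
  qed
  have "indep_var borel (a \<circ> ?Z (Suc ` I)) borel (b \<circ> ?Z (Suc ` J))"
    \<comment> \<open>\<open>a\<close> reads \<open>Z\<close> at the indices 1 to
      \<open>j + 1\<close>, \<open>b\<close> from \<open>j + n + 1\<close> on;
      \<open>n \<ge> 1\<close> makes these index sets disjoint.\<close>
    using n by (intro indep_var_compose[OF indep_var_restrict[OF Z]] am bm) (auto simp: I_def J_def)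
  moreover have "a \<circ> ?Z (Suc ` I) = (\<lambda>\<omega>. a (?Z {1..} \<omega>))" "b \<circ> ?Z (Suc ` J) = (\<lambda>\<omega>. b (?Z {1..} \<omega>))"
    by (simp_all only: a_def b_def comp_def \<phi>_restrict subset_refl Suc_image)
  ultimately have ind: "indep_var borel (\<lambda>\<omega>. a (?Z {1..} \<omega>)) borel (\<lambda>\<omega>. b (?Z {1..} \<omega>))"
    by simp
  have int: "integrable M (\<lambda>\<omega>. a (?Z {1..} \<omega>))" "integrable M (\<lambda>\<omega>. b (?Z {1..} \<omega>))"
    "integrable M (\<lambda>\<omega>. c (?Z {1..} \<omega>))"
    using ranges by (intro integrable_const_bound[of _ 1] measurable_compose[OF meas am]
      measurable_compose[OF meas bm] measurable_compose[OF meas cm]; force)+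
  have intab: "integrable M (\<lambda>\<omega>. a (?Z {1..} \<omega>) * b (?Z {1..} \<omega>))"
    by (rule indep_var_integrable[OF ind int(1,2)])
  \<comment> \<open>By independence \<open>prob G * prob H\<close> is the mean of the product
    \<open>a * b\<close>, so only the mean of the conditional covariance \<open>c - a * b\<close> is
    left.\<close>
  have eq: "prob (G \<inter> H) - prob G * prob H = expectation (\<lambda>\<omega>. c (?Z {1..} \<omega>) - a (?Z {1..} \<omega>) * b (?Z {1..} \<omega>))"
    unfolding PG PH PGH using int intab indep_var_lebesgue_integral[OF ind int(1,2)] by simp
  have "\<bar>prob (G \<inter> H) - prob G * prob H\<bar> \<le> expectation (\<lambda>\<omega>. alpha_mixing M S n)"
    unfolding eq real_norm_def[symmetric] by (rule norm_integral_le_integral) (simp_all only: real_norm_def abc int intab integrable_const Bochner_Integration.integrable_diff)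
  then show "\<bar>prob (G \<inter> H) - prob G * prob H\<bar> \<le> alpha_mixing M S n"
    by (simp add: prob_space)
qed

text \<open>A negative limes superior leaves room for some \<open>z < 0\<close> that bounds the rate
  for all large \<open>n\<close>, uniformly in the starting index because of the supremum over
  \<open>j\<close>. Short stretches are handled by the deterministic bound \<open>K\<close> on each
  increment.\<close>

lemma (in prob_space) exponential_decay_of_log_mgf_rate:
  fixes S Z :: "nat \<Rightarrow> 'a \<Rightarrow> real"
  assumes S[measurable]: "\<And>k. S k \<in> borel_measurable M"
    and S_range: "\<And>k \<omega>. \<omega> \<in> space M \<Longrightarrow> S k \<omega> \<in> {0..K}"
    and Z: "\<And>k. k \<ge> 1 \<Longrightarrow> Z k \<in> borel_measurable M"
    and Z_range: "\<And>k \<omega>. k \<ge> 1 \<Longrightarrow> \<omega> \<in> space M \<Longrightarrow> Z k \<omega> \<in> {0..}"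
    and t: "t > 0" and rate: "log_mgf_rate M S Z t < 0"
  shows "\<exists>C \<rho>. 0 < \<rho> \<and> \<rho> < 1 \<and>
     (\<forall>i d. expectation (\<lambda>\<omega>. exp (t * (\<Sum>l\<in>{i..<i + d}. S l \<omega> - Z (Suc l) \<omega>))) \<le> C * \<rho> ^ d)"
    and "integrable M (\<lambda>\<omega>. exp (t * (\<Sum>l\<in>{i..<i + d}. S l \<omega> - Z (Suc l) \<omega>)))"
proof -
  have [measurable]: "Z (Suc k) \<in> borel_measurable M" for k by (rule Z) simp
  let ?e = "\<lambda>i d \<omega>. exp (t * (\<Sum>l\<in>{i..<i + d}. S l \<omega> - Z (Suc l) \<omega>))"
  have K: "0 \<le> K" using not_empty S_range by fastforce
  have le: "?e i d \<omega> \<le> exp (t * (d * K))" if "\<omega> \<in> space M" for i d \<omega>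
  proof -
    have "(\<Sum>l\<in>{i..<i + d}. S l \<omega> - Z (Suc l) \<omega>) \<le> (\<Sum>l\<in>{i..<i + d}. K)"
    proof (rule sum_mono)
      fix l show "S l \<omega> - Z (Suc l) \<omega> \<le> K" using S_range[OF that, of l] Z_range[OF _ that, of "Suc l"] by auto
    qed
    then show ?thesis using t by simp
  qed
  show int: "integrable M (?e i d)" for i d
    using le[of _ i d] by (intro integrable_const_bound[of _ "exp (t * (d * K))"]) auto
  obtain z where z: "log_mgf_rate M S Z t < ereal z" "ereal z < 0"
    using ereal_dense2[OF rate] by blast
  have "eventually (\<lambda>n. (SUP j. ereal (1 / real n *
       ln (\<integral>\<omega>. exp (t * (\<Sum>k=0..n. S (k + j) \<omega> - Z (k + j + 1) \<omega>)) \<partial>M))) < ereal z) sequentially"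
    using z(1) unfolding log_mgf_rate_def by (rule Limsup_lessD)
  then obtain N where N: "\<And>n. n \<ge> N \<Longrightarrow> (SUP j. ereal (1 / real n *
       ln (\<integral>\<omega>. exp (t * (\<Sum>k=0..n. S (k + j) \<omega> - Z (k + j + 1) \<omega>)) \<partial>M))) < ereal z"
    unfolding eventually_sequentially by blast
  define \<rho> where "\<rho> = exp z"
  have \<rho>: "0 < \<rho>" "\<rho> < 1" using z unfolding \<rho>_def by auto
  \<comment> \<open>The numerator bounds all stretches of length up to \<open>N + 1\<close>, and
    dividing by \<open>\<rho> ^ (N + 1)\<close> makes \<open>C * \<rho> ^ d\<close> dominate it
    there. It also yields \<open>1 / \<rho> \<le> C\<close>, which pays for the off-by-one in longer
    stretches.\<close>
  define C where "C = exp (t * ((N + 1) * K)) / \<rho> ^ (N + 1)"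
  \<comment> \<open>The rate divides the logarithm for a sum of \<open>n + 1\<close> increments by
    \<open>n\<close>, so a stretch of length \<open>Suc n\<close> gets only
    \<open>\<rho> ^ n\<close>. The condition \<open>n \<ge> 1\<close> excludes the default value of
    \<open>1 / 0\<close>.\<close>
  have large: "expectation (?e i (Suc n)) \<le> \<rho> ^ n" if n: "n \<ge> N" "n \<ge> 1" for i n
  proof -
    have "(\<Sum>k=0..n. S (k + i) \<omega> - Z (k + i + 1) \<omega>) = (\<Sum>l\<in>{i..<i + Suc n}. S l \<omega> - Z (Suc l) \<omega>)" for \<omega>
      using sum.shift_bounds_nat_ivl[of "\<lambda>l. S l \<omega> - Z (Suc l) \<omega>" 0 i "Suc n"]
      by (simp add: atLeastLessThanSuc_atLeastAtMost add.commute)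
    then have "ereal (1 / real n * ln (expectation (?e i (Suc n)))) \<le> (SUP j. ereal (1 / real n *
       ln (\<integral>\<omega>. exp (t * (\<Sum>k=0..n. S (k + j) \<omega> - Z (k + j + 1) \<omega>)) \<partial>M)))"
      by (intro SUP_upper2[of i]) (simp_all del: sum.op_ivl_Suc)
    then have "1 / real n * ln (expectation (?e i (Suc n))) < z"
      by (metis (no_types, lifting) N[OF n(1)] le_less_trans less_ereal.simps(1))
    then have "ln (expectation (?e i (Suc n))) < n * z" using n by (simp add: field_simps)
    moreover have "0 < expectation (?e i (Suc n))"
      using int[of i "Suc n"] by (intro expectation_greater) auto
    ultimately have "expectation (?e i (Suc n)) < exp (n * z)"
      using exp_less_mono[of "ln (expectation (?e i (Suc n)))" "n * z"] by simp
    then show ?thesis unfolding \<rho>_def by (simp add: exp_of_nat_mult)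
  qed
  have "expectation (?e i d) \<le> C * \<rho> ^ d" for i d
  proof (cases "d \<le> N + 1")
    case True
    have "expectation (?e i d) \<le> expectation (\<lambda>_. exp (t * (d * K)))"
      using int le by (intro integral_mono) auto
    also have "\<dots> = exp (t * (d * K))" by (simp add: prob_space)
    also have "\<dots> \<le> exp (t * ((N + 1) * K))"
      using True t K by (auto intro!: mult_mono)
    also have "\<dots> = C * \<rho> ^ (N + 1)" unfolding C_def using \<rho> by simp
    also have "\<dots> \<le> C * \<rho> ^ d" using True \<rho> unfolding C_def
      by (intro mult_left_mono power_decreasing) auto
    finally show ?thesis .
  next
    case False
    then obtain n where n: "d = Suc n" "n \<ge> N" "n \<ge> 1" by (cases d) auto
    have "expectation (?e i d) \<le> \<rho> ^ n" using large n by simp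
    also have "\<dots> = \<rho> ^ d * (1 / \<rho>)" using n \<rho> by simp
    also have "1 / \<rho> \<le> C"
    proof -
      have "1 / \<rho> ^ 1 \<le> 1 / \<rho> ^ (N + 1)" using \<rho> by (intro divide_left_mono power_decreasing) auto
      also have "\<dots> \<le> C" unfolding C_def using t K \<rho> by (intro divide_right_mono) auto
      finally show ?thesis by simp
    qed
    finally show ?thesis using \<rho> by (simp add: mult.commute)
  qed
  then show "\<exists>C \<rho>. 0 < \<rho> \<and> \<rho> < 1 \<and> (\<forall>i d. expectation (?e i d) \<le> C * \<rho> ^ d)" using \<rho> by blast
qed

section \<open>Lindley's recursion\<close>

text \<open>A single term of the exponential series; it turns exponential moments into moments of
  every order.\<close>

lemma power_le_exp:
  fixes x :: real assumes "0 \<le> x" shows "x ^ p \<le> fact p * exp x"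
proof -
  have s: "(\<lambda>n. x ^ n /\<^sub>R fact n) sums exp x" by (rule exp_converges)
  have "(\<Sum>n\<in>{p}. x ^ n /\<^sub>R fact n) \<le> (\<Sum>n. x ^ n /\<^sub>R fact n)"
    using assms by (intro sum_le_suminf sums_summable[OF s]) auto
  then show ?thesis using sums_unique[OF s] by (simp add: field_simps)
qed

text \<open>Starting time and duration are separate arguments, so that the waiting time and its
  restarted versions are values of one function.\<close>

primrec lindley :: "(nat \<Rightarrow> 'a \<Rightarrow> real) \<Rightarrow> nat \<Rightarrow> nat \<Rightarrow> 'a \<Rightarrow> real" where
  "lindley X i 0 \<omega> = 0"
| "lindley X i (Suc d) \<omega> = max (lindley X i d \<omega> + X (i + d) \<omega>) 0"

lemma lindley_nonneg: "0 \<le> lindley X i d \<omega>"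
  by (cases d) auto

text \<open>Two runs of the recursion with the same increments merge once the larger one is
  reflected at 0; until then the larger one is the free walk. The maximum covers both cases.\<close>

lemma lindley_add:
  "lindley X 0 (a + d) \<omega> = max (lindley X a d \<omega>) (lindley X 0 a \<omega> + (\<Sum>l\<in>{a..<a + d}. X l \<omega>))"
proof (induction d)
  case 0
  then show ?case using lindley_nonneg[of X 0 a \<omega>] by auto
next
  case (Suc d)
  then show ?case by (auto simp: max_def)
qed

text \<open>The exponential of a maximum is at most the sum of the exponentials. Along the recursion
  this reads \<open>exp (max y 0) \<le> exp y + 1\<close>, where the 1 is the new empty sum
  \<open>i = Suc a\<close>.\<close>

lemma exp_lindley_le_sum:
  assumes "0 < t"
  shows "exp (t * lindley X 0 a \<omega>) \<le> (\<Sum>i\<le>a. exp (t * (\<Sum>l\<in>{i..<a}. X l \<omega>)))"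
proof (induction a)
  case 0
  then show ?case by simp
next
  case (Suc a)
  have "exp (t * lindley X 0 (Suc a) \<omega>) \<le> exp (t * lindley X 0 a \<omega>) * exp (t * X a \<omega>) + 1"
    by (auto simp: max_def exp_add[symmetric] algebra_simps)
  also have "\<dots> \<le> (\<Sum>i\<le>a. exp (t * (\<Sum>l\<in>{i..<a}. X l \<omega>))) * exp (t * X a \<omega>) + 1"
    using Suc.IH by (intro add_mono mult_right_mono) auto
  also have "\<dots> = (\<Sum>i\<le>Suc a. exp (t * (\<Sum>l\<in>{i..<Suc a}. X l \<omega>)))"
    by (auto simp: sum_distrib_right exp_add[symmetric] distrib_left intro!: sum.cong)
  finally show ?case .
qed

lemma lindley_measurable:
  "lindley X i d \<in> borel_measurable (generated_algebra M X {i..<i + d})"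
proof (induction d)
  case 0
  then show ?case by simp
next
  case (Suc d)
  have [measurable]: "lindley X i d \<in> borel_measurable (generated_algebra M X {i..<i + Suc d})"
    using Suc by (rule measurable_generated_algebra_mono[rotated]) auto
  have [measurable]: "X (i + d) \<in> borel_measurable (generated_algebra M X {i..<i + Suc d})"
    by (rule measurable_generated_algebra) auto
  show ?case unfolding lindley.simps by measurable
qed

section \<open>Exponential moments, restart error and covariances of the waiting times\<close>

locale lindley_walk = prob_space +
  fixes X :: "nat \<Rightarrow> 'a \<Rightarrow> real" and t C \<rho> :: real
  assumes X_measurable [measurable]: "\<And>k. X k \<in> borel_measurable M"
    and t_pos: "0 < t" and \<rho>: "0 < \<rho>" "\<rho> < 1"
    and exp_integrable: "\<And>i d. integrable M (\<lambda>\<omega>. exp (t * (\<Sum>l\<in>{i..<i + d}. X l \<omega>)))"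
    and exp_decay: "\<And>i d. expectation (\<lambda>\<omega>. exp (t * (\<Sum>l\<in>{i..<i + d}. X l \<omega>))) \<le> C * \<rho> ^ d"
begin

abbreviation W :: "nat \<Rightarrow> 'a \<Rightarrow> real" where
  "W k \<equiv> lindley X 0 k"

text \<open>For \<open>k \<le> m\<close> truncated subtraction makes the start 0 and the duration
  \<open>k\<close>, so that \<open>V m k = W k\<close>.\<close>

definition V :: "nat \<Rightarrow> nat \<Rightarrow> 'a \<Rightarrow> real" where
  "V m k = lindley X (k - m) (min m k)"

text \<open>The geometric series over the possible starting points of a partial sum; it bounds
  \<open>expectation (\<lambda>\<omega>. exp (t * W k \<omega>))\<close> uniformly in
  \<open>k\<close>.\<close>

definition D :: real where "D = C / (1 - \<rho>)"

lemma W_nonneg: "0 \<le> W k \<omega>" and V_nonneg: "0 \<le> V m k \<omega>"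
  unfolding V_def by (rule lindley_nonneg)+

lemma lindley_measurable_M [measurable]: "lindley X i d \<in> borel_measurable M"
  by (rule measurable_from_subalg[OF subalgebra_generated_algebra lindley_measurable]) auto

lemma V_measurable_M [measurable]: "V m k \<in> borel_measurable M"
  unfolding V_def by simp

lemma V_measurable:
  "V m k \<in> borel_measurable (generated_algebra M X {k - m..<k})"
proof -
  have "k - m + min m k = k" by auto
  then show ?thesis
    unfolding V_def using lindley_measurable[of X "k - m" "min m k"] by simp
qed

text \<open>Appending \<open>d\<close> further increments lengthens every partial sum in
  \<open>exp_lindley_le_sum\<close> by \<open>d\<close>, which factors out \<open>\<rho> ^ d\<close>
  and leaves a geometric series in \<open>a - i\<close>. The case \<open>d = 0\<close> gives the
  moments of \<open>W\<close>, the case \<open>d = m\<close> the restart error.\<close>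

lemma exp_W_add:
  "integrable M (\<lambda>\<omega>. exp (t * (W a \<omega> + (\<Sum>l\<in>{a..<a + d}. X l \<omega>))))"
  "expectation (\<lambda>\<omega>. exp (t * (W a \<omega> + (\<Sum>l\<in>{a..<a + d}. X l \<omega>)))) \<le> D * \<rho> ^ d"
proof -
  let ?s = "\<lambda>i \<omega>. exp (t * (\<Sum>l\<in>{i..<a + d}. X l \<omega>))"
  have int: "integrable M (?s i)" and le: "expectation (?s i) \<le> C * \<rho> ^ (a - i) * \<rho> ^ d" if "i \<le> a" for i
    using exp_integrable[of i "a - i + d"] exp_decay[of i "a - i + d"] that power_add[of \<rho> "a - i" d]
    by (simp_all add: mult_ac)
  have C0: "0 \<le> C" using exp_decay[of 0 0] by (simp add: prob_space)
  have pointwise: "exp (t * (W a \<omega> + (\<Sum>l\<in>{a..<a + d}. X l \<omega>))) \<le> (\<Sum>i\<le>a. ?s i \<omega>)" for \<omega>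
  proof -
    have "exp (t * (W a \<omega> + (\<Sum>l\<in>{a..<a + d}. X l \<omega>))) =
        exp (t * W a \<omega>) * exp (t * (\<Sum>l\<in>{a..<a + d}. X l \<omega>))"
      by (simp add: exp_add[symmetric] distrib_left)
    also have "\<dots> \<le> (\<Sum>i\<le>a. exp (t * (\<Sum>l\<in>{i..<a}. X l \<omega>))) * exp (t * (\<Sum>l\<in>{a..<a + d}. X l \<omega>))"
      by (intro mult_right_mono exp_lindley_le_sum t_pos) auto
    also have "\<dots> = (\<Sum>i\<le>a. ?s i \<omega>)"
      unfolding sum_distrib_right
      by (intro sum.cong refl)
        (simp add: exp_add[symmetric] distrib_left[symmetric] sum.atLeastLessThan_concat)
    finally show ?thesis .
  qed
  show int': "integrable M (\<lambda>\<omega>. exp (t * (W a \<omega> + (\<Sum>l\<in>{a..<a + d}. X l \<omega>))))"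
  proof (rule Bochner_Integration.integrable_bound)
    show "integrable M (\<lambda>\<omega>. \<Sum>i\<le>a. ?s i \<omega>)" using int by auto
    show "AE \<omega> in M. norm (exp (t * (W a \<omega> + (\<Sum>l\<in>{a..<a + d}. X l \<omega>)))) \<le> norm (\<Sum>i\<le>a. ?s i \<omega>)"
      using pointwise by (intro AE_I2) (simp, smt (verit, best) pointwise)
  qed simp
  have "expectation (\<lambda>\<omega>. exp (t * (W a \<omega> + (\<Sum>l\<in>{a..<a + d}. X l \<omega>)))) \<le> expectation (\<lambda>\<omega>. \<Sum>i\<le>a. ?s i \<omega>)"
    using int' int pointwise by (intro integral_mono) auto
  also have "\<dots> = (\<Sum>i\<le>a. expectation (?s i))"
    using int by (intro Bochner_Integration.integral_sum) auto
  also have "\<dots> \<le> (\<Sum>i\<le>a. C * \<rho> ^ (a - i) * \<rho> ^ d)" by (intro sum_mono le) auto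
  also have "\<dots> = C * \<rho> ^ d * (\<Sum>i\<le>a. \<rho> ^ (a - i))" by (simp add: sum_distrib_left mult_ac)
  also have "(\<Sum>i\<le>a. \<rho> ^ (a - i)) = (\<Sum>i\<le>a. \<rho> ^ i)"
    by (rule sum.reindex_bij_witness[of _ "\<lambda>i. a - i" "\<lambda>i. a - i"]) auto
  also have "C * \<rho> ^ d * (\<Sum>i\<le>a. \<rho> ^ i) \<le> C * \<rho> ^ d * (1 / (1 - \<rho>))"
  proof (rule mult_left_mono)
    have "(\<Sum>i\<in>{..a}. \<rho> ^ i) \<le> (\<Sum>i. \<rho> ^ i)"
      using \<rho> by (intro sum_le_suminf summable_geometric) auto
    then show "(\<Sum>i\<le>a. \<rho> ^ i) \<le> 1 / (1 - \<rho>)" using \<rho> suminf_geometric[of \<rho>] by simp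
  qed (use C0 \<rho> in auto)
  finally show "expectation (\<lambda>\<omega>. exp (t * (W a \<omega> + (\<Sum>l\<in>{a..<a + d}. X l \<omega>)))) \<le> D * \<rho> ^ d"
    by (simp add: D_def)
qed

lemma exp_W:
  "integrable M (\<lambda>\<omega>. exp (t * W k \<omega>))" "expectation (\<lambda>\<omega>. exp (t * W k \<omega>)) \<le> D"
  using exp_W_add[of k 0] by simp_all

lemma D_ge_1: "1 \<le> D"
  using exp_W(2)[of 0] by (simp add: prob_space)

text \<open>By \<open>lindley_add\<close> the restart error is at most the positive part of
  \<open>W (k - m)\<close> plus the increments of the window, and the positive part of
  \<open>x\<close> is at most \<open>exp (t * x) / t\<close>. Now \<open>exp_W_add\<close>
  applies.\<close>

lemma W_diff_V:
  "0 \<le> W k \<omega> - V m k \<omega>"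
  "integrable M (\<lambda>\<omega>. W k \<omega> - V m k \<omega>)"
  "expectation (\<lambda>\<omega>. W k \<omega> - V m k \<omega>) \<le> D / t * \<rho> ^ m"
proof -
  have *: "0 \<le> W k \<omega> - V m k \<omega> \<and> W k \<omega> - V m k \<omega> \<le>
      (if m < k then exp (t * (W (k - m) \<omega> + (\<Sum>l\<in>{k - m..<k - m + m}. X l \<omega>))) / t else 0)" for \<omega>
  proof (cases "m < k")
    case True
    let ?R = "W (k - m) \<omega> + (\<Sum>l\<in>{k - m..<k - m + m}. X l \<omega>)"
    have "W k \<omega> = max (V m k \<omega>) ?R"
      using True lindley_add[of X "k - m" m \<omega>] by (simp add: V_def)
    then have "0 \<le> W k \<omega> - V m k \<omega>" "W k \<omega> - V m k \<omega> \<le> max ?R 0"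
      using V_nonneg[of m k \<omega>] by (auto simp: max_def split: if_splits)
    moreover have "max ?R 0 \<le> exp (t * ?R) / t"
    proof -
      have "t * ?R \<le> exp (t * ?R)" using exp_ge_add_one_self[of "t * ?R"] by linarith
      then have "?R \<le> exp (t * ?R) / t" using t_pos by (simp add: field_simps)
      then show ?thesis using t_pos by simp
    qed
    ultimately have "0 \<le> W k \<omega> - V m k \<omega> \<and> W k \<omega> - V m k \<omega> \<le> exp (t * ?R) / t" by linarith
    then show ?thesis using True by simp
  next
    case False
    then show ?thesis by (simp add: V_def)
  qed
  then show "0 \<le> W k \<omega> - V m k \<omega>" by blast
  let ?r = "\<lambda>\<omega>. if m < k then exp (t * (W (k - m) \<omega> + (\<Sum>l\<in>{k - m..<k - m + m}. X l \<omega>))) / t else 0"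
  have int: "integrable M ?r" using exp_W_add(1)[of "k - m" m] by (cases "m < k") auto
  show int': "integrable M (\<lambda>\<omega>. W k \<omega> - V m k \<omega>)"
  proof (intro Bochner_Integration.integrable_bound[OF int] AE_I2)
    fix \<omega> show "norm (W k \<omega> - V m k \<omega>) \<le> norm (?r \<omega>)"
      unfolding real_norm_def using *[of \<omega>] by linarith
  qed simp
  have "expectation (\<lambda>\<omega>. W k \<omega> - V m k \<omega>) \<le> expectation ?r"
    using * by (intro integral_mono int int') auto
  also have "\<dots> \<le> D / t * \<rho> ^ m"
    using divide_right_mono[OF exp_W_add(2)[of "k - m" m], of t] t_pos D_ge_1 \<rho> by (cases "m < k") auto
  finally show "expectation (\<lambda>\<omega>. W k \<omega> - V m k \<omega>) \<le> D / t * \<rho> ^ m" .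
qed

lemma V_le_W: "V m k \<omega> \<le> W k \<omega>" using W_diff_V(1)[of k \<omega> m] by simp

lemma integrable_exp_bound:
  assumes [measurable]: "f \<in> borel_measurable M"
    and "\<And>\<omega>. \<omega> \<in> space M \<Longrightarrow> \<bar>f \<omega>\<bar> \<le> c * exp (t * W k \<omega>)"
  shows "integrable M f" "\<bar>expectation f\<bar> \<le> c * D"
proof -
  obtain \<omega> where "\<omega> \<in> space M" using not_empty by blast
  from assms(2)[OF this] have "0 \<le> c * exp (t * W k \<omega>)" by (meson abs_ge_zero order_trans)
  then have c: "0 \<le> c" by (simp add: zero_le_mult_iff)
  have int: "integrable M (\<lambda>\<omega>. c * exp (t * W k \<omega>))" using exp_W(1) by simp
  show f: "integrable M f"
    using assms(2) by (intro Bochner_Integration.integrable_bound[OF int])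
      (auto intro!: AE_I2 order_trans[OF _ abs_ge_self])
  have "\<bar>expectation f\<bar> \<le> expectation (\<lambda>\<omega>. c * exp (t * W k \<omega>))"
    using norm_integral_le_integral[OF f int] assms(2) by simp
  also have "\<dots> \<le> c * D" using exp_W c by (simp add: mult_left_mono)
  finally show "\<bar>expectation f\<bar> \<le> c * D" .
qed

lemma W_power:
  "integrable M (\<lambda>\<omega>. W k \<omega> ^ p)" "expectation (\<lambda>\<omega>. W k \<omega> ^ p) \<le> fact p / t ^ p * D"
proof -
  have *: "\<bar>W k \<omega> ^ p\<bar> \<le> fact p / t ^ p * exp (t * W k \<omega>)" for \<omega>
    using power_le_exp[of "t * W k \<omega>" p] t_pos W_nonneg[of k \<omega>] by (simp add: field_simps power_mult_distrib)
  show "integrable M (\<lambda>\<omega>. W k \<omega> ^ p)" by (rule integrable_exp_bound[OF _ *]) simp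
  have "\<bar>expectation (\<lambda>\<omega>. W k \<omega> ^ p)\<bar> \<le> fact p / t ^ p * D" by (rule integrable_exp_bound[OF _ *]) simp
  then show "expectation (\<lambda>\<omega>. W k \<omega> ^ p) \<le> fact p / t ^ p * D" by linarith
qed

lemma W_integrable [simp]: "integrable M (W k)" and W_mean_le: "expectation (W k) \<le> D / t"
  using W_power[of k 1] by simp_all

lemma W_mean_nonneg: "0 \<le> expectation (W k)"
  by (intro Bochner_Integration.integral_nonneg W_nonneg)

lemma linear_le_exp: "x \<le> 4 / t * exp (t * x / 4)"
proof -
  have "t * x / 4 \<le> exp (t * x / 4)" using exp_ge_add_one_self[of "t * x / 4"] by linarith
  then show ?thesis using t_pos by (simp add: field_simps)
qed

text \<open>The excess over \<open>B\<close> is paid for by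
  \<open>exp (t * (W j \<omega> - B) / 4)\<close>. Exponents with \<open>t / 4\<close> leave room
  for the product with \<open>W k\<close>: after AM-GM only exponentials of \<open>t * W / 2\<close>
  remain, which \<open>exp_W\<close> covers.\<close>

lemma tail_product:
  assumes B: "0 \<le> B"
  shows "integrable M (\<lambda>\<omega>. (W j \<omega> - min (W j \<omega>) B) * W k \<omega>)"
    "expectation (\<lambda>\<omega>. (W j \<omega> - min (W j \<omega>) B) * W k \<omega>) \<le> 16 / t\<^sup>2 * D * exp (- (t * B / 4))"
    "expectation (\<lambda>\<omega>. W j \<omega> - min (W j \<omega>) B) * expectation (W k) \<le> 16 / t\<^sup>2 * D\<^sup>2 * exp (- (t * B / 4))"
proof -
  let ?e = "exp (- (t * B / 4))"
  have tail: "W j \<omega> - min (W j \<omega>) B \<le> 4 / t * ?e * exp (t * W j \<omega> / 4)" for \<omega> j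
  proof -
    have "W j \<omega> - min (W j \<omega>) B \<le> max (W j \<omega> - B) 0" by auto
    also have "\<dots> \<le> 4 / t * exp (t * (W j \<omega> - B) / 4)"
      using linear_le_exp[of "W j \<omega> - B"] t_pos by auto
    also have "\<dots> = 4 / t * ?e * exp (t * W j \<omega> / 4)"
      by (simp add: exp_add[symmetric] field_simps)
    finally show ?thesis .
  qed
  have tail0: "0 \<le> W j \<omega> - min (W j \<omega>) B" for \<omega> j by auto
  let ?b = "\<lambda>\<omega>. 8 / t\<^sup>2 * ?e * (exp (t * W j \<omega>) + exp (t * W k \<omega>))"
  have bi: "integrable M ?b" using exp_W(1) by auto
  have *: "(W j \<omega> - min (W j \<omega>) B) * W k \<omega> \<le> ?b \<omega>" for \<omega>
  proof -
    let ?x = "exp (t * W j \<omega> / 4)" and ?y = "exp (t * W k \<omega> / 4)"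
    have "(W j \<omega> - min (W j \<omega>) B) * W k \<omega> \<le> (4 / t * ?e * ?x) * (4 / t * ?y)"
      using tail[of j \<omega>] linear_le_exp[of "W k \<omega>"] W_nonneg[of k \<omega>] t_pos by (intro mult_mono) auto
    also have "\<dots> = 8 / t\<^sup>2 * ?e * (2 * ?x * ?y)" by (simp add: power2_eq_square)
    also have "\<dots> \<le> 8 / t\<^sup>2 * ?e * (?x\<^sup>2 + ?y\<^sup>2)"
      using sum_squares_bound[of ?x ?y] by (intro mult_left_mono) auto
    also have "\<dots> \<le> ?b \<omega>"
      using W_nonneg t_pos by (intro mult_left_mono add_mono) (auto simp: exp_double[symmetric] mult_ac)
    finally show ?thesis .
  qed
  have **: "0 \<le> (W j \<omega> - min (W j \<omega>) B) * W k \<omega>" for \<omega>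
    using tail0 W_nonneg by simp
  show i: "integrable M (\<lambda>\<omega>. (W j \<omega> - min (W j \<omega>) B) * W k \<omega>)"
    using * ** by (intro Bochner_Integration.integrable_bound[OF bi]) (auto intro!: AE_I2 order_trans[OF _ abs_ge_self] simp: abs_of_nonneg simp del: abs_mult)
  have "expectation (\<lambda>\<omega>. (W j \<omega> - min (W j \<omega>) B) * W k \<omega>) \<le> expectation ?b"
    using * by (intro integral_mono i bi)
  also have "\<dots> = 8 / t\<^sup>2 * ?e * (expectation (\<lambda>\<omega>. exp (t * W j \<omega>)) + expectation (\<lambda>\<omega>. exp (t * W k \<omega>)))"
    using exp_W(1) by simp
  also have "\<dots> \<le> 8 / t\<^sup>2 * ?e * (D + D)" using exp_W(2) by (intro mult_left_mono add_mono) auto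
  finally show "expectation (\<lambda>\<omega>. (W j \<omega> - min (W j \<omega>) B) * W k \<omega>) \<le> 16 / t\<^sup>2 * D * ?e" by (simp add: mult_ac)
  have "\<bar>W j \<omega> - min (W j \<omega>) B\<bar> \<le> (4 / t * ?e) * exp (t * W j \<omega>)" for \<omega>
  proof -
    have "4 / t * ?e * exp (t * W j \<omega> / 4) \<le> 4 / t * ?e * exp (t * W j \<omega>)"
      using W_nonneg[of j \<omega>] t_pos by (intro mult_left_mono) auto
    then show ?thesis using tail[of j \<omega>] tail0[of j \<omega>] by linarith
  qed
  then have "\<bar>expectation (\<lambda>\<omega>. W j \<omega> - min (W j \<omega>) B)\<bar> \<le> 4 / t * ?e * D"
    by (intro integrable_exp_bound(2)) auto
  then have "expectation (\<lambda>\<omega>. W j \<omega> - min (W j \<omega>) B) * expectation (W k) \<le> (4 / t * ?e * D) * (D / t)"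
    using W_mean_le W_mean_nonneg t_pos D_ge_1 by (intro mult_mono) auto
  also have "\<dots> \<le> 4 * ((4 / t * ?e * D) * (D / t))"
    using t_pos D_ge_1 by (simp add: field_simps)
  finally show "expectation (\<lambda>\<omega>. W j \<omega> - min (W j \<omega>) B) * expectation (W k) \<le> 16 / t\<^sup>2 * D\<^sup>2 * ?e"
    by (simp add: power2_eq_square mult_ac)
qed

text \<open>Collects four tail errors with coefficient at most
  \<open>16 / t\<^sup>2 * D\<^sup>2\<close> and two window errors with coefficient
  \<open>D / t\<close>.\<close>

definition K :: real where "K = 64 / t\<^sup>2 * D\<^sup>2 + 2 * D / t"

lemma K_nonneg: "0 \<le> K" unfolding K_def using D_ge_1 t_pos by auto

definition cov :: "nat \<Rightarrow> nat \<Rightarrow> real" where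
  "cov j k = expectation (\<lambda>\<omega>. (W j \<omega> - expectation (W j)) * (W k \<omega> - expectation (W k)))"

lemma cov_commute: "cov j k = cov k j"
  unfolding cov_def by (simp add: mult.commute)

lemma W_mult_integrable: "integrable M (\<lambda>\<omega>. W j \<omega> * W k \<omega>)"
proof (rule Bochner_Integration.integrable_bound)
  show "integrable M (\<lambda>\<omega>. W j \<omega> ^ 2 + W k \<omega> ^ 2)"
    by (intro Bochner_Integration.integrable_add W_power)
  show "AE \<omega> in M. norm (W j \<omega> * W k \<omega>) \<le> norm (W j \<omega> ^ 2 + W k \<omega> ^ 2)"
  proof (rule AE_I2)
    fix \<omega>
    have "W j \<omega> * W k \<omega> \<le> W j \<omega> ^ 2 + W k \<omega> ^ 2"
      using sum_squares_bound[of "W j \<omega>" "W k \<omega>"]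
        mult_nonneg_nonneg[OF W_nonneg[of j \<omega>] W_nonneg[of k \<omega>]] by linarith
    then show "norm (W j \<omega> * W k \<omega>) \<le> norm (W j \<omega> ^ 2 + W k \<omega> ^ 2)"
      using W_nonneg[of j \<omega>] W_nonneg[of k \<omega>] by (simp add: abs_mult abs_of_nonneg)
  qed
qed simp

lemma cov_eq: "cov j k = expectation (\<lambda>\<omega>. W j \<omega> * W k \<omega>) - expectation (W j) * expectation (W k)"
proof -
  have "cov j k = expectation (\<lambda>\<omega>. W j \<omega> * W k \<omega> - (expectation (W k) * W j \<omega> + expectation (W j) * W k \<omega>)
      + expectation (W j) * expectation (W k))"
    unfolding cov_def by (intro Bochner_Integration.integral_cong) (auto simp: algebra_simps)
  also have "\<dots> = expectation (\<lambda>\<omega>. W j \<omega> * W k \<omega>) - (expectation (W k) * expectation (W j) +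
      expectation (W j) * expectation (W k)) + expectation (W j) * expectation (W k)"
    using W_mult_integrable by (simp add: prob_space)
  finally show ?thesis by (simp add: algebra_simps)
qed

text \<open>Here \<open>g\<close> is the gap and \<open>m\<close> the window. The truncated
  \<open>W j\<close> depends on increments before \<open>j\<close>, the truncated
  \<open>V m k\<close> on increments from \<open>k - m \<ge> j + g\<close> on, so mixing bounds
  their covariance. The rest is the cost of truncating both factors and restarting the
  second.\<close>

lemma cov_le:
  assumes B: "0 \<le> B" and jk: "j + g + m \<le> k"
  shows "\<bar>cov j k\<bar> \<le> 4 * alpha_mixing M X g * B\<^sup>2 + K * (exp (- (t * B / 4)) + B * \<rho> ^ m)"
proof -
  define f h where "f \<omega> = min (W j \<omega>) B" and "h \<omega> = min (V m k \<omega>) B" for \<omega>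
  let ?e = "exp (- (t * B / 4))"
  have [measurable]: "f \<in> borel_measurable M" "h \<in> borel_measurable M"
    unfolding f_def h_def by measurable
  have fr: "0 \<le> f \<omega>" "f \<omega> \<le> B" "f \<omega> \<le> W j \<omega>" and hr: "0 \<le> h \<omega>" "h \<omega> \<le> B" "h \<omega> \<le> W k \<omega>" for \<omega>
    unfolding f_def h_def using W_nonneg[of j \<omega>] V_nonneg[of m k \<omega>] B V_le_W[of m k \<omega>] by auto
  have fi[simp]: "integrable M f" and hi[simp]: "integrable M h"
    using fr hr by (intro integrable_const_bound[of _ B]; simp)+
  have fhi: "integrable M (\<lambda>\<omega>. f \<omega> * h \<omega>)"
    using fr hr B by (intro integrable_const_bound[of _ "B * B"]) (auto intro!: mult_mono AE_I2 simp: abs_mult)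
  have fWi: "integrable M (\<lambda>\<omega>. f \<omega> * W k \<omega>)"
    by (intro Bochner_Integration.integrable_bound[OF W_mult_integrable[of j k]])
      (use fr W_nonneg in \<open>auto simp: abs_mult intro!: mult_right_mono AE_I2\<close>)
  have 1: "\<bar>expectation (\<lambda>\<omega>. f \<omega> * h \<omega>) - expectation f * expectation h\<bar> \<le> 4 * alpha_mixing M X g * B * B"
  proof (rule covariance_le_alpha_mixing[where j=j])
    have "W j \<in> borel_measurable (generated_algebra M X {..j})"
      by (rule measurable_generated_algebra_mono[OF _ lindley_measurable[of X 0 j]]) auto
    then show "f \<in> borel_measurable (generated_algebra M X {..j})" unfolding f_def by measurable
    have "V m k \<in> borel_measurable (generated_algebra M X {j + g..})"
      using jk by (intro measurable_generated_algebra_mono[OF _ V_measurable]) auto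
    then show "h \<in> borel_measurable (generated_algebra M X {j + g..})" unfolding h_def by measurable
  qed (use fr hr in auto)
  note t1 = tail_product[OF B, of j k] and t2 = tail_product[OF B, of k j]
  have [simp]: "integrable M (\<lambda>\<omega>. W k \<omega> - h \<omega>)" "integrable M (\<lambda>\<omega>. W j \<omega> - f \<omega>)"
    "integrable M (\<lambda>\<omega>. min (W k \<omega>) B)" "integrable M (\<lambda>\<omega>. f \<omega> * (W k \<omega> - h \<omega>))"
    using fWi fhi B W_nonneg
    by (auto simp: right_diff_distrib intro!: integrable_const_bound[of _ B])
  \<comment> \<open>One factor is replaced at a time: first \<open>W j\<close> by \<open>f\<close>
    against \<open>W k\<close>, then \<open>W k\<close> by \<open>h\<close> against
    \<open>f\<close>.\<close>
  have cov3: "cov j k = (expectation (\<lambda>\<omega>. f \<omega> * h \<omega>) - expectation f * expectation h)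
     + (expectation (\<lambda>\<omega>. (W j \<omega> - f \<omega>) * W k \<omega>) - expectation (\<lambda>\<omega>. W j \<omega> - f \<omega>) * expectation (W k))
     + (expectation (\<lambda>\<omega>. f \<omega> * (W k \<omega> - h \<omega>)) - expectation f * expectation (\<lambda>\<omega>. W k \<omega> - h \<omega>))"
    unfolding cov_eq using fhi fWi W_mult_integrable by (simp add: algebra_simps)
  have pw: "W k \<omega> - h \<omega> \<le> (W k \<omega> - V m k \<omega>) + (W k \<omega> - min (W k \<omega>) B)" for \<omega>
    unfolding h_def using V_le_W[of m k \<omega>] by auto
  have 3: "expectation (\<lambda>\<omega>. f \<omega> * (W k \<omega> - h \<omega>)) \<le> B * (D / t * \<rho> ^ m) + 16 / t\<^sup>2 * D * ?e"
  proof -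
    have "expectation (\<lambda>\<omega>. f \<omega> * (W k \<omega> - h \<omega>)) \<le>
      expectation (\<lambda>\<omega>. B * (W k \<omega> - V m k \<omega>) + (W k \<omega> - min (W k \<omega>) B) * W j \<omega>)"
    proof (rule integral_mono)
      show "integrable M (\<lambda>\<omega>. B * (W k \<omega> - V m k \<omega>) + (W k \<omega> - min (W k \<omega>) B) * W j \<omega>)"
        by (intro Bochner_Integration.integrable_add integrable_mult_right W_diff_V t2)
      fix \<omega> 
      have "f \<omega> * (W k \<omega> - h \<omega>) \<le> f \<omega> * (W k \<omega> - V m k \<omega>) + f \<omega> * (W k \<omega> - min (W k \<omega>) B)"
        using mult_left_mono[OF pw[of \<omega>] fr(1)[of \<omega>]] by (simp only: distrib_left)
      also have "\<dots> \<le> B * (W k \<omega> - V m k \<omega>) + W j \<omega> * (W k \<omega> - min (W k \<omega>) B)"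
        using fr[of \<omega>] W_diff_V(1)[of k \<omega> m] by (intro add_mono mult_right_mono) auto
      finally show "f \<omega> * (W k \<omega> - h \<omega>) \<le> B * (W k \<omega> - V m k \<omega>) + (W k \<omega> - min (W k \<omega>) B) * W j \<omega>"
        by (simp add: mult.commute)
    qed simp
    also have "\<dots> = B * expectation (\<lambda>\<omega>. W k \<omega> - V m k \<omega>) + expectation (\<lambda>\<omega>. (W k \<omega> - min (W k \<omega>) B) * W j \<omega>)"
      using W_diff_V(2)[of k m] t2(1) by (subst Bochner_Integration.integral_add) auto
    also have "\<dots> \<le> B * (D / t * \<rho> ^ m) + 16 / t\<^sup>2 * D * ?e"
      using B by (intro add_mono mult_left_mono W_diff_V t2)
    finally show ?thesis .
  qed
  have 4: "expectation f * expectation (\<lambda>\<omega>. W k \<omega> - h \<omega>) \<le> B * (D / t * \<rho> ^ m) + 16 / t\<^sup>2 * D\<^sup>2 * ?e"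
  proof -
    have f: "0 \<le> expectation f" "expectation f \<le> B" "expectation f \<le> expectation (W j)"
      using fr by (simp_all add: Bochner_Integration.integral_nonneg integral_le_const integral_mono)
    have "expectation (\<lambda>\<omega>. W k \<omega> - h \<omega>) \<le> expectation (\<lambda>\<omega>. (W k \<omega> - V m k \<omega>) + (W k \<omega> - min (W k \<omega>) B))"
      using W_diff_V(2)[of k m] by (intro integral_mono pw Bochner_Integration.integrable_add) simp_all
    also have "\<dots> = expectation (\<lambda>\<omega>. W k \<omega> - V m k \<omega>) + expectation (\<lambda>\<omega>. W k \<omega> - min (W k \<omega>) B)"
      using W_diff_V(2)[of k m] by (subst Bochner_Integration.integral_add) auto
    finally have "expectation f * expectation (\<lambda>\<omega>. W k \<omega> - h \<omega>) \<le>
      expectation f * expectation (\<lambda>\<omega>. W k \<omega> - V m k \<omega>) + expectation f * expectation (\<lambda>\<omega>. W k \<omega> - min (W k \<omega>) B)"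
      using f by (simp add: distrib_left[symmetric] mult_left_mono)
    also have "\<dots> \<le> B * (D / t * \<rho> ^ m) + expectation (W j) * expectation (\<lambda>\<omega>. W k \<omega> - min (W k \<omega>) B)"
    proof (intro add_mono mult_mono)
      show "expectation f \<le> B" "expectation f \<le> expectation (W j)" by fact+
      show "0 \<le> expectation (\<lambda>\<omega>. W k \<omega> - V m k \<omega>)"
        by (intro Bochner_Integration.integral_nonneg W_diff_V)
      show "0 \<le> expectation (\<lambda>\<omega>. W k \<omega> - min (W k \<omega>) B)"
        by (rule Bochner_Integration.integral_nonneg) simp
    qed (use B W_mean_nonneg W_diff_V(3) in auto)
    also have "\<dots> \<le> B * (D / t * \<rho> ^ m) + 16 / t\<^sup>2 * D\<^sup>2 * ?e"
      using t2(3) by (simp add: mult.commute)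
    finally show ?thesis .
  qed
  \<comment> \<open>Truncating and restarting only decrease \<open>W\<close>, so the four error
    terms are nonnegative and their upper bounds control the absolute value.\<close>
  have nonneg: "0 \<le> expectation (\<lambda>\<omega>. (W j \<omega> - f \<omega>) * W k \<omega>)" "0 \<le> expectation (\<lambda>\<omega>. W j \<omega> - f \<omega>) * expectation (W k)"
    "0 \<le> expectation (\<lambda>\<omega>. f \<omega> * (W k \<omega> - h \<omega>))" "0 \<le> expectation f * expectation (\<lambda>\<omega>. W k \<omega> - h \<omega>)"
    by (intro Bochner_Integration.integral_nonneg mult_nonneg_nonneg;
        use fr hr W_nonneg in \<open>simp add: algebra_simps\<close>)+
  have DD: "D \<le> D\<^sup>2" using D_ge_1 by (simp add: power2_eq_square)
  have DD': "16 / t\<^sup>2 * D * ?e \<le> 16 / t\<^sup>2 * D\<^sup>2 * ?e"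
    using DD by (intro mult_right_mono mult_left_mono) auto
  have t1': "expectation (\<lambda>\<omega>. (W j \<omega> - f \<omega>) * W k \<omega>) \<le> 16 / t\<^sup>2 * D * ?e"
     "expectation (\<lambda>\<omega>. W j \<omega> - f \<omega>) * expectation (W k) \<le> 16 / t\<^sup>2 * D\<^sup>2 * ?e"
    using t1(2,3) unfolding f_def by auto
  have arith: "\<bar>c\<bar> \<le> x + 4 * E2 + 2 * b"
    if "c = a + (p - q) + (r - s)" "\<bar>a\<bar> \<le> x" "r \<le> b + E1" "s \<le> b + E2" "p \<le> E1" "q \<le> E2"
      "0 \<le> p" "0 \<le> q" "0 \<le> r" "0 \<le> s" "E1 \<le> E2" for a b c p q r s x E1 E2 :: real
    using that by linarith
  have "\<bar>cov j k\<bar> \<le> 4 * alpha_mixing M X g * B * B + 4 * (16 / t\<^sup>2 * D\<^sup>2 * ?e) + 2 * (B * (D / t * \<rho> ^ m))"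
    by (rule arith[OF cov3 1 3 4 t1' nonneg DD'])
  also have "\<dots> \<le> 4 * alpha_mixing M X g * B\<^sup>2 + K * (?e + B * \<rho> ^ m)"
  proof -
    have "a * e + b * y \<le> (a + b) * (e + y)" if "0 \<le> a * y" "0 \<le> b * e" for a b e y :: real
      using that by (simp add: algebra_simps)
    from this[of "64 / t\<^sup>2 * D\<^sup>2" "B * \<rho> ^ m" "2 * D / t" ?e]
    show ?thesis unfolding K_def using D_ge_1 t_pos \<rho> B by (simp add: power2_eq_square mult_ac)
  qed
  finally show ?thesis .
qed

text \<open>Serves the lags that are too short for mixing to help. Both terms of the covariance are
  nonnegative, so a common bound for them suffices.\<close>

lemma cov_bounded: "\<bar>cov j k\<bar> \<le> 4 * D\<^sup>2 / t\<^sup>2"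
proof -
  have n: "0 \<le> expectation (\<lambda>\<omega>. W j \<omega> * W k \<omega>)" "0 \<le> expectation (W j) * expectation (W k)"
    using W_nonneg by (auto intro!: Bochner_Integration.integral_nonneg mult_nonneg_nonneg)
  have "expectation (\<lambda>\<omega>. W j \<omega> * W k \<omega>) \<le> expectation (\<lambda>\<omega>. W j \<omega> ^ 2 + W k \<omega> ^ 2)"
  proof (intro integral_mono W_mult_integrable Bochner_Integration.integrable_add W_power)
    fix \<omega> show "W j \<omega> * W k \<omega> \<le> W j \<omega> ^ 2 + W k \<omega> ^ 2"
      using sum_squares_bound[of "W j \<omega>" "W k \<omega>"]
        mult_nonneg_nonneg[OF W_nonneg[of j \<omega>] W_nonneg[of k \<omega>]] by linarith
  qed
  also have "\<dots> = expectation (\<lambda>\<omega>. W j \<omega> ^ 2) + expectation (\<lambda>\<omega>. W k \<omega> ^ 2)"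
    by (intro Bochner_Integration.integral_add W_power)
  also have "\<dots> \<le> 2 / t\<^sup>2 * D + 2 / t\<^sup>2 * D"
    using W_power(2)[of j 2] W_power(2)[of k 2] by (intro add_mono) auto
  also have "\<dots> \<le> 4 * D\<^sup>2 / t\<^sup>2"
    using D_ge_1 t_pos by (simp add: power2_eq_square divide_right_mono)
  finally have 1: "expectation (\<lambda>\<omega>. W j \<omega> * W k \<omega>) \<le> 4 * D\<^sup>2 / t\<^sup>2" .
  have "expectation (W j) * expectation (W k) \<le> D / t * (D / t)"
    using W_mean_le W_mean_nonneg D_ge_1 t_pos by (intro mult_mono) auto
  also have "\<dots> \<le> 4 * D\<^sup>2 / t\<^sup>2" using D_ge_1 t_pos by (simp add: power2_eq_square field_simps)
  finally show ?thesis using 1 n unfolding cov_eq by linarith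
qed

lemma W_centered_mult_integrable:
  "integrable M (\<lambda>\<omega>. (W j \<omega> - expectation (W j)) * (W k \<omega> - expectation (W k)))"
  using W_mult_integrable[of j k] by (simp add: algebra_simps)

lemma centered_sum_square:
  assumes A: "finite A"
  shows "integrable M (\<lambda>\<omega>. (\<Sum>k\<in>A. W k \<omega> - expectation (W k))\<^sup>2)"
    "expectation (\<lambda>\<omega>. (\<Sum>k\<in>A. W k \<omega> - expectation (W k))\<^sup>2) = (\<Sum>j\<in>A. \<Sum>k\<in>A. cov j k)"
  unfolding power2_eq_square sum_product cov_def using W_centered_mult_integrable by auto

text \<open>In each row every lag occurs at most twice. The index set is arbitrary because the bound
  is later needed for the blocks and for the indices that the blocks leave over.\<close>

lemma centered_sum_square_le:
  fixes \<psi> :: "nat \<Rightarrow> real"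
  assumes A: "A \<subseteq> {..n}" and \<psi>: "\<And>d. 0 \<le> \<psi> d" and cov: "\<And>j d. \<bar>cov j (j + d)\<bar> \<le> \<psi> d"
  shows "expectation (\<lambda>\<omega>. (\<Sum>k\<in>A. W k \<omega> - expectation (W k))\<^sup>2) \<le> card A * (2 * (\<Sum>d\<le>n. \<psi> d))"
proof -
  have fin: "finite A" using A finite_subset by blast
  have "(\<Sum>k\<in>A. cov j k) \<le> 2 * (\<Sum>d\<le>n. \<psi> d)" if j: "j \<in> A" for j
  proof -
    have "(\<Sum>k\<in>A. cov j k) \<le> (\<Sum>k\<in>A. \<bar>cov j k\<bar>)" by (intro sum_mono) auto
    \<comment> \<open>The diagonal term is counted on both sides, which only increases the
      bound.\<close>
    also have "\<dots> \<le> (\<Sum>k\<in>A \<inter> {j..}. \<bar>cov j k\<bar>) + (\<Sum>k\<in>A \<inter> {..j}. \<bar>cov j k\<bar>)"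
    proof -
      have "0 \<le> (\<Sum>k\<in>A \<inter> {j..} \<inter> (A \<inter> {..j}). \<bar>cov j k\<bar>)" by (intro sum_nonneg) auto
      moreover have "(\<Sum>k\<in>A \<inter> {j..} \<union> A \<inter> {..j}. \<bar>cov j k\<bar>) + (\<Sum>k\<in>A \<inter> {j..} \<inter> (A \<inter> {..j}). \<bar>cov j k\<bar>) =
          (\<Sum>k\<in>A \<inter> {j..}. \<bar>cov j k\<bar>) + (\<Sum>k\<in>A \<inter> {..j}. \<bar>cov j k\<bar>)"
        using fin by (intro sum.union_inter) auto
      moreover have "(\<Sum>k\<in>A \<inter> {j..} \<union> A \<inter> {..j}. \<bar>cov j k\<bar>) = (\<Sum>k\<in>A. \<bar>cov j k\<bar>)"
        by (rule sum.cong) auto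
      ultimately show ?thesis by linarith
    qed
    also have "(\<Sum>k\<in>A \<inter> {j..}. \<bar>cov j k\<bar>) \<le> (\<Sum>d\<le>n. \<psi> d)"
    proof -
      have "(\<Sum>k\<in>A \<inter> {j..}. \<bar>cov j k\<bar>) \<le> (\<Sum>k\<in>A \<inter> {j..}. \<psi> (k - j))"
      proof (rule sum_mono)
        fix k assume "k \<in> A \<inter> {j..}" then show "\<bar>cov j k\<bar> \<le> \<psi> (k - j)" using cov[of j "k - j"] by auto
      qed
      also have "\<dots> = (\<Sum>d\<in>(\<lambda>k. k - j) ` (A \<inter> {j..}). \<psi> d)"
        by (subst sum.reindex) (auto simp: inj_on_def)
      also have "\<dots> \<le> (\<Sum>d\<le>n. \<psi> d)" using A \<psi> by (intro sum_mono2) auto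
      finally show ?thesis .
    qed
    also have "(\<Sum>k\<in>A \<inter> {..j}. \<bar>cov j k\<bar>) \<le> (\<Sum>d\<le>n. \<psi> d)"
    proof -
      have "(\<Sum>k\<in>A \<inter> {..j}. \<bar>cov j k\<bar>) \<le> (\<Sum>k\<in>A \<inter> {..j}. \<psi> (j - k))"
      proof (rule sum_mono)
        fix k assume "k \<in> A \<inter> {..j}" then show "\<bar>cov j k\<bar> \<le> \<psi> (j - k)"
          using cov[of k "j - k"] cov_commute[of j k] by auto
      qed
      also have "\<dots> = (\<Sum>d\<in>(\<lambda>k. j - k) ` (A \<inter> {..j}). \<psi> d)"
        by (subst sum.reindex) (auto simp: inj_on_def)
      also have "\<dots> \<le> (\<Sum>d\<le>n. \<psi> d)" using A j \<psi> by (intro sum_mono2) auto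
      finally show ?thesis .
    qed
    finally show ?thesis by simp
  qed
  then have "(\<Sum>j\<in>A. \<Sum>k\<in>A. cov j k) \<le> (\<Sum>j\<in>A. 2 * (\<Sum>d\<le>n. \<psi> d))" by (rule sum_mono)
  then show ?thesis unfolding centered_sum_square(2)[OF fin] by simp
qed

end

section \<open>Laws of large numbers\<close>

lemma filterlim_nat_div_2: "filterlim (\<lambda>d::nat. d div 2) at_top sequentially"
  unfolding filterlim_at_top eventually_sequentially
proof safe
  fix Z :: nat show "\<exists>N. \<forall>n\<ge>N. Z \<le> n div 2" by (intro exI[of _ "2 * Z"]) auto
qed

lemma (in prob_space) expectation_abs_le_sqrt:
  assumes "integrable M Y" "integrable M (\<lambda>x. (Y x)\<^sup>2)"
  shows "expectation (\<lambda>x. \<bar>Y x\<bar>) \<le> sqrt (expectation (\<lambda>x. (Y x)\<^sup>2))"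
proof -
  have "0 \<le> variance (\<lambda>x. \<bar>Y x\<bar>)" by (rule variance_positive)
  also have "\<dots> = expectation (\<lambda>x. \<bar>Y x\<bar>\<^sup>2) - (expectation (\<lambda>x. \<bar>Y x\<bar>))\<^sup>2"
    using assms by (intro variance_eq) auto
  finally show ?thesis by (intro real_le_rsqrt) simp
qed

text \<open>By Tonelli the series of the \<open>f n\<close> has finite expectation, so it converges
  almost surely and its terms tend to 0.\<close>

lemma (in prob_space) AE_tendsto_0_of_summable_expectation:
  fixes f :: "nat \<Rightarrow> 'a \<Rightarrow> real"
  assumes int: "\<And>n. integrable M (f n)" and nonneg: "\<And>n x. 0 \<le> f n x"
    and sum: "summable (\<lambda>n. expectation (f n))"
  shows "AE x in M. (\<lambda>n. f n x) \<longlonglongrightarrow> 0"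
proof -
  have [measurable]: "f n \<in> borel_measurable M" for n using int by auto
  have "(\<integral>\<^sup>+x. (\<Sum>n. ennreal (f n x)) \<partial>M) = (\<Sum>n. \<integral>\<^sup>+x. ennreal (f n x) \<partial>M)"
    by (rule nn_integral_suminf) simp
  also have "\<dots> = (\<Sum>n. ennreal (expectation (f n)))"
    using assms by (subst nn_integral_eq_integral) auto
  also have "\<dots> = ennreal (\<Sum>n. expectation (f n))"
    using nonneg sum by (intro suminf_ennreal2) (auto intro: Bochner_Integration.integral_nonneg)
  finally have "(\<integral>\<^sup>+x. (\<Sum>n. ennreal (f n x)) \<partial>M) \<noteq> \<infinity>" by simp
  then have "AE x in M. (\<Sum>n. ennreal (f n x)) \<noteq> \<infinity>"
    by (intro nn_integral_PInf_AE) auto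
  then show ?thesis
  proof (rule AE_mp, intro AE_I2 impI)
    fix x assume "(\<Sum>n. ennreal (f n x)) \<noteq> \<infinity>"
    then have "summable (\<lambda>n. f n x)" using nonneg by (intro summable_suminf_not_top) auto
    then show "(\<lambda>n. f n x) \<longlonglongrightarrow> 0" by (rule summable_LIMSEQ_zero)
  qed
qed

context lindley_walk
begin

definition T :: "nat \<Rightarrow> 'a \<Rightarrow> real" where
  "T n \<omega> = (\<Sum>k\<in>{1..n}. W k \<omega> - expectation (W k))"

lemma T_integrable: "integrable M (T n)" "integrable M (\<lambda>\<omega>. (T n \<omega>)\<^sup>2)"
  unfolding T_def by (auto intro: centered_sum_square)

text \<open>The order of choices matters: \<open>B\<close> is fixed first so that the tail error is
  below \<open>e\<close>; then the lag grows, half of it serving as window and the rest as gap, and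
  the other errors vanish.\<close>

lemma eventually_cov_small:
  assumes \<alpha>: "alpha_mixing M X \<longlonglongrightarrow> 0" and e: "0 < e"
  obtains N where "\<And>j d. d \<ge> N \<Longrightarrow> \<bar>cov j (j + d)\<bar> \<le> e"
proof -
  have "((\<lambda>B. K * exp (- (t * B / 4))) \<longlongrightarrow> 0) at_top" using t_pos by real_asymp
  then have "eventually (\<lambda>B. K * exp (- (t * B / 4)) < e) at_top" using e by (rule order_tendstoD)
  then have "eventually (\<lambda>B. K * exp (- (t * B / 4)) < e \<and> 0 \<le> B) at_top"
    by (intro eventually_conj eventually_ge_at_top)
  then obtain B where B: "K * exp (- (t * B / 4)) < e" "0 \<le> B"
    by (auto dest: eventually_happens)
  have f: "filterlim (\<lambda>d::nat. d - d div 2) at_top sequentially"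
    by (rule filterlim_at_top_mono[OF filterlim_nat_div_2]) (auto intro!: always_eventually)
  have "(\<lambda>n. \<rho> ^ n) \<longlonglongrightarrow> 0" using \<rho> by (intro LIMSEQ_power_zero) auto
  then have "(\<lambda>d. \<rho> ^ (d div 2)) \<longlonglongrightarrow> 0" using filterlim_nat_div_2 by (rule filterlim_compose)
  moreover have "(\<lambda>d. alpha_mixing M X (d - d div 2)) \<longlonglongrightarrow> 0" using \<alpha> f by (rule filterlim_compose)
  ultimately have "(\<lambda>d. 4 * alpha_mixing M X (d - d div 2) * B\<^sup>2 + K * (exp (- (t * B / 4)) + B * \<rho> ^ (d div 2)))
      \<longlonglongrightarrow> 4 * 0 * B\<^sup>2 + K * (exp (- (t * B / 4)) + B * 0)"
    by (intro tendsto_intros)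
  then have "eventually (\<lambda>d. 4 * alpha_mixing M X (d - d div 2) * B\<^sup>2 + K * (exp (- (t * B / 4)) + B * \<rho> ^ (d div 2)) < e) sequentially"
    using B(1) by (intro order_tendstoD) auto
  then obtain N where N: "\<And>d. d \<ge> N \<Longrightarrow> 4 * alpha_mixing M X (d - d div 2) * B\<^sup>2 + K * (exp (- (t * B / 4)) + B * \<rho> ^ (d div 2)) < e"
    unfolding eventually_sequentially by blast
  show thesis
  proof
    fix j d :: nat assume "d \<ge> N"
    then show "\<bar>cov j (j + d)\<bar> \<le> e"
      using cov_le[OF B(2), of j "d - d div 2" "d div 2" "j + d"] N[of d] by simp
  qed
qed

lemma mean_square_tendsto_0:
  assumes \<alpha>: "alpha_mixing M X \<longlonglongrightarrow> 0"
  shows "(\<lambda>n. expectation (\<lambda>\<omega>. (T n \<omega>)\<^sup>2) / (real n)\<^sup>2) \<longlonglongrightarrow> 0"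
proof (rule LIMSEQ_I)
  fix e :: real assume e: "0 < e"
  obtain N where N: "\<And>j d. d \<ge> N \<Longrightarrow> \<bar>cov j (j + d)\<bar> \<le> e / 4"
    using eventually_cov_small[OF \<alpha>, of "e / 4"] e by auto
  define c where "c = 4 * D\<^sup>2 / t\<^sup>2"
  have c: "0 \<le> c" unfolding c_def by auto
  \<comment> \<open>The boundedly many lags below \<open>N\<close> carry the crude bound and
    contribute only linearly in \<open>n\<close>. The others carry \<open>e / 4\<close>, which the
    factor 2 for the two sides of a row turns into the limit \<open>e / 2\<close>.\<close>
  let ?\<psi> = "\<lambda>d. if d < N then c + e / 4 else e / 4"
  have le: "expectation (\<lambda>\<omega>. (T n \<omega>)\<^sup>2) \<le> n * (2 * (N * c + (real n + 1) * (e / 4)))" for n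
  proof -
    have "expectation (\<lambda>\<omega>. (T n \<omega>)\<^sup>2) \<le> card {1..n} * (2 * (\<Sum>d\<le>n. ?\<psi> d))"
      unfolding T_def
    proof (rule centered_sum_square_le)
      fix j d show "\<bar>cov j (j + d)\<bar> \<le> ?\<psi> d"
        using N[of d j] cov_bounded[of j "j + d"] e unfolding c_def by auto
    qed (use c e in auto)
    also have "(\<Sum>d\<le>n. ?\<psi> d) = (\<Sum>d\<le>n. if d \<in> {..<N} then c else 0) + (\<Sum>d\<le>n. e / 4)"
      unfolding sum.distrib[symmetric] by (intro sum.cong) auto
    also have "\<dots> = card ({..n} \<inter> {..<N}) * c + (real n + 1) * (e / 4)"
      by (subst sum.inter_restrict[symmetric]) auto
    also have "\<dots> \<le> N * c + (real n + 1) * (e / 4)"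
      using c card_mono[of "{..<N}" "{..n} \<inter> {..<N}"] by (intro add_right_mono mult_right_mono) auto
    finally show ?thesis by (simp add: mult_left_mono add.commute)
  qed
  define g where "g n = (n * (2 * (N * c + (real n + 1) * (e / 4)))) / (real n)\<^sup>2" for n :: nat
  have "g \<longlonglongrightarrow> e / 2" unfolding g_def by real_asymp
  then have "eventually (\<lambda>n. g n < e) sequentially"
    by (rule order_tendstoD) (use e in simp)
  then obtain n0 where n0: "\<And>n. n \<ge> n0 \<Longrightarrow> g n < e"
    unfolding eventually_sequentially by blast
  have "norm (expectation (\<lambda>\<omega>. (T n \<omega>)\<^sup>2) / (real n)\<^sup>2 - 0) < e" if "n \<ge> n0" for n
  proof -
    have "expectation (\<lambda>\<omega>. (T n \<omega>)\<^sup>2) / (real n)\<^sup>2 < e"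
      using divide_right_mono[OF le[of n] zero_le_power2[of "real n"]] n0[OF that] unfolding g_def by (rule le_less_trans)
    moreover have "0 \<le> expectation (\<lambda>\<omega>. (T n \<omega>)\<^sup>2) / (real n)\<^sup>2" by simp
    ultimately show ?thesis by simp
  qed
  then show "\<exists>no. \<forall>n\<ge>no. norm (expectation (\<lambda>\<omega>. (T n \<omega>)\<^sup>2) / (real n)\<^sup>2 - 0) < e" by blast
qed

theorem L1_law_of_large_numbers:
  assumes \<alpha>: "alpha_mixing M X \<longlonglongrightarrow> 0"
  shows "(\<lambda>n. \<integral>\<^sup>+\<omega>. ennreal \<bar>1 / real n * T n \<omega>\<bar> \<partial>M) \<longlonglongrightarrow> 0"
proof -
  have eq: "(\<integral>\<^sup>+\<omega>. ennreal \<bar>1 / real n * T n \<omega>\<bar> \<partial>M) = ennreal (expectation (\<lambda>\<omega>. \<bar>1 / real n * T n \<omega>\<bar>))" for n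
    using T_integrable by (intro nn_integral_eq_integral) auto
  have "(\<lambda>n. expectation (\<lambda>\<omega>. \<bar>1 / real n * T n \<omega>\<bar>)) \<longlonglongrightarrow> 0"
  proof (rule tendsto_sandwich[OF always_eventually always_eventually])
    show "\<forall>n. 0 \<le> expectation (\<lambda>\<omega>. \<bar>1 / real n * T n \<omega>\<bar>)" by simp
    show "\<forall>n. expectation (\<lambda>\<omega>. \<bar>1 / real n * T n \<omega>\<bar>) \<le> sqrt (expectation (\<lambda>\<omega>. (T n \<omega>)\<^sup>2) / (real n)\<^sup>2)"
    proof
      fix n
      have "expectation (\<lambda>\<omega>. \<bar>1 / real n * T n \<omega>\<bar>) \<le> sqrt (expectation (\<lambda>\<omega>. (1 / real n * T n \<omega>)\<^sup>2))"
        using T_integrable by (intro expectation_abs_le_sqrt) (auto simp: power_mult_distrib power_divide)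
      then show "expectation (\<lambda>\<omega>. \<bar>1 / real n * T n \<omega>\<bar>) \<le> sqrt (expectation (\<lambda>\<omega>. (T n \<omega>)\<^sup>2) / (real n)\<^sup>2)"
        by (simp add: power_mult_distrib power_divide)
    qed
    show "(\<lambda>n. sqrt (expectation (\<lambda>\<omega>. (T n \<omega>)\<^sup>2) / (real n)\<^sup>2)) \<longlonglongrightarrow> 0"
      using tendsto_real_sqrt[OF mean_square_tendsto_0[OF \<alpha>]] by simp
  qed simp
  then show ?thesis unfolding eq using tendsto_ennrealI[of _ 0] by fastforce
qed

text \<open>Letting the truncation level grow with the lag makes the bound of \<open>cov_le\<close>
  summable over lags. Second moments then grow linearly in the number of summands, wherever these
  are placed.\<close>

lemma centered_sum_square_linear:
  assumes \<kappa>: "1 < \<kappa>" and c: "0 < c" and \<alpha>: "\<And>n. n \<ge> 1 \<Longrightarrow> alpha_mixing M X n \<le> c * real n powr (- \<kappa>)"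
  obtains L :: real where "0 < L"
    "\<And>A. finite A \<Longrightarrow> expectation (\<lambda>\<omega>. (\<Sum>k\<in>A. W k \<omega> - expectation (W k))\<^sup>2) \<le> L * card A"
proof -
  \<comment> \<open>The factor 8 turns the tail error \<open>exp (- (t * B d / 4))\<close> into
    \<open>(real d + 1) powr (- 2)\<close>, which is summable, while \<open>B d\<close> itself is
    only logarithmic.\<close>
  define B where "B d = 8 / t * ln (real d + 1)" for d :: nat
  define \<psi> where "\<psi> d = 4 * alpha_mixing M X (d - d div 2) * (B d)\<^sup>2 +
    K * (exp (- (t * B d / 4)) + B d * \<rho> ^ (d div 2))" for d :: nat
  have B: "0 \<le> B d" for d unfolding B_def using t_pos by simp
  have \<psi>_nonneg: "0 \<le> \<psi> d" for d
    unfolding \<psi>_def using B K_nonneg alpha_mixing_nonneg \<rho> by auto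
  have cov: "\<bar>cov j (j + d)\<bar> \<le> \<psi> d" for j d
    unfolding \<psi>_def by (rule cov_le[OF B]) auto
  \<comment> \<open>The window is half of the lag; in terms of the square root of
    \<open>\<rho>\<close> its error is geometric in the lag itself, up to a factor
    \<open>1 / s\<close> for odd lags.\<close>
  define s where "s = sqrt \<rho>"
  have s: "0 < s" "s < 1" "\<rho> = s\<^sup>2" unfolding s_def using \<rho> by auto
  have e: "exp (- (t * B d / 4)) = (real d + 1) powr (- 2)" for d
    unfolding B_def powr_def using t_pos by simp
  have s1: "summable (\<lambda>d::nat. (real d / 2) powr (- \<kappa>) * (ln (real d + 1))\<^sup>2)"
  proof (rule summable_comparison_test_bigo)
    \<comment> \<open>The exponent \<open>(1 + \<kappa>) / 2\<close> lies strictly between 1 and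
      \<open>\<kappa>\<close>: large enough for summability, small enough to absorb the squared
      logarithm.\<close>
    show "summable (\<lambda>d. norm (real d powr (- (1 + \<kappa>) / 2)))" using \<kappa> by (simp add: summable_real_powr_iff)
    show "(\<lambda>d::nat. (real d / 2) powr (- \<kappa>) * (ln (real d + 1))\<^sup>2) \<in> O(\<lambda>d. real d powr (- (1 + \<kappa>) / 2))"
      using \<kappa> by real_asymp
  qed
  have s2: "summable (\<lambda>d::nat. (real d + 1) powr (- 2))"
  proof (rule summable_comparison_test_bigo)
    show "summable (\<lambda>d. norm (real d powr (- 2)))" by (simp add: summable_real_powr_iff)
    show "(\<lambda>d::nat. (real d + 1) powr (- 2)) \<in> O(\<lambda>d. real d powr (- 2))" by real_asymp
  qed
  have s3: "summable (\<lambda>d::nat. ln (real d + 1) * s ^ d)"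
  proof (rule summable_comparison_test_bigo)
    show "summable (\<lambda>d. norm (real d powr (- 2)))" by (simp add: summable_real_powr_iff)
    show "(\<lambda>d::nat. ln (real d + 1) * s ^ d) \<in> O(\<lambda>d. real d powr (- 2))" using s by real_asymp
  qed
  let ?G = "\<lambda>d::nat. 4 * c * (64 / t\<^sup>2) * ((real d / 2) powr (- \<kappa>) * (ln (real d + 1))\<^sup>2) +
      (K * (real d + 1) powr (- 2) + K * (8 / t) / s * (ln (real d + 1) * s ^ d))"
  have sumG: "summable ?G" by (intro summable_add summable_mult s1 s2 s3)
  have "summable \<psi>"
  proof (rule summable_comparison_test[OF exI sumG], intro allI impI)
    fix d :: nat assume d: "1 \<le> d"
    have "alpha_mixing M X (d - d div 2) \<le> c * real (d - d div 2) powr (- \<kappa>)" using d by (intro \<alpha>) auto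
    also have "\<dots> \<le> c * (real d / 2) powr (- \<kappa>)"
      using d c \<kappa> by (intro mult_left_mono powr_mono2') auto
    finally have a: "alpha_mixing M X (d - d div 2) \<le> c * (real d / 2) powr (- \<kappa>)" .
    have "\<rho> ^ (d div 2) = s ^ (2 * (d div 2))" unfolding s(3) by (simp add: power_mult)
    also have "\<dots> \<le> s ^ (d - 1)" using s by (intro power_decreasing) auto
    also have "\<dots> = s ^ d / s" using s d by (cases d) auto
    finally have r: "\<rho> ^ (d div 2) \<le> s ^ d / s" .
    have "\<psi> d \<le> 4 * (c * (real d / 2) powr (- \<kappa>)) * (B d)\<^sup>2 + K * ((real d + 1) powr (- 2) + B d * (s ^ d / s))"
      unfolding \<psi>_def e using a r B K_nonneg
      by (intro add_mono mult_right_mono mult_left_mono order_refl) auto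
    also have "\<dots> = ?G d"
      unfolding B_def by (simp add: power2_eq_square algebra_simps)
    finally show "norm (\<psi> d) \<le> ?G d" using \<psi>_nonneg[of d] by simp
  qed
  note sum\<psi> = this
  show thesis
  proof (rule that[of "2 * suminf \<psi> + 1"])
    show "0 < 2 * suminf \<psi> + 1" using suminf_nonneg[OF sum\<psi>] \<psi>_nonneg by (simp add: add_nonneg_pos)
    fix A :: "nat set" assume A: "finite A"
    then obtain n where n: "A \<subseteq> {..n}" using finite_nat_iff_bounded_le by blast
    have "expectation (\<lambda>\<omega>. (\<Sum>k\<in>A. W k \<omega> - expectation (W k))\<^sup>2) \<le> card A * (2 * (\<Sum>d\<le>n. \<psi> d))"
      using n \<psi>_nonneg cov by (rule centered_sum_square_le)
    also have "\<dots> \<le> card A * (2 * suminf \<psi> + 1)"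
    proof (rule mult_left_mono)
      have "(\<Sum>d\<le>n. \<psi> d) \<le> suminf \<psi>" by (intro sum_le_suminf sum\<psi> \<psi>_nonneg) auto
      then show "2 * (\<Sum>d\<le>n. \<psi> d) \<le> 2 * suminf \<psi> + 1" by simp
    qed simp
    finally show "expectation (\<lambda>\<omega>. (\<Sum>k\<in>A. W k \<omega> - expectation (W k))\<^sup>2) \<le> (2 * suminf \<psi> + 1) * card A"
      by (simp add: mult.commute)
  qed
qed

text \<open>Between consecutive squares the partial sums of the nonnegative \<open>W k\<close> are monotone, so
  almost sure convergence along \<open>n\<^sup>2\<close> suffices.\<close>

lemma T_between_squares:
  assumes "q\<^sup>2 \<le> n" "n \<le> (Suc q)\<^sup>2"
  shows "\<bar>T n \<omega>\<bar> \<le> \<bar>T (q\<^sup>2) \<omega>\<bar> + \<bar>T ((Suc q)\<^sup>2) \<omega>\<bar> + (2 * real q + 1) * (D / t)"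
proof -
  define U m where "U n = (\<Sum>k\<in>{1..n}. W k \<omega>)" and "m n = (\<Sum>k\<in>{1..n}. expectation (W k))" for n
  have T: "T n \<omega> = U n - m n" for n unfolding T_def U_def m_def by (rule sum_subtractf)
  have mono: "U a \<le> U b" "m a \<le> m b" if "a \<le> b" for a b
    unfolding U_def m_def using that W_nonneg W_mean_nonneg by (auto intro!: sum_mono2)
  have "m ((Suc q)\<^sup>2) - m (q\<^sup>2) = (\<Sum>k\<in>{q\<^sup>2<..(Suc q)\<^sup>2}. expectation (W k))"
  proof -
    have "{1..(Suc q)\<^sup>2} = {1..q\<^sup>2} \<union> {q\<^sup>2<..(Suc q)\<^sup>2}" using assms by auto
    then show ?thesis unfolding m_def by (simp only:) (subst sum.union_disjoint; auto)
  qed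
  also have "\<dots> \<le> (\<Sum>k\<in>{q\<^sup>2<..(Suc q)\<^sup>2}. D / t)" by (intro sum_mono W_mean_le)
  also have "\<dots> = (2 * real q + 1) * (D / t)"
  proof -
    have "(Suc q)\<^sup>2 - q\<^sup>2 = 2 * q + 1" by (simp add: power2_eq_square)
    then show ?thesis by simp
  qed
  finally have "m ((Suc q)\<^sup>2) - m (q\<^sup>2) \<le> (2 * real q + 1) * (D / t)" .
  then show ?thesis unfolding T using mono[OF assms(1)] mono[OF assms(2)] by linarith
qed

theorem strong_law_of_large_numbers:
  assumes \<kappa>: "1 < \<kappa>" and c: "0 < c" and \<alpha>: "\<And>n. n \<ge> 1 \<Longrightarrow> alpha_mixing M X n \<le> c * real n powr (- \<kappa>)"
  shows "AE \<omega> in M. (\<lambda>n. 1 / real n * T n \<omega>) \<longlonglongrightarrow> 0"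
proof -
  obtain L :: real where L: "0 < L"
    "\<And>A. finite A \<Longrightarrow> expectation (\<lambda>\<omega>. (\<Sum>k\<in>A. W k \<omega> - expectation (W k))\<^sup>2) \<le> L * card A"
    using centered_sum_square_linear[OF \<kappa> c \<alpha>] by blast
  \<comment> \<open>Linear growth of the second moment gives only \<open>L / n\<close> for the
    averages, which is not summable over all \<open>n\<close>; along squares it becomes
    \<open>L / q\<^sup>2\<close>.\<close>
  define Y where "Y q \<omega> = T (q\<^sup>2) \<omega> / (real q)\<^sup>2" for q \<omega>
  have "AE \<omega> in M. (\<lambda>q. (Y q \<omega>)\<^sup>2) \<longlonglongrightarrow> 0"
  proof (rule AE_tendsto_0_of_summable_expectation)
    show "integrable M (\<lambda>\<omega>. (Y q \<omega>)\<^sup>2)" for q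
      unfolding Y_def using T_integrable by (simp add: power_divide)
    have le: "expectation (\<lambda>\<omega>. (Y q \<omega>)\<^sup>2) \<le> L * (1 / (real q)\<^sup>2)" for q
    proof -
      have "expectation (\<lambda>\<omega>. (Y q \<omega>)\<^sup>2) = expectation (\<lambda>\<omega>. (T (q\<^sup>2) \<omega>)\<^sup>2) / (real q)^4"
        unfolding Y_def by (simp add: power_divide)
      also have "\<dots> \<le> (L * real (q\<^sup>2)) / (real q)^4"
        using L(2)[of "{1..q\<^sup>2}"] unfolding T_def by (intro divide_right_mono) auto
      finally show ?thesis by (cases "q = 0") (auto simp: power2_eq_square eval_nat_numeral)
    qed
    show "summable (\<lambda>q. expectation (\<lambda>\<omega>. (Y q \<omega>)\<^sup>2))"
      using le by (intro summable_comparison_test'[OF summable_mult[OF inverse_power_summable[of 2]], of 0 _ L])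
        (auto simp: divide_inverse)
  qed simp
  then show ?thesis
  proof (rule AE_mp, intro AE_I2 impI)
    fix \<omega> assume "(\<lambda>q. (Y q \<omega>)\<^sup>2) \<longlonglongrightarrow> 0"
    then have "(\<lambda>q. \<bar>Y q \<omega>\<bar>) \<longlonglongrightarrow> 0" using tendsto_real_sqrt by fastforce
    \<comment> \<open>A majorant between consecutive squares for \<open>q \<ge> 1\<close>: the 4
      comes from \<open>(q + 1)\<^sup>2 \<le> 4 * q\<^sup>2\<close>, the 3 from
      \<open>2 * q + 1 \<le> 3 * q\<close>.\<close>
    define E where "E q = \<bar>Y q \<omega>\<bar> + 4 * \<bar>Y (Suc q) \<omega>\<bar> + 3 * (D / t) / real q" for q
    have "E \<longlonglongrightarrow> 0 + 4 * 0 + 0"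
      unfolding E_def using \<open>(\<lambda>q. \<bar>Y q \<omega>\<bar>) \<longlonglongrightarrow> 0\<close>
      by (intro tendsto_intros LIMSEQ_Suc[of "\<lambda>q. \<bar>Y q \<omega>\<bar>"] lim_const_over_n) auto
    then have E: "E \<longlonglongrightarrow> 0" by simp
    have "filterlim floor_sqrt at_top sequentially"
      unfolding filterlim_at_top eventually_sequentially
    proof safe
      fix Z show "\<exists>N. \<forall>n\<ge>N. Z \<le> floor_sqrt n"
        by (intro exI[of _ "Z\<^sup>2"]) (use mono_floor_sqrt' in fastforce)
    qed
    with E have lim: "(\<lambda>n. E (floor_sqrt n)) \<longlonglongrightarrow> 0" by (rule filterlim_compose)
    show "(\<lambda>n. 1 / real n * T n \<omega>) \<longlonglongrightarrow> 0"
    proof (rule Lim_null_comparison[OF _ lim], rule eventually_sequentiallyI)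
      fix n :: nat assume n: "1 \<le> n"
      define q where "q = floor_sqrt n"
      have q1: "1 \<le> q" unfolding q_def using n by (simp add: le_floor_sqrt_iff)
      have q: "q\<^sup>2 \<le> n" "n \<le> (Suc q)\<^sup>2"
        unfolding q_def using Suc_floor_sqrt_power2_gt[of n] by auto
      have *: "(a + b + x * y) / z = a / z + b / z + x / z * y" for a b x y z :: real
        by (simp add: add_divide_distrib)
      have qn: "(real q)\<^sup>2 \<le> real n" using q(1) by (metis of_nat_le_iff of_nat_power)
      have "norm (1 / real n * T n \<omega>) = \<bar>T n \<omega>\<bar> / real n" using n by simp
      also have "\<dots> \<le> \<bar>T n \<omega>\<bar> / (real q)\<^sup>2"
        using qn q1 n by (intro divide_left_mono) auto
      also have "\<dots> \<le> (\<bar>T (q\<^sup>2) \<omega>\<bar> + \<bar>T ((Suc q)\<^sup>2) \<omega>\<bar> + (2 * real q + 1) * (D / t)) / (real q)\<^sup>2"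
        by (intro divide_right_mono T_between_squares q) auto
      also have "\<dots> = \<bar>Y q \<omega>\<bar> + \<bar>T ((Suc q)\<^sup>2) \<omega>\<bar> / (real q)\<^sup>2 + (2 * real q + 1) / (real q)\<^sup>2 * (D / t)"
        unfolding * Y_def by simp
      also have "\<dots> \<le> E q"
        unfolding E_def
      proof (intro add_mono order_refl)
        have "(real (Suc q))\<^sup>2 \<le> 4 * (real q)\<^sup>2"
          using q1 power_mono[of "real (Suc q)" "2 * real q" 2] by (simp add: power_mult_distrib)
        then have "\<bar>T ((Suc q)\<^sup>2) \<omega>\<bar> / (real q)\<^sup>2 \<le> \<bar>T ((Suc q)\<^sup>2) \<omega>\<bar> / ((real (Suc q))\<^sup>2 / 4)"
          using q1 by (intro divide_left_mono) auto
        also have "\<dots> = 4 * \<bar>Y (Suc q) \<omega>\<bar>" unfolding Y_def by simp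
        finally show "\<bar>T ((Suc q)\<^sup>2) \<omega>\<bar> / (real q)\<^sup>2 \<le> 4 * \<bar>Y (Suc q) \<omega>\<bar>" .
        have "(2 * real q + 1) / (real q)\<^sup>2 \<le> 3 * real q / (real q)\<^sup>2"
          using q1 by (intro divide_right_mono) auto
        also have "\<dots> = 3 / real q" using q1 by (simp add: power2_eq_square)
        finally have "(2 * real q + 1) / (real q)\<^sup>2 * (D / t) \<le> 3 / real q * (D / t)"
          using D_ge_1 t_pos by (intro mult_right_mono) auto
        then show "(2 * real q + 1) / (real q)\<^sup>2 * (D / t) \<le> 3 * (D / t) / real q" by (simp add: mult.commute)
      qed
      finally show "norm (1 / real n * T n \<omega>) \<le> E (floor_sqrt n)" unfolding q_def .
    qed
  qed
qed

end

section \<open>Characteristic functions and blocks\<close>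

lemma norm_iexp_diff_le: "cmod (iexp x - iexp y) \<le> \<bar>x - y\<bar>"
proof -
  have "iexp x - iexp y = iexp y * (iexp (x - y) - 1)"
    by (simp add: algebra_simps exp_add[symmetric])
  also have "cmod \<dots> = cmod (iexp (x - y) - 1)" by (simp add: norm_mult del: of_real_diff)
  also have "\<dots> \<le> \<bar>x - y\<bar>" using iexp_approx1[of "x - y" 0] by simp
  finally show ?thesis .
qed

text \<open>The upper estimate of \<open>exp (- y)\<close> passes through \<open>1 / (1 + y)\<close>
  and rests on \<open>(1 - y + y\<^sup>2) * (1 + y) = 1 + y ^ 3\<close>.\<close>

lemma exp_minus_approx:
  fixes y :: real assumes "0 \<le> y"
  shows "\<bar>(1 - y) - exp (- y)\<bar> \<le> y\<^sup>2"
proof -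
  have "exp (- y) \<ge> 1 - y" using exp_ge_add_one_self[of "- y"] by simp
  moreover have "exp (- y) \<le> 1 - y + y\<^sup>2"
  proof -
    have "exp (- y) \<le> 1 / (1 + y)"
      using exp_ge_add_one_self[of y] assms by (simp add: exp_minus field_simps)
    also have "\<dots> \<le> 1 - y + y\<^sup>2"
    proof -
      have "1 \<le> (1 - y + y\<^sup>2) * (1 + y)" using assms by (simp add: algebra_simps power2_eq_square)
      then show ?thesis using assms by (simp add: divide_le_eq)
    qed
    finally show ?thesis .
  qed
  ultimately show ?thesis by linarith
qed

text \<open>Cauchy-Schwarz twice, first for the \<open>f i\<close>, then for their squares.\<close>

lemma sum_power4_le:
  fixes f :: "'i \<Rightarrow> real"
  shows "(\<Sum>i\<in>I. f i) ^ 4 \<le> real (card I) ^ 3 * (\<Sum>i\<in>I. f i ^ 4)"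
proof -
  have "(\<Sum>i\<in>I. f i) ^ 4 = ((\<Sum>i\<in>I. f i)\<^sup>2)\<^sup>2" by simp
  also have "\<dots> \<le> ((\<Sum>i\<in>I. (f i)\<^sup>2) * card I)\<^sup>2"
    by (intro power_mono sum_squared_le_sum_of_squares) auto
  also have "\<dots> = (\<Sum>i\<in>I. (f i)\<^sup>2)\<^sup>2 * (card I)\<^sup>2" by (simp add: power_mult_distrib)
  also have "\<dots> \<le> ((\<Sum>i\<in>I. ((f i)\<^sup>2)\<^sup>2) * card I) * (card I)\<^sup>2"
    by (intro mult_right_mono sum_squared_le_sum_of_squares) auto
  also have "\<dots> = real (card I) ^ 3 * (\<Sum>i\<in>I. ((f i)\<^sup>2)\<^sup>2)"
    by (simp add: power2_eq_square power3_eq_cube mult_ac)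
  finally show ?thesis by simp
qed

section \<open>Characteristic functions of weakly dependent sums\<close>

context prob_space
begin

text \<open>The characteristic function of the law of \<open>Y\<close> at 1. Frequencies and
  scalings are put into \<open>Y\<close>, so that all sums remain random variables on one
  space.\<close>

definition cf :: "('a \<Rightarrow> real) \<Rightarrow> complex" where
  "cf Y = (CLINT \<omega>|M. iexp (Y \<omega>))"

lemma char_distr_eq_cf:
  "Y \<in> borel_measurable M \<Longrightarrow> char (distr M borel Y) u = cf (\<lambda>\<omega>. u * Y \<omega>)"
  unfolding char_def cf_def by (subst integral_distr) auto

lemma iexp_integrable: "Y \<in> borel_measurable M \<Longrightarrow> integrable M (\<lambda>\<omega>. iexp (Y \<omega>))"
  by (intro integrable_const_bound[of _ 1]) auto

lemma cf_le_1: "cmod (cf Y) \<le> 1"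
proof -
  have "cmod (cf Y) \<le> (\<integral>\<omega>. cmod (iexp (Y \<omega>)) \<partial>M)"
    unfolding cf_def by (rule integral_norm_bound)
  then show ?thesis by (simp add: prob_space)
qed

lemma cf_diff_le:
  assumes [measurable]: "Y \<in> borel_measurable M" "Y' \<in> borel_measurable M"
    and int: "integrable M (\<lambda>\<omega>. Y \<omega> - Y' \<omega>)"
  shows "cmod (cf Y - cf Y') \<le> expectation (\<lambda>\<omega>. \<bar>Y \<omega> - Y' \<omega>\<bar>)"
proof -
  have "cf Y - cf Y' = (CLINT \<omega>|M. iexp (Y \<omega>) - iexp (Y' \<omega>))"
    unfolding cf_def by (intro Bochner_Integration.integral_diff[symmetric] iexp_integrable) auto
  also have "cmod \<dots> \<le> expectation (\<lambda>\<omega>. \<bar>Y \<omega> - Y' \<omega>\<bar>)"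
    using int by (intro norm_integral_le_integral Bochner_Integration.integrable_diff
        iexp_integrable norm_iexp_diff_le) auto
  finally show ?thesis .
qed

lemma cf_eq_Complex:
  assumes [measurable]: "Y \<in> borel_measurable M"
  shows "cf Y = Complex (expectation (\<lambda>\<omega>. cos (Y \<omega>))) (expectation (\<lambda>\<omega>. sin (Y \<omega>)))"
proof -
  have i: "integrable M (\<lambda>\<omega>. iexp (Y \<omega>))" by (rule iexp_integrable) simp
  have "Re (cf Y) = (\<integral>\<omega>. Re (iexp (Y \<omega>)) \<partial>M)" "Im (cf Y) = (\<integral>\<omega>. Im (iexp (Y \<omega>)) \<partial>M)"
    unfolding cf_def using integral_bounded_linear[OF bounded_linear_Re i]
      integral_bounded_linear[OF bounded_linear_Im i] by simp_all
  then show ?thesis by (simp add: complex_eq_iff Re_exp Im_exp)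
qed

text \<open>Real and imaginary part together consist of four covariances of sines and cosines, each
  at most \<open>4 * alpha_mixing M X n\<close>.\<close>

lemma cf_add_le_alpha_mixing:
  assumes X: "\<And>k. X k \<in> borel_measurable M"
    and f: "f \<in> borel_measurable (generated_algebra M X {..j})"
    and g: "g \<in> borel_measurable (generated_algebra M X {j + n..})"
  shows "cmod (cf (\<lambda>\<omega>. f \<omega> + g \<omega>) - cf f * cf g) \<le> 16 * alpha_mixing M X n"
proof -
  have [measurable]: "f \<in> borel_measurable M" "g \<in> borel_measurable M"
    using f g X by (auto intro: measurable_from_subalg[OF subalgebra_generated_algebra])
  let ?C = "\<lambda>p q. expectation (\<lambda>\<omega>. p (f \<omega>) * q (g \<omega>)) - expectation (\<lambda>\<omega>. p (f \<omega>)) * expectation (\<lambda>\<omega>. q (g \<omega>))"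
  have cov: "\<bar>?C p q\<bar> \<le> 4 * alpha_mixing M X n"
    if p: "p \<in> borel_measurable borel" "\<And>x. \<bar>p x\<bar> \<le> 1" and q: "q \<in> borel_measurable borel" "\<And>x. \<bar>q x\<bar> \<le> 1"
    for p q :: "real \<Rightarrow> real"
    using covariance_le_alpha_mixing[OF X measurable_compose[OF f p(1)] p(2) measurable_compose[OF g q(1)] q(2)]
    by simp
  have m: "(cos :: real \<Rightarrow> real) \<in> borel_measurable borel" "(sin :: real \<Rightarrow> real) \<in> borel_measurable borel"
    by measurable
  have i: "integrable M (\<lambda>\<omega>. p (f \<omega>) * q (g \<omega>))"
    if "p \<in> {sin, cos}" "q \<in> {sin, cos}" for p q :: "real \<Rightarrow> real"
    using that by (intro integrable_const_bound[of _ 1])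
      (auto simp: abs_mult intro!: mult_le_one AE_I2)
  have Re: "Re (cf (\<lambda>\<omega>. f \<omega> + g \<omega>) - cf f * cf g) = ?C cos cos - ?C sin sin"
    and Im: "Im (cf (\<lambda>\<omega>. f \<omega> + g \<omega>) - cf f * cf g) = ?C sin cos + ?C cos sin"
    using i[of cos cos] i[of sin sin] i[of sin cos] i[of cos sin]
    by (simp add: cf_eq_Complex cos_add sin_add; simp add: algebra_simps)+
  have "cmod (cf (\<lambda>\<omega>. f \<omega> + g \<omega>) - cf f * cf g) \<le> \<bar>?C cos cos - ?C sin sin\<bar> + \<bar>?C sin cos + ?C cos sin\<bar>"
    unfolding Re[symmetric] Im[symmetric] by (rule cmod_le)
  also have "\<dots> \<le> 16 * alpha_mixing M X n"
  proof -
    have "\<bar>?C cos cos\<bar> \<le> 4 * alpha_mixing M X n" "\<bar>?C sin sin\<bar> \<le> 4 * alpha_mixing M X n"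
      "\<bar>?C sin cos\<bar> \<le> 4 * alpha_mixing M X n" "\<bar>?C cos sin\<bar> \<le> 4 * alpha_mixing M X n"
      using m by (intro cov; simp)+
    then show ?thesis by linarith
  qed
  finally show ?thesis .
qed

text \<open>AM-GM, \<open>2 \<bar>x\<bar>\<^sup>3 \<le> \<eta> x\<^sup>2 + x^4 / \<eta>\<close>, replaces the third absolute moment by even moments.\<close>

lemma cf_gaussian_approx:
  assumes [measurable]: "Y \<in> borel_measurable M" and int: "integrable M Y" "integrable M (\<lambda>\<omega>. (Y \<omega>)\<^sup>2)"
    "integrable M (\<lambda>\<omega>. Y \<omega> ^ 4)" and mean: "expectation Y = 0" and \<eta>: "0 < \<eta>"
  defines "v \<equiv> expectation (\<lambda>\<omega>. (Y \<omega>)\<^sup>2)"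
  shows "cmod (cf Y - of_real (exp (- (v / 2)))) \<le> (\<eta> * v + expectation (\<lambda>\<omega>. Y \<omega> ^ 4) / \<eta>) / 12 + v\<^sup>2 / 4"
proof -
  have v: "0 \<le> v" unfolding v_def by simp
  have var: "variance Y = v" unfolding v_def mean by simp
  have bi: "integrable M (\<lambda>\<omega>. (\<eta> * (Y \<omega>)\<^sup>2 + Y \<omega> ^ 4 / \<eta>) / 2)" using int by auto
  have pw: "min (6 * x\<^sup>2) (\<bar>x\<bar> ^ 3) \<le> (\<eta> * x\<^sup>2 + x ^ 4 / \<eta>) / 2" for x :: real
  proof -
    have "\<bar>x\<bar> ^ 3 * 2 = 2 * (sqrt \<eta> * \<bar>x\<bar>) * (x\<^sup>2 / sqrt \<eta>)"
      using \<eta> by (simp add: power3_eq_cube power2_eq_square)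
    also have "\<dots> \<le> (sqrt \<eta> * \<bar>x\<bar>)\<^sup>2 + (x\<^sup>2 / sqrt \<eta>)\<^sup>2" by (rule sum_squares_bound)
    also have "\<dots> = \<eta> * x\<^sup>2 + x ^ 4 / \<eta>" using \<eta> by (simp add: power_mult_distrib power_divide)
    finally have "\<bar>x\<bar> ^ 3 \<le> (\<eta> * x\<^sup>2 + x ^ 4 / \<eta>) / 2" by simp
    then show ?thesis by (rule min.coboundedI2)
  qed
  have "cmod (cf Y - complex_of_real (1 - v / 2)) \<le> 1 / 6 * expectation (\<lambda>\<omega>. min (6 * (Y \<omega>)\<^sup>2) (\<bar>Y \<omega>\<bar> ^ 3))"
    using char_approx3'[OF _ int(1,2) mean var refl, of 1] char_distr_eq_cf[of Y 1] by simp
  also have "\<dots> \<le> 1 / 6 * expectation (\<lambda>\<omega>. (\<eta> * (Y \<omega>)\<^sup>2 + Y \<omega> ^ 4 / \<eta>) / 2)"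
  proof (intro mult_left_mono integral_mono pw bi)
    show "integrable M (\<lambda>\<omega>. min (6 * (Y \<omega>)\<^sup>2) (\<bar>Y \<omega>\<bar> ^ 3))"
      using int(2) by (intro Bochner_Integration.integrable_bound[OF integrable_mult_right[OF int(2), of 6]]) (auto intro!: AE_I2)
  qed simp
  also have "\<dots> = (\<eta> * v + expectation (\<lambda>\<omega>. Y \<omega> ^ 4) / \<eta>) / 12"
    unfolding v_def using int by simp
  finally have 1: "cmod (cf Y - complex_of_real (1 - v / 2)) \<le> (\<eta> * v + expectation (\<lambda>\<omega>. Y \<omega> ^ 4) / \<eta>) / 12" .
  \<comment> \<open>The quadratic Taylor polynomial is traded for an exponential so that the
    approximations of several blocks multiply to a single Gaussian factor.\<close>
  have "cmod (complex_of_real (1 - v / 2) - of_real (exp (- (v / 2)))) = \<bar>(1 - v / 2) - exp (- (v / 2))\<bar>"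
    by (simp only: of_real_diff[symmetric] norm_of_real)
  also have "\<dots> \<le> v\<^sup>2 / 4" using exp_minus_approx[of "v / 2"] v by (simp add: power_divide)
  finally have 2: "cmod (complex_of_real (1 - v / 2) - of_real (exp (- (v / 2)))) \<le> v\<^sup>2 / 4" .
  show ?thesis using norm_diff_triangle_le[OF 1 2] .
qed

end

section \<open>Fourth moments and Bernstein blocks\<close>

context lindley_walk
begin

definition C4 :: real where "C4 = fact 4 / t ^ 4 * D + (D / t) ^ 4"

lemma centered_power4:
  "integrable M (\<lambda>\<omega>. (W k \<omega> - expectation (W k)) ^ 4)"
  "expectation (\<lambda>\<omega>. (W k \<omega> - expectation (W k)) ^ 4) \<le> C4"
proof -
  have le: "(x - y) ^ 4 \<le> x ^ 4 + y ^ 4" if "0 \<le> x" "0 \<le> y" for x y :: real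
  proof -
    have "(x - y) ^ 4 = \<bar>x - y\<bar> ^ 4" by simp
    also have "\<dots> \<le> (max x y) ^ 4" using that by (intro power_mono) auto
    also have "\<dots> \<le> x ^ 4 + y ^ 4" by (auto simp: max_def)
    finally show ?thesis .
  qed
  have i: "integrable M (\<lambda>\<omega>. W k \<omega> ^ 4 + expectation (W k) ^ 4)" using W_power(1)[of k 4] by auto
  show i2: "integrable M (\<lambda>\<omega>. (W k \<omega> - expectation (W k)) ^ 4)"
    using le[OF W_nonneg W_mean_nonneg] by (intro Bochner_Integration.integrable_bound[OF i]) (auto intro!: AE_I2)
  have "expectation (\<lambda>\<omega>. (W k \<omega> - expectation (W k)) ^ 4) \<le> expectation (\<lambda>\<omega>. W k \<omega> ^ 4 + expectation (W k) ^ 4)"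
    by (intro integral_mono i i2 le W_nonneg W_mean_nonneg)
  also have "\<dots> = expectation (\<lambda>\<omega>. W k \<omega> ^ 4) + expectation (W k) ^ 4"
    using W_power(1)[of k 4] by (simp add: prob_space)
  also have "\<dots> \<le> C4" unfolding C4_def
    by (intro add_mono W_power power_mono W_mean_le W_mean_nonneg)
  finally show "expectation (\<lambda>\<omega>. (W k \<omega> - expectation (W k)) ^ 4) \<le> C4" .
qed

text \<open>Deliberately crude: weak dependence would suggest the square of the number of summands,
  but the fourth power is affordable because the blocks will be very short compared with
  \<open>n\<close>.\<close>

lemma centered_sum_power4:
  assumes "finite A"
  shows "integrable M (\<lambda>\<omega>. (\<Sum>k\<in>A. W k \<omega> - expectation (W k)) ^ 4)"
   "expectation (\<lambda>\<omega>. (\<Sum>k\<in>A. W k \<omega> - expectation (W k)) ^ 4) \<le> real (card A) ^ 4 * C4"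
proof -
  let ?w = "\<lambda>k \<omega>. W k \<omega> - expectation (W k)"
  have i: "integrable M (\<lambda>\<omega>. real (card A) ^ 3 * (\<Sum>k\<in>A. ?w k \<omega> ^ 4))"
    using centered_power4 by auto
  show i2: "integrable M (\<lambda>\<omega>. (\<Sum>k\<in>A. ?w k \<omega>) ^ 4)"
    using sum_power4_le[of "\<lambda>k. ?w k _" A]
    by (intro Bochner_Integration.integrable_bound[OF i]) (auto intro!: AE_I2 simp: sum_nonneg)
  have "expectation (\<lambda>\<omega>. (\<Sum>k\<in>A. ?w k \<omega>) ^ 4) \<le> expectation (\<lambda>\<omega>. real (card A) ^ 3 * (\<Sum>k\<in>A. ?w k \<omega> ^ 4))"
    by (intro integral_mono i i2 sum_power4_le)
  also have "\<dots> = real (card A) ^ 3 * (\<Sum>k\<in>A. expectation (\<lambda>\<omega>. ?w k \<omega> ^ 4))"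
    using centered_power4 by simp
  also have "\<dots> \<le> real (card A) ^ 3 * (\<Sum>k\<in>A. C4)"
    by (intro mult_left_mono sum_mono centered_power4) auto
  finally show "expectation (\<lambda>\<omega>. (\<Sum>k\<in>A. ?w k \<omega>) ^ 4) \<le> real (card A) ^ 4 * C4"
    by (simp add: eval_nat_numeral)
qed

text \<open>Bernstein's method: gaps of length \<open>q\<close> separate \<open>N\<close> blocks of length \<open>p\<close>, and inside the blocks \<open>W\<close> is
  replaced by \<open>V m\<close>, which only looks \<open>m\<close> steps back.\<close>

lemma cf_blocks:
  assumes L: "0 \<le> L" "\<And>A. finite A \<Longrightarrow> expectation (\<lambda>\<omega>. (\<Sum>k\<in>A. W k \<omega> - expectation (W k))\<^sup>2) \<le> L * real (card A)"
    and n: "N * (p + q) \<le> n" and m: "m \<le> q" and \<eta>: "0 < \<eta>"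
  shows "\<exists>v. 0 \<le> v \<and> v \<le> L * real n \<and> (\<forall>a.
    cmod (cf (\<lambda>\<omega>. a * T n \<omega>) - of_real (exp (- (a\<^sup>2 * v / 2)))) \<le>
      \<bar>a\<bar> * sqrt (L * real (n - N * p)) + 2 * (\<bar>a\<bar> * real n * (D / t * \<rho> ^ m)) + real N * (16 * alpha_mixing M X (q - m)) +
      real N * ((\<eta> * (a\<^sup>2 * (L * real p)) + a ^ 4 * (real p ^ 4 * C4) / \<eta>) / 12 + (a\<^sup>2 * (L * real p))\<^sup>2 / 4))"
proof -
  let ?w = "\<lambda>k \<omega>. W k \<omega> - expectation (W k)"
  define b where "b = p + q"
  \<comment> \<open>Each period of length \<open>b\<close> begins with its gap, so every block,
    including the first, has \<open>q\<close> skipped indices directly before it.\<close>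
  define I where "I i = {i * b + q<..i * b + b}" for i
  define S where "S i \<omega> = (\<Sum>k\<in>I i. ?w k \<omega>)" for i \<omega>
  \<comment> \<open>Centered by the mean of \<open>W k\<close> rather than of \<open>V m k\<close>,
    so that \<open>S i - S' i\<close> is a sum of nonnegative restart errors; the constant shift
    does not affect measurability with respect to the window.\<close>
  define S' where "S' i \<omega> = (\<Sum>k\<in>I i. V m k \<omega> - expectation (W k))" for i \<omega>
  have fin[simp]: "finite (I i)" and card: "card (I i) = p" for i unfolding I_def b_def by auto
  have disj: "I i \<inter> I j = {}" if "i \<noteq> j" for i j
  proof -
    have *: "I i \<inter> I j = {}" if "i < j" for i j
    proof -
      have "Suc i * b \<le> j * b" using that by (intro mult_right_mono) auto
      then show ?thesis unfolding I_def by auto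
    qed
    show ?thesis using *[of i j] *[of j i] that by (cases "i < j") auto
  qed
  have sub: "I i \<subseteq> {1..n}" if "i < N" for i
  proof -
    have "Suc i * b \<le> N * b" using that by (intro mult_right_mono) auto
    then show ?thesis unfolding I_def using n by (auto simp: b_def)
  qed
  define J where "J = (\<Union>i<N. I i)"
  have J: "J \<subseteq> {1..n}" using sub by (auto simp: J_def)
  have cardJ: "card J = N * p"
    unfolding J_def using disj card by (subst card_UN_disjoint) auto
  have sumJ: "(\<Sum>k\<in>J. f k) = (\<Sum>i<N. \<Sum>k\<in>I i. f k)" for f :: "nat \<Rightarrow> real"
    unfolding J_def using disj by (subst sum.UNION_disjoint) auto
  have [measurable]: "S i \<in> borel_measurable M" "S' i \<in> borel_measurable M" "T n \<in> borel_measurable M" for i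
    unfolding S_def S'_def T_def by measurable
  have Si: "integrable M (S i)" for i unfolding S_def by auto
  have S2: "integrable M (\<lambda>\<omega>. (S i \<omega>)\<^sup>2)" "expectation (\<lambda>\<omega>. (S i \<omega>)\<^sup>2) \<le> L * real p" for i
    unfolding S_def using centered_sum_square(1)[of "I i"] L(2)[of "I i"] card by auto
  have S4: "integrable M (\<lambda>\<omega>. S i \<omega> ^ 4)" "expectation (\<lambda>\<omega>. S i \<omega> ^ 4) \<le> real p ^ 4 * C4" for i
    unfolding S_def using centered_sum_power4[of "I i"] card by auto
  have S0: "expectation (S i) = 0" for i unfolding S_def by (simp add: prob_space)
  have SS': "integrable M (\<lambda>\<omega>. S i \<omega> - S' i \<omega>)" "expectation (\<lambda>\<omega>. \<bar>S i \<omega> - S' i \<omega>\<bar>) \<le> real p * (D / t * \<rho> ^ m)" for i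
  proof -
    have eq: "S i \<omega> - S' i \<omega> = (\<Sum>k\<in>I i. W k \<omega> - V m k \<omega>)" for \<omega>
      unfolding S_def S'_def sum_subtractf[symmetric] by (intro sum.cong) auto
    show "integrable M (\<lambda>\<omega>. S i \<omega> - S' i \<omega>)" unfolding eq using W_diff_V(2) by auto
    have "expectation (\<lambda>\<omega>. \<bar>S i \<omega> - S' i \<omega>\<bar>) = expectation (\<lambda>\<omega>. \<Sum>k\<in>I i. W k \<omega> - V m k \<omega>)"
      unfolding eq by (intro Bochner_Integration.integral_cong abs_of_nonneg sum_nonneg W_diff_V refl)
    also have "\<dots> = (\<Sum>k\<in>I i. expectation (\<lambda>\<omega>. W k \<omega> - V m k \<omega>))"
      by (intro Bochner_Integration.integral_sum W_diff_V)
    also have "\<dots> \<le> (\<Sum>k\<in>I i. D / t * \<rho> ^ m)" by (intro sum_mono W_diff_V)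
    finally show "expectation (\<lambda>\<omega>. \<bar>S i \<omega> - S' i \<omega>\<bar>) \<le> real p * (D / t * \<rho> ^ m)" by (simp add: card)
  qed
  \<comment> \<open>The sum of the block variances, without covariances between blocks. It does not
    depend on the frequency \<open>a\<close>, so one normal law serves all frequencies.\<close>
  define v where "v = (\<Sum>i<N. expectation (\<lambda>\<omega>. (S i \<omega>)\<^sup>2))"
  have Npn: "real N * real p \<le> real n"
  proof -
    have "N * p \<le> n" using n by (simp add: distrib_left)
    then show ?thesis by (metis of_nat_le_iff of_nat_mult)
  qed
  have v: "0 \<le> v" "v \<le> L * real n"
  proof -
    show "0 \<le> v" unfolding v_def by (intro sum_nonneg) auto
    have "v \<le> (\<Sum>i<N. L * real p)" unfolding v_def by (intro sum_mono S2)
    also have "\<dots> = L * (real N * real p)" by simp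
    also have "\<dots> \<le> L * real n" using Npn L(1) by (intro mult_left_mono)
    finally show "v \<le> L * real n" .
  qed
  have small: "real N * (\<bar>a\<bar> * (real p * (D / t * \<rho> ^ m))) \<le> \<bar>a\<bar> * real n * (D / t * \<rho> ^ m)" for a
  proof -
    have "(real N * real p) * (\<bar>a\<bar> * (D / t * \<rho> ^ m)) \<le> real n * (\<bar>a\<bar> * (D / t * \<rho> ^ m))"
      using Npn D_ge_1 t_pos \<rho> by (intro mult_right_mono) auto
    then show ?thesis by (simp add: mult_ac)
  qed
  \<comment> \<open>Discards the gaps and the incomplete last period, \<open>n - N * p\<close>
    indices in all, whose second moment is linear in their number.\<close>
  have step1: "cmod (cf (\<lambda>\<omega>. a * T n \<omega>) - cf (\<lambda>\<omega>. a * (\<Sum>i<N. S i \<omega>))) \<le> \<bar>a\<bar> * sqrt (L * real (n - N * p))" for a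
  proof -
    let ?R = "{1..n} - J"
    have R: "T n \<omega> - (\<Sum>i<N. S i \<omega>) = (\<Sum>k\<in>?R. ?w k \<omega>)" for \<omega>
      unfolding T_def S_def sumJ[symmetric] using J by (subst sum_diff) auto
    have iR: "integrable M (\<lambda>\<omega>. \<Sum>k\<in>?R. ?w k \<omega>)" by auto
    have "cmod (cf (\<lambda>\<omega>. a * T n \<omega>) - cf (\<lambda>\<omega>. a * (\<Sum>i<N. S i \<omega>))) \<le>
        expectation (\<lambda>\<omega>. \<bar>a * T n \<omega> - a * (\<Sum>i<N. S i \<omega>)\<bar>)"
      using T_integrable Si by (intro cf_diff_le) auto
    also have "\<dots> = \<bar>a\<bar> * expectation (\<lambda>\<omega>. \<bar>\<Sum>k\<in>?R. ?w k \<omega>\<bar>)"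
      unfolding right_diff_distrib[symmetric] R abs_mult by simp
    also have "\<dots> \<le> \<bar>a\<bar> * sqrt (expectation (\<lambda>\<omega>. (\<Sum>k\<in>?R. ?w k \<omega>)\<^sup>2))"
      by (intro mult_left_mono expectation_abs_le_sqrt iR centered_sum_square) auto
    also have "\<dots> \<le> \<bar>a\<bar> * sqrt (L * real (n - N * p))"
    proof (intro mult_left_mono real_sqrt_le_mono)
      have "card ?R = n - N * p" using J cardJ by (subst card_Diff_subset) (auto intro: finite_subset)
      then show "expectation (\<lambda>\<omega>. (\<Sum>k\<in>?R. ?w k \<omega>)\<^sup>2) \<le> L * real (n - N * p)"
        using L(2)[of ?R] by simp
    qed simp
    finally show ?thesis .
  qed
  have step2: "cmod (cf (\<lambda>\<omega>. a * (\<Sum>i<N. S i \<omega>)) - cf (\<lambda>\<omega>. a * (\<Sum>i<N. S' i \<omega>))) \<le> \<bar>a\<bar> * real n * (D / t * \<rho> ^ m)" for a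
  proof -
    have eq: "a * (\<Sum>i<N. S i \<omega>) - a * (\<Sum>i<N. S' i \<omega>) = (\<Sum>i<N. a * (S i \<omega> - S' i \<omega>))" for \<omega>
      by (simp add: sum_distrib_left sum_subtractf right_diff_distrib)
    have "cmod (cf (\<lambda>\<omega>. a * (\<Sum>i<N. S i \<omega>)) - cf (\<lambda>\<omega>. a * (\<Sum>i<N. S' i \<omega>))) \<le>
        expectation (\<lambda>\<omega>. \<bar>a * (\<Sum>i<N. S i \<omega>) - a * (\<Sum>i<N. S' i \<omega>)\<bar>)"
      using SS'(1) by (intro cf_diff_le) (auto simp: eq)
    also have "\<dots> \<le> expectation (\<lambda>\<omega>. \<Sum>i<N. \<bar>a\<bar> * \<bar>S i \<omega> - S' i \<omega>\<bar>)"
      unfolding eq using SS'(1)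
      by (intro integral_mono) (auto intro!: order_trans[OF sum_abs] sum_mono simp: abs_mult)
    also have "\<dots> = (\<Sum>i<N. \<bar>a\<bar> * expectation (\<lambda>\<omega>. \<bar>S i \<omega> - S' i \<omega>\<bar>))"
      using SS'(1) by simp
    also have "\<dots> \<le> (\<Sum>i<N. \<bar>a\<bar> * (real p * (D / t * \<rho> ^ m)))"
      by (intro sum_mono mult_left_mono SS') auto
    finally show ?thesis using small[of a] by simp
  qed
  have V_meas: "V m k \<in> borel_measurable (generated_algebra M X K)" if "{k - m..<k} \<subseteq> K" for k K
    using that V_measurable by (rule measurable_generated_algebra_mono)
  \<comment> \<open>Splits off one block at a time. The earlier sums use increments up to
    \<open>k * b\<close>; the next block lies beyond \<open>k * b + q\<close> and looks back
    \<open>m\<close>, which leaves a gap of \<open>q - m\<close>.\<close>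
  have step3: "cmod (cf (\<lambda>\<omega>. a * (\<Sum>i<k. S' i \<omega>)) - (\<Prod>i<k. cf (\<lambda>\<omega>. a * S' i \<omega>))) \<le>
      real k * (16 * alpha_mixing M X (q - m))" for a k
  proof (induction k)
    case 0
    then show ?case by (simp add: cf_def prob_space)
  next
    case (Suc k)
    let ?P = "cf (\<lambda>\<omega>. a * (\<Sum>i<k. S' i \<omega>))" and ?Q = "cf (\<lambda>\<omega>. a * S' k \<omega>)"
      and ?R = "\<Prod>i<k. cf (\<lambda>\<omega>. a * S' i \<omega>)"
    have "cmod (cf (\<lambda>\<omega>. a * (\<Sum>i<k. S' i \<omega>) + a * S' k \<omega>) - ?P * ?Q) \<le> 16 * alpha_mixing M X (q - m)"
    proof (rule cf_add_le_alpha_mixing[where j="k * b"])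
      have "S' i \<in> borel_measurable (generated_algebra M X {..k * b})" if "i < k" for i
      proof -
        have "Suc i * b \<le> k * b" using that by (intro mult_right_mono) auto
        then show ?thesis unfolding S'_def I_def
          by (intro borel_measurable_sum borel_measurable_diff V_meas) auto
      qed
      then show "(\<lambda>\<omega>. a * (\<Sum>i<k. S' i \<omega>)) \<in> borel_measurable (generated_algebra M X {..k * b})"
        by (intro borel_measurable_times borel_measurable_const borel_measurable_sum) auto
      have "S' k \<in> borel_measurable (generated_algebra M X {k * b + (q - m)..})"
        unfolding S'_def I_def using m by (intro borel_measurable_sum borel_measurable_diff V_meas) auto
      then show "(\<lambda>\<omega>. a * S' k \<omega>) \<in> borel_measurable (generated_algebra M X {k * b + (q - m)..})"
        by (intro borel_measurable_times borel_measurable_const)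
    qed simp
    moreover have "cmod (?P * ?Q - ?R * ?Q) \<le> real k * (16 * alpha_mixing M X (q - m))"
    proof -
      have "cmod (?P * ?Q - ?R * ?Q) = cmod (?P - ?R) * cmod ?Q"
        by (simp add: left_diff_distrib[symmetric] norm_mult)
      also have "\<dots> \<le> cmod (?P - ?R) * 1" by (intro mult_left_mono cf_le_1) auto
      finally show ?thesis using Suc.IH by simp
    qed
    ultimately have "cmod (cf (\<lambda>\<omega>. a * (\<Sum>i<k. S' i \<omega>) + a * S' k \<omega>) - ?R * ?Q) \<le>
        16 * alpha_mixing M X (q - m) + real k * (16 * alpha_mixing M X (q - m))"
      by (rule norm_diff_triangle_le)
    then show ?case by (simp add: distrib_left algebra_simps)
  qed
  \<comment> \<open>Returns from \<open>S'\<close> to \<open>S\<close> inside the product, because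
    the Gaussian approximation needs mean zero and the moment bounds of \<open>S\<close>.\<close>
  have step4: "cmod ((\<Prod>i<N. cf (\<lambda>\<omega>. a * S' i \<omega>)) - (\<Prod>i<N. cf (\<lambda>\<omega>. a * S i \<omega>))) \<le> \<bar>a\<bar> * real n * (D / t * \<rho> ^ m)" for a
  proof -
    have "cmod ((\<Prod>i<N. cf (\<lambda>\<omega>. a * S' i \<omega>)) - (\<Prod>i<N. cf (\<lambda>\<omega>. a * S i \<omega>))) \<le>
      (\<Sum>i<N. cmod (cf (\<lambda>\<omega>. a * S' i \<omega>) - cf (\<lambda>\<omega>. a * S i \<omega>)))"
      by (intro norm_prod_diff cf_le_1)
    also have "\<dots> \<le> (\<Sum>i<N. \<bar>a\<bar> * (real p * (D / t * \<rho> ^ m)))"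
    proof (rule sum_mono)
      fix i
      have "cmod (cf (\<lambda>\<omega>. a * S' i \<omega>) - cf (\<lambda>\<omega>. a * S i \<omega>)) = cmod (cf (\<lambda>\<omega>. a * S i \<omega>) - cf (\<lambda>\<omega>. a * S' i \<omega>))"
        by (rule norm_minus_commute)
      also have "\<dots> \<le> expectation (\<lambda>\<omega>. \<bar>a * S i \<omega> - a * S' i \<omega>\<bar>)"
        using SS'(1)[of i] by (intro cf_diff_le) (auto simp: right_diff_distrib[symmetric])
      also have "\<dots> = \<bar>a\<bar> * expectation (\<lambda>\<omega>. \<bar>S i \<omega> - S' i \<omega>\<bar>)"
        by (simp add: right_diff_distrib[symmetric] abs_mult)
      also have "\<dots> \<le> \<bar>a\<bar> * (real p * (D / t * \<rho> ^ m))" by (intro mult_left_mono SS') auto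
      finally show "cmod (cf (\<lambda>\<omega>. a * S' i \<omega>) - cf (\<lambda>\<omega>. a * S i \<omega>)) \<le> \<bar>a\<bar> * (real p * (D / t * \<rho> ^ m))" .
    qed
    finally show ?thesis using small[of a] by simp
  qed
  have step5: "cmod ((\<Prod>i<N. cf (\<lambda>\<omega>. a * S i \<omega>)) - of_real (exp (- (a\<^sup>2 * v / 2)))) \<le>
      real N * ((\<eta> * (a\<^sup>2 * (L * real p)) + a ^ 4 * (real p ^ 4 * C4) / \<eta>) / 12 + (a\<^sup>2 * (L * real p))\<^sup>2 / 4)" for a
  proof -
    define u where "u i = a\<^sup>2 * expectation (\<lambda>\<omega>. (S i \<omega>)\<^sup>2)" for i
    have u: "0 \<le> u i" "u i \<le> a\<^sup>2 * (L * real p)" for i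
      unfolding u_def using S2(2) by (auto intro!: mult_left_mono)
    have prod: "of_real (exp (- (a\<^sup>2 * v / 2))) = (\<Prod>i<N. complex_of_real (exp (- (u i / 2))))"
      unfolding v_def u_def
      by (simp add: exp_sum[symmetric] of_real_prod[symmetric] sum_distrib_left sum_negf sum_divide_distrib del: of_real_prod)
    have "cmod ((\<Prod>i<N. cf (\<lambda>\<omega>. a * S i \<omega>)) - of_real (exp (- (a\<^sup>2 * v / 2)))) \<le>
      (\<Sum>i<N. cmod (cf (\<lambda>\<omega>. a * S i \<omega>) - of_real (exp (- (u i / 2)))))"
      unfolding prod using u by (intro norm_prod_diff cf_le_1) simp
    also have "\<dots> \<le> (\<Sum>i<N. (\<eta> * (a\<^sup>2 * (L * real p)) + a ^ 4 * (real p ^ 4 * C4) / \<eta>) / 12 + (a\<^sup>2 * (L * real p))\<^sup>2 / 4)"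
    proof (rule sum_mono)
      fix i
      have ui: "expectation (\<lambda>\<omega>. (a * S i \<omega>)\<^sup>2) = u i" unfolding u_def by (simp add: power_mult_distrib)
      have "cmod (cf (\<lambda>\<omega>. a * S i \<omega>) - of_real (exp (- (u i / 2)))) \<le>
        (\<eta> * u i + expectation (\<lambda>\<omega>. (a * S i \<omega>) ^ 4) / \<eta>) / 12 + (u i)\<^sup>2 / 4"
        unfolding ui[symmetric] using Si S2 S4 S0 \<eta>
        by (intro cf_gaussian_approx) (auto simp: power_mult_distrib)
      also have "expectation (\<lambda>\<omega>. (a * S i \<omega>) ^ 4) = a ^ 4 * expectation (\<lambda>\<omega>. S i \<omega> ^ 4)"
        by (simp add: power_mult_distrib)
      also have "(\<eta> * u i + a ^ 4 * expectation (\<lambda>\<omega>. S i \<omega> ^ 4) / \<eta>) / 12 + (u i)\<^sup>2 / 4 \<le>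
        (\<eta> * (a\<^sup>2 * (L * real p)) + a ^ 4 * (real p ^ 4 * C4) / \<eta>) / 12 + (a\<^sup>2 * (L * real p))\<^sup>2 / 4"
        using u[of i] \<eta> S4(2)[of i] by (intro add_mono divide_right_mono mult_left_mono power_mono) auto
      finally show "cmod (cf (\<lambda>\<omega>. a * S i \<omega>) - of_real (exp (- (u i / 2)))) \<le>
        (\<eta> * (a\<^sup>2 * (L * real p)) + a ^ 4 * (real p ^ 4 * C4) / \<eta>) / 12 + (a\<^sup>2 * (L * real p))\<^sup>2 / 4" .
    qed
    finally show ?thesis by simp
  qed
  show ?thesis
  proof (rule exI[of _ v], intro conjI[OF v(1) conjI[OF v(2)]] allI)
    fix a
    show "cmod (cf (\<lambda>\<omega>. a * T n \<omega>) - of_real (exp (- (a\<^sup>2 * v / 2)))) \<le>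
      \<bar>a\<bar> * sqrt (L * real (n - N * p)) + 2 * (\<bar>a\<bar> * real n * (D / t * \<rho> ^ m)) + real N * (16 * alpha_mixing M X (q - m)) +
      real N * ((\<eta> * (a\<^sup>2 * (L * real p)) + a ^ 4 * (real p ^ 4 * C4) / \<eta>) / 12 + (a\<^sup>2 * (L * real p))\<^sup>2 / 4)"
      using norm_diff_triangle_le[OF norm_diff_triangle_le[OF norm_diff_triangle_le[OF norm_diff_triangle_le[OF
        step1[of a] step2[of a]] step3[of a N]] step4[of a]] step5[of a]] by (simp add: algebra_simps)
  qed
qed

end

section \<open>Gaussian tail bounds\<close>

text \<open>The \<open>v n\<close> need not converge, so a subsequence realizing the limes superior
  is thinned by compactness of \<open>[0, L]\<close> until they do. The limit law is then normal
  with variance at most \<open>L\<close>, and the strict inequality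
  \<open>L < \<sigma>\<^sup>2\<close> leads from the closed event with \<open>\<ge> a\<close> to the
  open complement of \<open>[-a, a]\<close>.\<close>

lemma (in prob_space) limsup_prob_le_of_cf:
  fixes Y :: "nat \<Rightarrow> 'a \<Rightarrow> real"
  assumes [measurable]: "\<And>n. Y n \<in> borel_measurable M"
    and v: "\<And>n. 0 \<le> v n" "\<And>n. v n \<le> L" and \<sigma>: "0 < \<sigma>" "L < \<sigma>\<^sup>2"
    and lim: "\<And>u. (\<lambda>n. cf (\<lambda>\<omega>. u * Y n \<omega>) - of_real (exp (- (u\<^sup>2 * v n / 2)))) \<longlonglongrightarrow> 0"
    and a: "0 < a"
  shows "limsup (\<lambda>n. ereal (prob {\<omega> \<in> space M. \<bar>Y n \<omega>\<bar> \<ge> a})) \<le>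
    ereal (\<integral>x. indicator (- {-a..a}) (\<sigma> * x) * std_normal_density x \<partial>lborel)"
proof -
  let ?N = "std_normal_distribution"
  interpret N: real_distribution ?N by (rule real_dist_normal_dist)
  define p where "p n = ereal (prob {\<omega> \<in> space M. \<bar>Y n \<omega>\<bar> \<ge> a})" for n
  obtain h where h: "strict_mono h" "(p \<circ> h) \<longlonglongrightarrow> limsup p"
    using limsup_subseq_lim by blast
  have "seq_compact {0..L}" by (simp add: compact_imp_seq_compact)
  then obtain w g where w: "w \<in> {0..L}" and g: "strict_mono g" "((v \<circ> h) \<circ> g) \<longlonglongrightarrow> w"
    using v by (elim seq_compactE[where f="v \<circ> h"]) auto
  define k where "k = h \<circ> g"
  have k: "strict_mono k" unfolding k_def using h g by (simp add: strict_mono_o)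
  have vk: "(\<lambda>n. v (k n)) \<longlonglongrightarrow> w" using g(2) by (simp add: k_def o_def)
  have pk: "(\<lambda>n. p (k n)) \<longlonglongrightarrow> limsup p"
    using LIMSEQ_subseq_LIMSEQ[OF h(2) g(1)] by (simp add: k_def o_def)
  define s where "s = sqrt w"
  have s: "0 \<le> s" "s\<^sup>2 = w" "s < \<sigma>"
    unfolding s_def using w \<sigma> by (auto intro: real_less_lsqrt)
  \<comment> \<open>Defined as an image of the standard normal law rather than by a density, since
    \<open>s = 0\<close> must be allowed; \<open>G\<close> is then the point mass at 0.\<close>
  define G where "G = distr ?N borel (\<lambda>x. s * x)"
  define Q where "Q n = distr M borel (Y (k n))" for n
  have G: "real_distribution G" unfolding G_def by (rule N.real_distribution_distr) simp
  have Q: "real_distribution (Q n)" for n unfolding Q_def by (rule real_distribution_distr) simp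
  have "weak_conv_m Q G"
  proof (rule levy_continuity[OF Q G])
    fix u
    have "char G u = char ?N (u * s)"
      unfolding char_def G_def by (subst integral_distr) (auto simp: mult.assoc)
    also have "\<dots> = of_real (exp (- (u\<^sup>2 * w / 2)))"
      unfolding char_std_normal_distribution by (simp add: power_mult_distrib s)
    finally have charG: "char G u = of_real (exp (- (u\<^sup>2 * w / 2)))" .
    have 1: "(\<lambda>n. cf (\<lambda>\<omega>. u * Y (k n) \<omega>) - of_real (exp (- (u\<^sup>2 * v (k n) / 2)))) \<longlonglongrightarrow> 0"
      using LIMSEQ_subseq_LIMSEQ[OF lim[of u] k] by (simp add: o_def)
    have 2: "(\<lambda>n. complex_of_real (exp (- (u\<^sup>2 * v (k n) / 2)))) \<longlonglongrightarrow> of_real (exp (- (u\<^sup>2 * w / 2)))"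
      by (intro tendsto_intros vk) simp
    show "(\<lambda>n. char (Q n) u) \<longlonglongrightarrow> char G u"
      using tendsto_add[OF 1 2] unfolding Q_def charG by (simp add: char_distr_eq_cf)
  qed
  let ?A = "{x::real. a \<le> \<bar>x\<bar>}"
  have A: "?A = {..-a} \<union> {a..}" by auto
  have A_sets[measurable]: "?A \<in> sets borel" unfolding A by simp
  have fr: "frontier ?A \<subseteq> {-a, a}"
  proof -
    have "closed ?A" unfolding A by (intro closed_Un) auto
    moreover have "{x. x < -a} \<union> {x. a < x} \<subseteq> interior ?A"
      by (intro interior_maximal open_Un open_Collect_less continuous_intros) auto
    ultimately show ?thesis unfolding frontier_def by (force simp: closure_closed)
  qed
  \<comment> \<open>For \<open>s = 0\<close> the preimage of the two boundary points is empty
    because \<open>a > 0\<close>; otherwise it is finite. Either way the tail set is a continuity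
    set of \<open>G\<close>.\<close>
  have G_pts: "emeasure G {-a, a} = 0"
  proof -
    have "emeasure G {-a, a} = emeasure ?N ((\<lambda>x. s * x) -` {-a, a} \<inter> space ?N)"
      unfolding G_def by (subst emeasure_distr) auto
    also have "\<dots> = 0"
    proof -
      have "finite ((\<lambda>x. s * x) -` {-a, a})"
      proof (cases "s = 0")
        case True
        then have "(\<lambda>x. s * x) -` {-a, a} = {}" using a by auto
        then show ?thesis by simp
      next
        case False
        then have "(\<lambda>x. s * x) -` {-a, a} \<subseteq> {- a / s, a / s}" by (auto simp: field_simps)
        then show ?thesis by (rule finite_subset) simp
      qed
      then have "(\<lambda>x. s * x) -` {-a, a} \<in> null_sets lborel" by (rule finite_imp_null_set_lborel)
      then have "(\<lambda>x. s * x) -` {-a, a} \<in> null_sets ?N"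
        using absolutely_continuousI_density[of std_normal_density lborel]
        by (auto simp: absolutely_continuous_def)
      then show ?thesis by auto
    qed
    finally show ?thesis .
  qed
  have "emeasure G (frontier ?A) \<le> emeasure G {-a, a}"
    using fr by (rule emeasure_mono) (simp add: G_def)
  then have "emeasure G (frontier ?A) = 0" using G_pts by simp
  then have "(\<lambda>n. measure (Q n) ?A) \<longlonglongrightarrow> measure G ?A"
    using weak_conv_imp_continuity_set_conv[OF Q G \<open>weak_conv_m Q G\<close> A_sets] by simp
  moreover have "measure (Q n) ?A = prob {\<omega> \<in> space M. \<bar>Y (k n) \<omega>\<bar> \<ge> a}" for n
    unfolding Q_def by (subst measure_distr) (auto simp: vimage_def Int_def conj_commute)
  ultimately have "(\<lambda>n. p (k n)) \<longlonglongrightarrow> ereal (measure G ?A)"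
    unfolding p_def by (auto intro: tendsto_ereal)
  then have "limsup p = ereal (measure G ?A)" using pk LIMSEQ_unique by blast
  also have "measure G ?A \<le> (\<integral>x. indicator (- {-a..a}) (\<sigma> * x) * std_normal_density x \<partial>lborel)"
  proof -
    have meas: "{x. \<sigma> * x \<in> - {-a..a}} \<in> sets borel" by measurable
    have "measure G ?A = measure ?N {x. a \<le> \<bar>s * x\<bar>}"
      unfolding G_def by (subst measure_distr) (auto simp: vimage_def)
    also have "\<dots> \<le> measure ?N {x. \<sigma> * x \<in> - {-a..a}}"
    proof (rule N.finite_measure_mono)
      show "{x. a \<le> \<bar>s * x\<bar>} \<subseteq> {x. \<sigma> * x \<in> - {-a..a}}"
      proof
        fix x assume "x \<in> {x. a \<le> \<bar>s * x\<bar>}"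
        then have x: "a \<le> s * \<bar>x\<bar>" using s by (simp add: abs_mult)
        then have "0 < \<bar>x\<bar>" using a s(1) by (cases "x = 0") auto
        then have "s * \<bar>x\<bar> < \<sigma> * \<bar>x\<bar>" using s(3) by (rule mult_strict_right_mono[rotated])
        then have "a < \<bar>\<sigma> * x\<bar>" using x \<sigma> by (simp add: abs_mult)
        then show "x \<in> {x. \<sigma> * x \<in> - {-a..a}}" by auto
      qed
    qed (use meas in simp)
    also have "\<dots> = (\<integral>x. indicator {x. \<sigma> * x \<in> - {-a..a}} x \<partial>?N)" using meas by simp
    also have "\<dots> = (\<integral>x. std_normal_density x *\<^sub>R indicator {x. \<sigma> * x \<in> - {-a..a}} x \<partial>lborel)"
      using meas by (intro integral_density) auto
    also have "\<dots> = (\<integral>x. indicator (- {-a..a}) (\<sigma> * x) * std_normal_density x \<partial>lborel)"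
      by (intro Bochner_Integration.integral_cong) (auto simp: indicator_def)
    finally show ?thesis .
  qed
  finally show ?thesis unfolding p_def by simp
qed

lemma obtain_nat_root:
  assumes "0 < m"
  obtains r :: "nat \<Rightarrow> nat" where "\<And>n. r n ^ m \<le> n" "\<And>n. n < (r n + 1) ^ m"
    "filterlim r at_top sequentially"
proof -
  define r where "r n = nat \<lfloor>root m (real n)\<rfloor>" for n
  have r: "real (r n) \<le> root m (real n)" "root m (real n) < real (r n) + 1" for n
    unfolding r_def using assms by auto
  have le: "r n ^ m \<le> n" for n
  proof -
    have "real (r n) ^ m \<le> root m (real n) ^ m" using r by (intro power_mono) auto
    also have "\<dots> = real n" using assms by simp
    finally show ?thesis by (metis of_nat_le_iff of_nat_power)
  qed
  have less: "n < (r n + 1) ^ m" for n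
  proof -
    have "real n = root m (real n) ^ m" using assms by simp
    also have "\<dots> < (real (r n) + 1) ^ m" using r assms by (intro power_strict_mono) auto
    finally have "real n < real ((r n + 1) ^ m)" by (simp add: add.commute)
    then show ?thesis by (simp only: of_nat_less_iff)
  qed
  have "filterlim r at_top sequentially"
    unfolding filterlim_at_top eventually_sequentially
  proof safe
    fix Z
    have "Z \<le> r n" if "Z ^ m \<le> n" for n
    proof (rule ccontr)
      assume "\<not> Z \<le> r n"
      then have "(r n + 1) ^ m \<le> Z ^ m" by (intro power_mono) auto
      then show False using less[of n] that by simp
    qed
    then show "\<exists>N. \<forall>n\<ge>N. Z \<le> r n" by blast
  qed
  then show thesis using that le less by blast
qed

section \<open>Choice of the block sizes and the tail bound\<close>

context lindley_walk
begin

text \<open>With \<open>n\<close> of order \<open>r ^ 20\<close> there are about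
  \<open>r ^ 14\<close> blocks. The gaps occupy a fraction \<open>q / p = 1 / r\<close>, mixing
  costs about \<open>N / q ^ 3 = 1 / r\<close>, and the fourth moments cost about
  \<open>N * p ^ 4 / n\<^sup>2 = 1 / r\<^sup>2\<close> before division by \<open>\<eta>\<close>.
  Half of each gap serves as window.\<close>

lemma gaussian_approximation:
  assumes c: "0 < c" and \<alpha>: "\<And>n. n \<ge> 1 \<Longrightarrow> alpha_mixing M X n \<le> c / real n ^ 3"
    and L: "0 \<le> L" "\<And>A. finite A \<Longrightarrow> expectation (\<lambda>\<omega>. (\<Sum>k\<in>A. W k \<omega> - expectation (W k))\<^sup>2) \<le> L * real (card A)"
  obtains v :: "nat \<Rightarrow> real" where "\<And>n. 0 \<le> v n" "\<And>n. v n \<le> L"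
    "\<And>u. (\<lambda>n. cf (\<lambda>\<omega>. u * (T n \<omega> / sqrt (real n))) - of_real (exp (- (u\<^sup>2 * v n / 2)))) \<longlonglongrightarrow> 0"
proof -
  obtain r :: "nat \<Rightarrow> nat" where r: "\<And>n. r n ^ 20 \<le> n" "\<And>n. n < (r n + 1) ^ 20" "filterlim r at_top sequentially"
    using obtain_nat_root[of 20] by auto
  define p q N m where "p n = r n ^ 6" and "q n = r n ^ 5" and "N n = n div (p n + q n)" and "m n = q n div 2" for n
  \<comment> \<open>It has to vanish, but more slowly than \<open>1 / r\<^sup>2\<close>; the added 1
    keeps it positive also when \<open>r n = 0\<close>.\<close>
  define \<eta> where "\<eta> n = 1 / (real (r n) + 1)" for n
  have "\<forall>n. \<exists>w. 0 \<le> w \<and> w \<le> L * real n \<and> (\<forall>a.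
    cmod (cf (\<lambda>\<omega>. a * T n \<omega>) - of_real (exp (- (a\<^sup>2 * w / 2)))) \<le>
      \<bar>a\<bar> * sqrt (L * real (n - N n * p n)) + 2 * (\<bar>a\<bar> * real n * (D / t * \<rho> ^ m n)) + real (N n) * (16 * alpha_mixing M X (q n - m n)) +
      real (N n) * ((\<eta> n * (a\<^sup>2 * (L * real (p n))) + a ^ 4 * (real (p n) ^ 4 * C4) / \<eta> n) / 12 + (a\<^sup>2 * (L * real (p n)))\<^sup>2 / 4))"
    using L by (intro allI cf_blocks) (auto simp: N_def m_def \<eta>_def)
  then obtain w where w: "\<And>n. 0 \<le> w n" "\<And>n. w n \<le> L * real n" and cfw: "\<And>n a.
    cmod (cf (\<lambda>\<omega>. a * T n \<omega>) - of_real (exp (- (a\<^sup>2 * w n / 2)))) \<le>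
      \<bar>a\<bar> * sqrt (L * real (n - N n * p n)) + 2 * (\<bar>a\<bar> * real n * (D / t * \<rho> ^ m n)) + real (N n) * (16 * alpha_mixing M X (q n - m n)) +
      real (N n) * ((\<eta> n * (a\<^sup>2 * (L * real (p n))) + a ^ 4 * (real (p n) ^ 4 * C4) / \<eta> n) / 12 + (a\<^sup>2 * (L * real (p n)))\<^sup>2 / 4)"
    by metis
  have C4: "0 \<le> C4" unfolding C4_def using D_ge_1 t_pos by auto
  \<comment> \<open>A majorant of the errors of \<open>cf_blocks\<close> in the single real variable
    \<open>R = real (r n)\<close>; \<open>n\<close> is eliminated by \<open>R ^ 20 \<le> n\<close>
    and \<open>n \<le> (R + 1) ^ 20\<close>.\<close>
  define e where "e u R = \<bar>u\<bar> * sqrt (L * (1 / R + (R ^ 6 + R ^ 5) / R ^ 20)) + 2 * (\<bar>u\<bar> * (R + 1) ^ 10 * (D / t * \<rho> powr R)) +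
     (R + 1) ^ 20 / R ^ 6 * (16 * (8 * c / R ^ 15)) +
     ((u\<^sup>2 * L / (R + 1) + u ^ 4 * C4 * (R ^ 18 * (R + 1) / R ^ 20)) / 12 + u ^ 4 * L\<^sup>2 * (R ^ 6 / R ^ 20) / 4)" for u R :: real
  have e_lim: "((\<lambda>R. e u R) \<longlongrightarrow> 0) at_top" for u
  proof -
    have 1: "((\<lambda>R. \<bar>u\<bar> * sqrt (L * (1 / R + (R ^ 6 + R ^ 5) / R ^ 20))) \<longlongrightarrow> \<bar>u\<bar> * sqrt (L * 0)) at_top"
      by (intro tendsto_intros) real_asymp
    have "((\<lambda>R. 2 * (\<bar>u\<bar> * ((R + 1) ^ 10 * \<rho> powr R) * (D / t))) \<longlongrightarrow> 2 * (\<bar>u\<bar> * 0 * (D / t))) at_top"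
      by (intro tendsto_intros) (use \<rho> in real_asymp)
    then have 2: "((\<lambda>R. 2 * (\<bar>u\<bar> * (R + 1) ^ 10 * (D / t * \<rho> powr R))) \<longlongrightarrow> 0) at_top"
      by (simp add: mult_ac)
    have 3: "((\<lambda>R. (R + 1) ^ 20 / R ^ 6 * (16 * (8 * c / R ^ 15))) \<longlongrightarrow> 0) at_top" by real_asymp
    have 4: "((\<lambda>R. (u\<^sup>2 * L / (R + 1) + u ^ 4 * C4 * (R ^ 18 * (R + 1) / R ^ 20)) / 12 + u ^ 4 * L\<^sup>2 * (R ^ 6 / R ^ 20) / 4)
        \<longlongrightarrow> (0 + u ^ 4 * C4 * 0) / 12 + u ^ 4 * L\<^sup>2 * 0 / 4) at_top"
    proof -
      have "((\<lambda>R. u\<^sup>2 * L / (R + 1)) \<longlongrightarrow> 0) at_top" by real_asymp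
      moreover have "((\<lambda>R::real. R ^ 18 * (R + 1) / R ^ 20) \<longlongrightarrow> 0) at_top" by real_asymp
      moreover have "((\<lambda>R::real. R ^ 6 / R ^ 20) \<longlongrightarrow> 0) at_top" by real_asymp
      ultimately show ?thesis by (intro tendsto_intros) simp_all
    qed
    show ?thesis
      using tendsto_add[OF tendsto_add[OF tendsto_add[OF 1 2] 3] 4] unfolding e_def by simp
  qed
  have bound: "cmod (cf (\<lambda>\<omega>. u * (T n \<omega> / sqrt (real n))) - of_real (exp (- (u\<^sup>2 * (w n / real n) / 2)))) \<le> e u (real (r n))"
    if r2: "2 \<le> r n" for u n
  proof -
    define R where "R = real (r n)"
    define a where "a = u / sqrt (real n)"
    have n: "0 < n" using r2 r(1)[of n] by (cases "n = 0") auto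
    have R: "2 \<le> R" unfolding R_def using r2 by simp
    have Rn: "R ^ 20 \<le> real n" "real n \<le> (R + 1) ^ 20"
    proof -
      have "real (r n ^ 20) \<le> real n" "real n \<le> real ((r n + 1) ^ 20)"
        using r(1)[of n] less_imp_le[OF r(2)[of n]] by (simp_all only: of_nat_le_iff)
      then show "R ^ 20 \<le> real n" "real n \<le> (R + 1) ^ 20" unfolding R_def by (simp_all add: add.commute)
    qed
    have P: "real (p n) = R ^ 6" "real (q n) = R ^ 5" unfolding p_def q_def R_def by simp_all
    have a2: "a\<^sup>2 = u\<^sup>2 / real n" unfolding a_def by (simp add: power_divide)
    have a4: "a ^ 4 = u ^ 4 / (real n)\<^sup>2"
    proof -
      have "a ^ 4 = (a\<^sup>2)\<^sup>2" by simp
      then show ?thesis unfolding a2 by (simp add: power_divide)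
    qed
    have absa: "\<bar>a\<bar> = \<bar>u\<bar> / sqrt (real n)" unfolding a_def by simp
    have Nb: "N n * (p n + q n) \<le> n" unfolding N_def by simp
    have Np: "real (N n) * R ^ 6 \<le> real n"
    proof -
      have "N n * p n \<le> n" using Nb by (simp add: distrib_left)
      then have "real (N n * p n) \<le> real n" by (simp only: of_nat_le_iff)
      then show ?thesis by (simp add: P)
    qed
    have N_le: "real (N n) \<le> real n / R ^ 6" using Np R by (simp add: field_simps)
    have b1: "\<bar>a\<bar> * sqrt (L * real (n - N n * p n)) \<le> \<bar>u\<bar> * sqrt (L * (1 / R + (R ^ 6 + R ^ 5) / R ^ 20))"
    proof -
      have "n - N n * p n \<le> N n * q n + (p n + q n)"
      proof -
        have "n = N n * (p n + q n) + n mod (p n + q n)"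
          unfolding N_def by (rule div_mult_mod_eq[symmetric])
        moreover have "n mod (p n + q n) \<le> p n + q n"
          using r2 by (intro less_imp_le mod_less_divisor) (simp add: p_def)
        ultimately show ?thesis by (simp add: distrib_left)
      qed
      then have "real (n - N n * p n) \<le> real (N n * q n + (p n + q n))" by (simp only: of_nat_le_iff)
      also have "\<dots> = real (N n) * R ^ 5 + (R ^ 6 + R ^ 5)" by (simp add: P)
      also have "\<dots> \<le> real n / R ^ 6 * R ^ 5 + (R ^ 6 + R ^ 5)" using N_le R by (intro add_mono mult_right_mono) auto
      also have "real n / R ^ 6 * R ^ 5 = real n * (1 / R)" using R by (simp add: field_simps eval_nat_numeral)
      also have "real n * (1 / R) + (R ^ 6 + R ^ 5) \<le> real n * (1 / R) + real n * ((R ^ 6 + R ^ 5) / R ^ 20)"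
      proof -
        have "R ^ 20 * ((R ^ 6 + R ^ 5) / R ^ 20) \<le> real n * ((R ^ 6 + R ^ 5) / R ^ 20)"
          using Rn R by (intro mult_right_mono) auto
        then show ?thesis using R by simp
      qed
      finally have "real (n - N n * p n) \<le> real n * (1 / R + (R ^ 6 + R ^ 5) / R ^ 20)" by (simp add: distrib_left)
      then have "sqrt (L * real (n - N n * p n)) \<le> sqrt (real n * (L * (1 / R + (R ^ 6 + R ^ 5) / R ^ 20)))"
        using L(1) mult_left_mono[of "real (n - N n * p n)" "real n * (1 / R + (R ^ 6 + R ^ 5) / R ^ 20)" L]
        by (intro real_sqrt_le_mono) (simp add: mult_ac)
      also have "\<dots> = sqrt (real n) * sqrt (L * (1 / R + (R ^ 6 + R ^ 5) / R ^ 20))" by (rule real_sqrt_mult)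
      finally have "\<bar>a\<bar> * sqrt (L * real (n - N n * p n)) \<le> \<bar>a\<bar> * (sqrt (real n) * sqrt (L * (1 / R + (R ^ 6 + R ^ 5) / R ^ 20)))"
        by (intro mult_left_mono) auto
      then show ?thesis unfolding absa using n by simp
    qed
    have b2: "2 * (\<bar>a\<bar> * real n * (D / t * \<rho> ^ m n)) \<le> 2 * (\<bar>u\<bar> * (R + 1) ^ 10 * (D / t * \<rho> powr R))"
    proof -
      \<comment> \<open>From \<open>r n \<ge> 2\<close> one gets \<open>q n \<ge> 16 * r n\<close>.
        Much of the window is given away, but \<open>\<rho> ^ r n\<close> already beats
        \<open>sqrt n\<close>, which is at most a power of \<open>r n + 1\<close>.\<close>
      have "r n \<le> m n"
      proof -
        have "r n * 2 ^ 4 \<le> r n * r n ^ 4" using r2 by (intro mult_left_mono power_mono) auto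
        also have "\<dots> = q n" unfolding q_def by (simp add: eval_nat_numeral)
        finally show ?thesis unfolding m_def by simp
      qed
      then have "\<rho> ^ m n \<le> \<rho> ^ r n" using \<rho> by (intro power_decreasing) auto
      also have "\<dots> = \<rho> powr R" unfolding R_def using \<rho> by (simp add: powr_realpow)
      finally have 1: "\<rho> ^ m n \<le> \<rho> powr R" .
      have "\<bar>a\<bar> * real n = \<bar>u\<bar> * sqrt (real n)" unfolding absa
        using real_div_sqrt[of "real n"] by (simp add: times_divide_eq_right[symmetric] del: times_divide_eq_right)
      also have "\<dots> \<le> \<bar>u\<bar> * (R + 1) ^ 10"
      proof (rule mult_left_mono)
        have "real n \<le> ((R + 1) ^ 10)\<^sup>2" using Rn(2) by (simp add: power_mult[symmetric])
        then show "sqrt (real n) \<le> (R + 1) ^ 10" using R by (intro real_le_lsqrt) auto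
      qed simp
      finally have "\<bar>a\<bar> * real n \<le> \<bar>u\<bar> * (R + 1) ^ 10" .
      moreover have "D / t * \<rho> ^ m n \<le> D / t * \<rho> powr R"
        using 1 D_ge_1 t_pos by (intro mult_left_mono) auto
      ultimately have "(\<bar>a\<bar> * real n) * (D / t * \<rho> ^ m n) \<le> (\<bar>u\<bar> * (R + 1) ^ 10) * (D / t * \<rho> powr R)"
        by (rule mult_mono) (use D_ge_1 t_pos \<rho> R in auto)
      then show ?thesis by simp
    qed
    have b3: "real (N n) * (16 * alpha_mixing M X (q n - m n)) \<le> (R + 1) ^ 20 / R ^ 6 * (16 * (8 * c / R ^ 15))"
    proof -
      have q1: "1 \<le> q n" unfolding q_def using r2 by simp
      have half: "R ^ 5 / 2 \<le> real (q n - m n)" unfolding m_def P(2)[symmetric] by linarith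
      have "alpha_mixing M X (q n - m n) \<le> c / real (q n - m n) ^ 3"
        using q1 by (intro \<alpha>) (auto simp: m_def)
      also have "\<dots> \<le> c / (R ^ 5 / 2) ^ 3"
      proof (intro divide_left_mono power_mono half mult_pos_pos zero_less_power)
        show "0 < real (q n - m n)" using q1 by (simp add: m_def)
      qed (use c R in auto)
      also have "\<dots> = 8 * c / R ^ 15" by (simp add: power_divide power_mult[symmetric])
      finally have 1: "alpha_mixing M X (q n - m n) \<le> 8 * c / R ^ 15" .
      have "real (N n) \<le> (R + 1) ^ 20 / R ^ 6"
        using N_le Rn R by (intro order_trans[OF N_le] divide_right_mono) auto
      with 1 show ?thesis using R alpha_mixing_nonneg[of X] by (intro mult_mono mult_left_mono) auto
    qed
    have b4: "real (N n) * ((\<eta> n * (a\<^sup>2 * (L * real (p n))) + a ^ 4 * (real (p n) ^ 4 * C4) / \<eta> n) / 12 + (a\<^sup>2 * (L * real (p n)))\<^sup>2 / 4)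
      \<le> (u\<^sup>2 * L / (R + 1) + u ^ 4 * C4 * (R ^ 18 * (R + 1) / R ^ 20)) / 12 + u ^ 4 * L\<^sup>2 * (R ^ 6 / R ^ 20) / 4"
    proof -
      \<comment> \<open>The fraction of the indices covered by blocks; factoring it out removes the
        number of blocks from the estimate.\<close>
      define y where "y = real (N n) * R ^ 6 / real n"
      have y: "0 \<le> y" "y \<le> 1" unfolding y_def using Np n R by (auto simp: divide_le_eq)
      define z where "z = 1 / real n"
      have z: "0 \<le> z" "z \<le> 1 / R ^ 20" unfolding z_def using Rn R n by (auto intro!: divide_left_mono)
      have "real (N n) * ((\<eta> n * (a\<^sup>2 * (L * real (p n))) + a ^ 4 * (real (p n) ^ 4 * C4) / \<eta> n) / 12 + (a\<^sup>2 * (L * real (p n)))\<^sup>2 / 4)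
        = y * ((u\<^sup>2 * L / (R + 1) + u ^ 4 * C4 * (R ^ 18 * (R + 1) * z)) / 12 + u ^ 4 * L\<^sup>2 * (R ^ 6 * z) / 4)"
      proof -
        have id: "k * ((1 / s * (U * z * (L * b)) + U\<^sup>2 * z\<^sup>2 * (b ^ 4 * C4) / (1 / s)) / 12 + (U * z * (L * b))\<^sup>2 / 4)
          = k * b * z * ((U * L / s + U\<^sup>2 * C4 * (b ^ 3 * s * z)) / 12 + U\<^sup>2 * L\<^sup>2 * (b * z) / 4)"
          if "s \<noteq> 0" for k U b s :: real
          using that by (simp add: field_simps eval_nat_numeral)
        have "a\<^sup>2 = u\<^sup>2 * z" "a ^ 4 = (u\<^sup>2)\<^sup>2 * z\<^sup>2"
          unfolding a4 a2 z_def by (simp_all add: power_divide)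
        moreover have "y = real (N n) * R ^ 6 * z" unfolding y_def z_def by simp
        ultimately show ?thesis
          using id[of "R + 1" "real (N n)" "u\<^sup>2" "R ^ 6"] R unfolding P \<eta>_def R_def[symmetric] by simp
      qed
      also have "\<dots> \<le> 1 * ((u\<^sup>2 * L / (R + 1) + u ^ 4 * C4 * (R ^ 18 * (R + 1) * (1 / R ^ 20))) / 12 + u ^ 4 * L\<^sup>2 * (R ^ 6 * (1 / R ^ 20)) / 4)"
        using y z R L(1) C4
        by (intro mult_mono add_mono divide_right_mono mult_left_mono) (auto intro!: add_nonneg_nonneg mult_nonneg_nonneg divide_nonneg_nonneg)
      finally show ?thesis by simp
    qed
    have eq: "u * (T n \<omega> / sqrt (real n)) = a * T n \<omega>" "u\<^sup>2 * (w n / real n) = a\<^sup>2 * w n" for \<omega>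
      unfolding a2 by (simp_all add: a_def)
    show ?thesis unfolding eq
      using cfw[of a n] b1 b2 b3 b4 unfolding e_def R_def by linarith
  qed
  show thesis
  proof (rule that[of "\<lambda>n. w n / real n"])
    show "0 \<le> w n / real n" for n using w by simp
    show "w n / real n \<le> L" for n using w(2)[of n] L(1) by (cases "n = 0") (auto simp: divide_le_eq)
    fix u
    have "filterlim (\<lambda>n. real (r n)) at_top sequentially"
      by (rule filterlim_compose[OF filterlim_real_sequentially r(3)])
    then have "(\<lambda>n. e u (real (r n))) \<longlonglongrightarrow> 0" by (rule filterlim_compose[OF e_lim])
    moreover have "eventually (\<lambda>n. 2 \<le> r n) sequentially"
      using r(3) by (simp add: filterlim_at_top)
    then have "eventually (\<lambda>n. norm (cf (\<lambda>\<omega>. u * (T n \<omega> / sqrt (real n))) - of_real (exp (- (u\<^sup>2 * (w n / real n) / 2)))) \<le> e u (real (r n))) sequentially"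
      by (rule eventually_mono) (rule bound)
    ultimately show "(\<lambda>n. cf (\<lambda>\<omega>. u * (T n \<omega> / sqrt (real n))) - of_real (exp (- (u\<^sup>2 * (w n / real n) / 2)))) \<longlonglongrightarrow> 0"
      by (rule Lim_null_comparison[rotated])
  qed
qed

theorem central_limit_bound:
  assumes c: "0 < c" and \<alpha>: "\<And>n. n \<ge> 1 \<Longrightarrow> alpha_mixing M X n \<le> c / real n ^ 3"
  shows "\<exists>\<sigma>>0. \<forall>a>0. limsup (\<lambda>n. ereal (prob {\<omega> \<in> space M. 1 / sqrt (real n) * \<bar>T n \<omega>\<bar> \<ge> a}))
    \<le> ereal (\<integral>x. indicator (- {-a..a}) (\<sigma> * x) * std_normal_density x \<partial>lborel)"
proof -
  have "alpha_mixing M X n \<le> c * real n powr (- 3)" if "n \<ge> 1" for n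
    using \<alpha>[OF that] that by (simp add: powr_minus divide_inverse)
  then obtain L :: real where L: "0 < L"
    "\<And>A. finite A \<Longrightarrow> expectation (\<lambda>\<omega>. (\<Sum>k\<in>A. W k \<omega> - expectation (W k))\<^sup>2) \<le> L * card A"
    using centered_sum_square_linear[of 3 c] c by auto
  obtain v where v: "\<And>n. 0 \<le> v n" "\<And>n. v n \<le> L"
    and lim: "\<And>u. (\<lambda>n. cf (\<lambda>\<omega>. u * (T n \<omega> / sqrt (real n))) - of_real (exp (- (u\<^sup>2 * v n / 2)))) \<longlonglongrightarrow> 0"
    using gaussian_approximation[OF c \<alpha> less_imp_le[OF L(1)] L(2)] by blast
  \<comment> \<open>The added 1 makes \<open>\<sigma>\<^sup>2\<close> strictly larger than the
    common bound \<open>L\<close> of the variances, as the comparison of tails requires.\<close>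
  define \<sigma> where "\<sigma> = sqrt (L + 1)"
  have \<sigma>: "0 < \<sigma>" "L < \<sigma>\<^sup>2" unfolding \<sigma>_def using L by auto
  have [measurable]: "T n \<in> borel_measurable M" for n unfolding T_def by measurable
  have eq: "1 / sqrt (real n) * \<bar>x\<bar> = \<bar>x / sqrt (real n)\<bar>" for n x by simp
  show ?thesis
    unfolding eq
    by (intro exI[of _ \<sigma>] conjI allI impI \<sigma>(1) limsup_prob_le_of_cf[OF _ v \<sigma> lim]) simp_all
qed

end

text \<open>Since the coefficients decrease, the terms up to \<open>n\<close> add up to at least
  \<open>alpha_mixing M X n powr \<delta>\<close> times a sum of squares of order
  \<open>n ^ 3\<close>. As the coefficients are at most 1 and \<open>\<delta> < 1\<close>, dropping
  the power only decreases the left-hand side.\<close>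

lemma (in prob_space) alpha_mixing_le_of_summable:
  assumes \<delta>: "0 < \<delta>" "\<delta> < 1" and sum: "summable (\<lambda>n. (real n + 1)\<^sup>2 * alpha_mixing M X n powr \<delta>)"
  shows "\<exists>c>0. \<forall>n\<ge>1. alpha_mixing M X n \<le> c / real n ^ 3"
proof -
  let ?\<alpha> = "alpha_mixing M X"
  let ?f = "\<lambda>n. (real n + 1)\<^sup>2 * ?\<alpha> n powr \<delta>"
  have cube: "real n ^ 3 / 3 \<le> (\<Sum>k\<le>n. (real k + 1)\<^sup>2)" for n
  proof (induction n)
    case (Suc n)
    have "real (Suc n) ^ 3 / 3 \<le> real n ^ 3 / 3 + (real (Suc n) + 1)\<^sup>2"
      by (simp add: power2_eq_square power3_eq_cube field_simps)
    then show ?case using Suc by simp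
  qed simp
  have f0: "0 \<le> ?f n" for n by simp
  have "?\<alpha> n \<le> (3 * suminf ?f + 1) / real n ^ 3" if n: "n \<ge> 1" for n
  proof -
    have "real n ^ 3 / 3 * ?\<alpha> n powr \<delta> \<le> (\<Sum>k\<le>n. (real k + 1)\<^sup>2) * ?\<alpha> n powr \<delta>"
      using cube by (intro mult_right_mono) auto
    also have "\<dots> \<le> (\<Sum>k\<le>n. ?f k)"
      unfolding sum_distrib_right using \<delta> alpha_mixing_nonneg
      by (intro sum_mono mult_left_mono powr_mono2 alpha_mixing_antimono) auto
    also have "\<dots> \<le> suminf ?f" using sum f0 by (intro sum_le_suminf) auto
    finally have "?\<alpha> n powr \<delta> \<le> 3 * suminf ?f / real n ^ 3" using n by (simp add: field_simps)
    moreover have "?\<alpha> n \<le> ?\<alpha> n powr \<delta>"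
    proof (cases "?\<alpha> n = 0")
      case False
      have "?\<alpha> n \<le> 1" by (rule alpha_mixing_le) (rule abs_prob_diff_le_1)
      then have "?\<alpha> n powr 1 \<le> ?\<alpha> n powr \<delta>"
        using \<delta> alpha_mixing_nonneg[of X n] by (intro powr_mono') auto
      then show ?thesis using alpha_mixing_nonneg[of X n] False by simp
    qed simp
    moreover have "3 * suminf ?f / real n ^ 3 \<le> (3 * suminf ?f + 1) / real n ^ 3"
      by (intro divide_right_mono) auto
    ultimately show ?thesis by linarith
  qed
  moreover have "0 < 3 * suminf ?f + 1" using suminf_nonneg[OF sum f0] by simp
  ultimately show ?thesis by blast
qed

section \<open>Transfer from services and inter-arrival times to the increments\<close>

theorem theorem3p13:
  fixes P :: "'a measure"
    and S Z :: "nat \<Rightarrow> 'a \<Rightarrow> real"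
    and M t_bar \<gamma>_bar r :: real
  assumes "prob_space P"
    and M_pos: "M > 0"
    and S_meas: "\<And>n. S n \<in> borel_measurable P"
    and S_range: "\<And>n \<omega>. \<omega> \<in> space P \<Longrightarrow> S n \<omega> \<in> {0..M}"
    and Z_meas: "\<And>n. n \<ge> 1 \<Longrightarrow> Z n \<in> borel_measurable P"
    and Z_range: "\<And>n \<omega>. n \<ge> 1 \<Longrightarrow> \<omega> \<in> space P \<Longrightarrow> Z n \<omega> \<in> {0..}"
    and Z_indep: "prob_space.indep_vars P (\<lambda>_. borel) Z {1..}"
    and Z_ident: "\<And>n. n \<ge> 1 \<Longrightarrow> distr P borel (Z n) = distr P borel (Z 1)"
    and Z_S_indep: "prob_space.indep_var P
          (\<Pi>\<^sub>M n\<in>{1..}. borel) (\<lambda>\<omega>. \<lambda>n\<in>{1..}. Z n \<omega>)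
          (\<Pi>\<^sub>M n\<in>UNIV. borel) (\<lambda>\<omega> n. S n \<omega>)"
    and Z_sq: "integrable P (\<lambda>\<omega>. (Z 1 \<omega>)\<^sup>2)"
    and t_bar_pos: "t_bar > 0"
    and rate_neg: "log_mgf_rate P S Z t_bar < 0"
    and \<gamma>_bar: "\<gamma>_bar = exp (real_of_ereal (log_mgf_rate P S Z t_bar))"
    and r: "0 < r" "r < 1 / \<gamma>_bar"
    and Z_large: "measure P {\<omega> \<in> space P. Z 1 \<omega> \<ge> M + 1 / t_bar * ln (1 + 2 / r)} > 0"
  shows
    "((alpha_mixing P S \<longlonglongrightarrow> 0) \<longrightarrow>
        (\<lambda>n. \<integral>\<^sup>+\<omega>. ennreal \<bar>1 / real n * centered_sum P S Z n \<omega>\<bar> \<partial>P) \<longlonglongrightarrow> 0)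
     \<and>
     ((\<exists>c \<kappa>. c > 0 \<and> \<kappa> > 1 \<and> (\<forall>n\<ge>1. alpha_mixing P S n \<le> c * real n powr (- \<kappa>))) \<longrightarrow>
        (AE \<omega> in P. (\<lambda>n. 1 / real n * centered_sum P S Z n \<omega>) \<longlonglongrightarrow> 0))
     \<and>
     ((\<exists>\<delta>. 0 < \<delta> \<and> \<delta> < 1 \<and> summable (\<lambda>n. (real n + 1)\<^sup>2 * alpha_mixing P S n powr \<delta>)) \<longrightarrow>
        (\<exists>\<sigma>>0. \<forall>a>0.
           limsup (\<lambda>n. ereal (measure P
             {\<omega> \<in> space P. 1 / sqrt (real n) * \<bar>centered_sum P S Z n \<omega>\<bar> \<ge> a}))
           \<le> ereal (\<integral>t. indicator (- {-a..a}) (\<sigma> * t) * std_normal_density t \<partial>lborel)))"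
proof -
  interpret prob_space P by fact
  define X where "X k \<omega> = S k \<omega> - Z (Suc k) \<omega>" for k \<omega>
  obtain C \<rho> where \<rho>: "0 < \<rho>" "\<rho> < 1" and decay:
    "\<And>i d. expectation (\<lambda>\<omega>. exp (t_bar * (\<Sum>l\<in>{i..<i + d}. X l \<omega>))) \<le> C * \<rho> ^ d"
    using exponential_decay_of_log_mgf_rate(1)[OF S_meas S_range Z_meas Z_range t_bar_pos rate_neg]
    unfolding X_def by blast
  interpret lindley_walk P X t_bar C \<rho>
  proof
    show "X k \<in> borel_measurable P" for k
      unfolding X_def using S_meas Z_meas[of "Suc k"] by simp
    show "integrable P (\<lambda>\<omega>. exp (t_bar * (\<Sum>l\<in>{i..<i + d}. X l \<omega>)))" for i d
      unfolding X_def
      by (rule exponential_decay_of_log_mgf_rate(2)[OF S_meas S_range Z_meas Z_range t_bar_pos rate_neg])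
  qed (fact t_bar_pos \<rho> decay)+
  have "waiting_time S Z n \<omega> = lindley X 0 n \<omega>" for n \<omega>
    by (induction n) (auto simp: X_def algebra_simps)
  then have "waiting_time S Z = lindley X 0" by (intro ext)
  then have T_eq: "centered_sum P S Z n \<omega> = T n \<omega>" for n \<omega>
    unfolding centered_sum_def T_def by simp
  \<comment> \<open>At \<open>n = 0\<close> past and future would share \<open>Z (j + 1)\<close>;
    the limits and rates below only need \<open>n \<ge> 1\<close>.\<close>
  have \<alpha>_le: "alpha_mixing P X n \<le> alpha_mixing P S n" if "n \<ge> 1" for n
    using alpha_mixing_diff_indep_le[OF S_meas Z_indep Z_S_indep that] unfolding X_def .
  show ?thesis
    unfolding T_eq
  proof (intro conjI impI)
    assume "alpha_mixing P S \<longlonglongrightarrow> 0"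
    moreover have "eventually (\<lambda>n. norm (alpha_mixing P X n) \<le> alpha_mixing P S n) sequentially"
      using \<alpha>_le by (intro eventually_sequentiallyI[of 1]) (simp add: alpha_mixing_nonneg)
    ultimately have "alpha_mixing P X \<longlonglongrightarrow> 0" by (rule Lim_null_comparison[rotated])
    then show "(\<lambda>n. \<integral>\<^sup>+\<omega>. ennreal \<bar>1 / real n * T n \<omega>\<bar> \<partial>P) \<longlonglongrightarrow> 0"
      by (rule L1_law_of_large_numbers)
  next
    assume "\<exists>c \<kappa>. c > 0 \<and> \<kappa> > 1 \<and> (\<forall>n\<ge>1. alpha_mixing P S n \<le> c * real n powr (- \<kappa>))"
    then obtain c \<kappa> where c: "c > 0" "\<kappa> > 1" "\<And>n. n \<ge> 1 \<Longrightarrow> alpha_mixing P S n \<le> c * real n powr (- \<kappa>)"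
      by blast
    show "AE \<omega> in P. (\<lambda>n. 1 / real n * T n \<omega>) \<longlonglongrightarrow> 0"
      by (rule strong_law_of_large_numbers[OF c(2,1) order_trans[OF \<alpha>_le c(3)]])
  next
    assume "\<exists>\<delta>. 0 < \<delta> \<and> \<delta> < 1 \<and> summable (\<lambda>n. (real n + 1)\<^sup>2 * alpha_mixing P S n powr \<delta>)"
    \<comment> \<open>Summability is exploited for \<open>S\<close> itself, and only the resulting
      power bound is transferred to \<open>X\<close>.\<close>
    then obtain c where c: "c > 0" "\<And>n. n \<ge> 1 \<Longrightarrow> alpha_mixing P S n \<le> c / real n ^ 3"
      using alpha_mixing_le_of_summable by blast
    show "\<exists>\<sigma>>0. \<forall>a>0.
           limsup (\<lambda>n. ereal (measure P {\<omega> \<in> space P. 1 / sqrt (real n) * \<bar>T n \<omega>\<bar> \<ge> a}))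
           \<le> ereal (\<integral>t. indicator (- {-a..a}) (\<sigma> * t) * std_normal_density t \<partial>lborel)"
      by (rule central_limit_bound[OF c(1)]) (rule order_trans[OF \<alpha>_le c(2)])
  qed
qed

end
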